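(* Let $X$ be a separable Banach space such that $\mathrm{SP_w}(X)$ is uncountable. Then $\mathrm{SP_w}(X)$ contains an antichain of the size of the continuum, i.e. a subset of cardinality $2^{\aleph_0}$ whose elements are pairwise incomparable with respect to domination.
   Context: Banach spaces are real, and $\mathbb{N}=\{0,1,2,\dots\}$. Domination and equivalence: for Schauder basic sequences $(x_n)_n$, $(y_n)_n$ (possibly in different Banach spaces), $(x_n)_n$ is dominated by $(y_n)_n$, written $(x_n)_n\leq (y_n)_n$, if there is $C\geq 1$ with $\|\sum_{n=0}^k a_nx_n\|\leq C\|\sum_{n=0}^k a_ny_n\|$ for every $k\in\mathbb{N}$ and $a_0,\dots,a_k\in\mathbb{R}$. Two sequences are equivalent if each is dominated by the other, and incomparable if neither is dominated by the other. Spreading models: a sequence $(x_n)_n$ is seminormalized if $0<\inf_n\|x_n\|\leq\sup_n\|x_n\|<\infty$. A sequence $(y_n)_n$ in some Banach space is a spreading model generated by a seminormalized sequence $(x_n)_n$ if there is a sequence $\varepsilon_k\downarrow 0$ such that for every $k\geq 1$, all $k\leq n_0<\dots<n_{k-1}$ and all $a_0,\dots,a_{k-1}\in[-1,1]$ we have $\big|\,\|\sum_{i<k}a_ix_{n_i}\|-\|\sum_{i<k}a_iy_i\|\,\big|<\varepsilon_k$. $\mathrm{SP_w}(X)$ is the set of all spreading models generated by (seminormalized) weakly-null sequences in $X$, modulo equivalence, ordered by domination $\leq$. *)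

theory Defs
  imports "HOL-Analysis.Analysis" "HOL-Probability.Discrete_Topology"
begin

definition dominated :: "(nat \<Rightarrow> 'a::real_normed_vector) \<Rightarrow> (nat \<Rightarrow> 'b::real_normed_vector) \<Rightarrow> bool"
  where "dominated x y \<longleftrightarrow>
    (\<exists>C\<ge>1. \<forall>k. \<forall>a :: nat \<Rightarrow> real.
      norm (\<Sum>n=0..k. a n *\<^sub>R x n) \<le> C * norm (\<Sum>n=0..k. a n *\<^sub>R y n))"

definition seq_equivalent :: "(nat \<Rightarrow> 'a::real_normed_vector) \<Rightarrow> (nat \<Rightarrow> 'b::real_normed_vector) \<Rightarrow> bool"
  where "seq_equivalent x y \<longleftrightarrow> dominated x y \<and> dominated y x"

definition seminormalized :: "(nat \<Rightarrow> 'a::real_normed_vector) \<Rightarrow> bool"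
  where "seminormalized x \<longleftrightarrow> 0 < (INF n. norm (x n)) \<and> bdd_above (range (\<lambda>n. norm (x n)))"

definition weakly_null :: "(nat \<Rightarrow> 'a::real_normed_vector) \<Rightarrow> bool"
  where "weakly_null x \<longleftrightarrow> (\<forall>f :: 'a \<Rightarrow> real. bounded_linear f \<longrightarrow> (\<lambda>n. f (x n)) \<longlonglongrightarrow> 0)"

definition spreading_model :: "(nat \<Rightarrow> 'a::real_normed_vector) \<Rightarrow> (nat \<Rightarrow> 'b::real_normed_vector) \<Rightarrow> bool"
  where "spreading_model x y \<longleftrightarrow>
    (\<exists>\<epsilon> :: nat \<Rightarrow> real. decseq \<epsilon> \<and> \<epsilon> \<longlonglongrightarrow> 0 \<and>
      (\<forall>k\<ge>1. \<forall>n :: nat \<Rightarrow> nat. \<forall>a :: nat \<Rightarrow> real.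
        k \<le> n 0 \<and> strict_mono_on {..<k} n \<and> (\<forall>i<k. a i \<in> {-1..1}) \<longrightarrow>
        \<bar>norm (\<Sum>i<k. a i *\<^sub>R x (n i)) - norm (\<Sum>i<k. a i *\<^sub>R y i)\<bar> < \<epsilon> k))"

text \<open>
  A spreading model may live in any Banach space. The closed span of a sequence embeds isometrically
  into \<open>\<ell>\<^sub>\<infinity>\<close>, so every spreading model is equivalent to one in \<open>\<ell>\<^sub>\<infinity>\<close> generated by the same sequence
  (\<open>spreading_model_in_linfty\<close> below), and \<open>SPw\<close> collects the equivalence classes of these.
  The index type is \<open>nat discrete\<close> rather than \<open>nat\<close> because the completeness instance for
  bounded continuous functions asks for a metric domain.
\<close>

type_synonym linfty = "nat discrete \<Rightarrow>\<^sub>C real"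

definition wn_spreading_models :: "'a::banach itself \<Rightarrow> (nat \<Rightarrow> linfty) set"
  where "wn_spreading_models _ =
    {y. \<exists>x :: nat \<Rightarrow> 'a. seminormalized x \<and> weakly_null x \<and> spreading_model x y}"

definition SPw :: "'a::banach itself \<Rightarrow> (nat \<Rightarrow> linfty) set set"
  where "SPw T = wn_spreading_models T //
    {(y, z). y \<in> wn_spreading_models T \<and> z \<in> wn_spreading_models T \<and> seq_equivalent y z}"

text \<open>Domination is a preorder, so the choice of representatives does not matter.\<close>

definition class_dominated :: "(nat \<Rightarrow> linfty) set \<Rightarrow> (nat \<Rightarrow> linfty) set \<Rightarrow> bool"
  where "class_dominated P Q \<longleftrightarrow> (\<exists>y\<in>P. \<exists>z\<in>Q. dominated y z)"

definition incomparable :: "(nat \<Rightarrow> linfty) set \<Rightarrow> (nat \<Rightarrow> linfty) set \<Rightarrow> bool"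
  where "incomparable P Q \<longleftrightarrow> \<not> class_dominated P Q \<and> \<not> class_dominated Q P"

lemma norming_functional:
  fixes v :: "'a::real_normed_vector"
  shows "\<exists>f :: 'a \<Rightarrow> real. bounded_linear f \<and> (\<forall>x. \<bar>f x\<bar> \<le> norm x) \<and> f v = norm v"
proof -
  define A :: "('a \<Rightarrow> real) set" where
    "A = {q. (\<forall>x y. q (x + y) \<le> q x + q y) \<and> (\<forall>c x. c > 0 \<longrightarrow> q (c *\<^sub>R x) \<le> c * q x)
             \<and> (\<forall>x. q x \<le> norm x)}"
  have sub: "q (x + y) \<le> q x + q y" and hom': "c > 0 \<Longrightarrow> q (c *\<^sub>R x) \<le> c * q x"
    and le: "q x \<le> norm x" if "q \<in> A" for q x y c
    using that by (auto simp: A_def)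
  have zero: "q 0 = 0" if "q \<in> A" for q
    using hom'[OF that, of 2 0] le[OF that, of 0] by simp
  have hom: "q (c *\<^sub>R x) = c * q x" if "q \<in> A" "c \<ge> 0" for q c x
  proof (cases "c = 0")
    case False
    then have c: "c > 0" using that by simp
    have "q x \<le> (1/c) * q (c *\<^sub>R x)"
      using hom'[OF that(1), of "1/c" "c *\<^sub>R x"] c by simp
    then show ?thesis using hom'[OF that(1) c, of x] c by (simp add: field_simps)
  qed (simp add: zero that)
  have ge: "- norm x \<le> q x" if "q \<in> A" for q x
    using sub[OF that, of x "-x"] le[OF that, of "-x"] zero[OF that] by simp
  have step: "\<exists>r\<in>A. (\<forall>x. r x \<le> q x) \<and> r (-w) \<le> - q w" if q: "q \<in> A" for q w
  proof -
    define g where "g x t = q (x + t *\<^sub>R w) - t * q w" for x t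
    define r where "r x = (INF t\<in>{0..}. g x t)" for x
    have low: "- norm x \<le> g x t" if "t \<ge> 0" for x t
      using sub[OF q, of "x + t *\<^sub>R w" "-x"] le[OF q, of "-x"] hom[OF q that, of w]
      by (simp add: g_def)
    have bdd: "bdd_below (g x ` {0..})" for x
      using low by (intro bdd_belowI[of _ "- norm x"]) auto
    have r_le: "r x \<le> g x t" if "t \<ge> 0" for x t
      unfolding r_def using that by (intro cINF_lower bdd) auto
    have r_ge: "b \<le> r x" if "\<And>t. t \<ge> 0 \<Longrightarrow> b \<le> g x t" for b x
      unfolding r_def using that by (intro cINF_greatest) auto
    have rq: "r x \<le> q x" for x using r_le[of 0 x] by (simp add: g_def)
    have "r (x + y) \<le> r x + r y" for x y
    proof -
      have "r (x + y) - g x t \<le> g y s" if "t \<ge> 0" "s \<ge> 0" for t s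
        using r_le[of "t + s" "x + y"] that sub[OF q, of "x + t *\<^sub>R w" "y + s *\<^sub>R w"]
        by (simp add: g_def algebra_simps)
      then have "r (x + y) - g x t \<le> r y" if "t \<ge> 0" for t
        using that by (intro r_ge) auto
      then have "r (x + y) - r y \<le> g x t" if "t \<ge> 0" for t
        using that by (simp add: algebra_simps)
      then have "r (x + y) - r y \<le> r x" by (intro r_ge) auto
      then show ?thesis by simp
    qed
    moreover have "r (c *\<^sub>R x) \<le> c * r x" if c: "c > 0" for c x
    proof -
      have "r (c *\<^sub>R x) / c \<le> g x t" if "t \<ge> 0" for t
        using r_le[of "c * t" "c *\<^sub>R x"] c that hom[OF q, of c "x + t *\<^sub>R w"]
        by (simp add: g_def field_simps scaleR_add_right)
      then have "r (c *\<^sub>R x) / c \<le> r x" by (intro r_ge)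
      then show ?thesis using c by (simp add: field_simps)
    qed
    moreover have "r x \<le> norm x" for x using rq[of x] le[OF q, of x] by simp
    moreover have "r (-w) \<le> - q w" using r_le[of 1 "-w"] zero[OF q] by (simp add: g_def)
    ultimately show ?thesis using rq by (intro bexI[of _ r]) (simp_all add: A_def)
  qed
  define B where "B = {q\<in>A. q (-v) \<le> - norm v}"
  have "norm \<in> A" by (auto simp: A_def norm_triangle_ineq)
  then obtain r0 where r0: "r0 \<in> B" using step[of norm v] by (auto simp: B_def)
  have "\<exists>m\<in>B. \<forall>a\<in>B. (\<forall>x. a x \<le> m x) \<longrightarrow> a = m"
  proof (rule predicate_Zorn)
    show "partial_order_on B (relation_of (\<lambda>a b. \<forall>x. b x \<le> a x) B)"
      by (rule partial_order_on_relation_ofI) (auto intro: order_trans simp: fun_eq_iff order_antisym)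
    fix C assume "C \<in> Chains (relation_of (\<lambda>a b. \<forall>x. b x \<le> a x) B)"
    then have CB: "C \<subseteq> B"
      and ch: "\<And>a b. a \<in> C \<Longrightarrow> b \<in> C \<Longrightarrow> (\<forall>x. a x \<le> b x) \<or> (\<forall>x. b x \<le> a x)"
      by (auto simp: Chains_def relation_of_def)
    show "\<exists>u\<in>B. \<forall>a\<in>C. \<forall>x. u x \<le> a x"
    proof (cases "C = {}")
      case False
      have CA: "a \<in> A" if "a \<in> C" for a using that CB by (auto simp: B_def)
      define u where "u x = (INF a\<in>C. a x)" for x
      have bdd: "bdd_below ((\<lambda>a. a x) ` C)" for x
        using ge CA by (intro bdd_belowI[of _ "- norm x"]) auto
      have u_le: "u x \<le> a x" if "a \<in> C" for a x
        unfolding u_def using that by (intro cINF_lower bdd)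
      have u_ge: "b \<le> u x" if "\<And>a. a \<in> C \<Longrightarrow> b \<le> a x" for b x
        unfolding u_def using that False by (intro cINF_greatest) auto
      obtain a0 where a0: "a0 \<in> C" using False by auto
      have "u (x + y) \<le> u x + u y" for x y
      proof -
        have "u (x + y) - a x \<le> b y" if ab: "a \<in> C" "b \<in> C" for a b
          using ch[OF ab] u_le[OF ab(1), of "x + y"] u_le[OF ab(2), of "x + y"]
            sub[OF CA[OF ab(1)], of x y] sub[OF CA[OF ab(2)], of x y]
          by (smt (verit))
        then have "u (x + y) - a x \<le> u y" if "a \<in> C" for a
          using that by (intro u_ge) auto
        then have "u (x + y) - u y \<le> a x" if "a \<in> C" for a
          using that by (simp add: algebra_simps)
        then have "u (x + y) - u y \<le> u x" by (intro u_ge) auto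
        then show ?thesis by simp
      qed
      moreover have "u (c *\<^sub>R x) \<le> c * u x" if c: "c > 0" for c x
      proof -
        have "u (c *\<^sub>R x) / c \<le> a x" if "a \<in> C" for a
          using u_le[OF that, of "c *\<^sub>R x"] hom'[OF CA[OF that] c, of x] c by (simp add: field_simps)
        then have "u (c *\<^sub>R x) / c \<le> u x" by (intro u_ge)
        then show ?thesis using c by (simp add: field_simps)
      qed
      moreover have "u x \<le> norm x" for x using u_le[OF a0, of x] le[OF CA[OF a0], of x] by simp
      moreover have "u (-v) \<le> - norm v" using u_le[OF a0, of "-v"] a0 CB by (force simp: B_def)
      ultimately have "u \<in> B" by (auto simp: A_def B_def)
      then show ?thesis using u_le by auto
    qed (use r0 in auto)
  qed
  then obtain m where m: "m \<in> B" and min: "\<And>a. a \<in> B \<Longrightarrow> (\<forall>x. a x \<le> m x) \<Longrightarrow> a = m" by auto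
  have mA: "m \<in> A" using m by (auto simp: B_def)
  have neg: "m (-w) = - m w" for w
  proof -
    obtain r where r: "r \<in> A" "\<forall>x. r x \<le> m x" "r (-w) \<le> - m w" using step[OF mA] by blast
    then have "r \<in> B" using m by (auto simp: B_def intro: order_trans)
    then have "r = m" using r min by auto
    then show ?thesis using r sub[OF mA, of w "-w"] zero[OF mA] by simp
  qed
  have add: "m (x + y) = m x + m y" for x y
    using sub[OF mA, of x y] sub[OF mA, of "-x" "-y"] neg[of "x + y"] neg[of x] neg[of y] by simp
  have scale: "m (c *\<^sub>R x) = c * m x" for c x
  proof (cases "c \<ge> 0")
    case False
    then show ?thesis using hom[OF mA, of "-c" x] neg[of "c *\<^sub>R x"] by simp
  qed (rule hom[OF mA])
  have abs: "\<bar>m x\<bar> \<le> norm x" for x using le[OF mA, of x] ge[OF mA, of x] by simp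
  have "bounded_linear m"
    by (rule bounded_linear_intro[of _ 1]) (use add scale abs in auto)
  moreover have "m v = norm v" using m neg[of v] abs[of v] by (auto simp: B_def)
  ultimately show ?thesis using abs by auto
qed

lemma isometric_copy_in_linfty:
  fixes y :: "nat \<Rightarrow> 'b::real_normed_vector"
  shows "\<exists>z :: nat \<Rightarrow> linfty. \<forall>k. \<forall>a :: nat \<Rightarrow> real.
           norm (\<Sum>i<k. a i *\<^sub>R z i) = norm (\<Sum>i<k. a i *\<^sub>R y i)"
proof -
  define comb :: "rat list \<Rightarrow> 'b" where
    "comb L = (\<Sum>i<length L. of_rat (L ! i) *\<^sub>R y i)" for L
  obtain F :: "'b \<Rightarrow> 'b \<Rightarrow> real" where F: "\<And>v. bounded_linear (F v)"
      "\<And>v x. \<bar>F v x\<bar> \<le> norm x" "\<And>v. F v v = norm v"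
    using norming_functional by metis
  define h where "h d = F (comb (from_nat (of_discrete d)))" for d :: "nat discrete"
  define z :: "nat \<Rightarrow> linfty" where "z i = Bcontfun (\<lambda>d. h d (y i))" for i
  have z: "apply_bcontfun (z i) d = h d (y i)" for i d
  proof -
    have "(\<lambda>d. h d (y i)) \<in> bcontfun"
      by (rule bcontfun_normI[of _ "norm (y i)"])
        (auto simp: h_def F continuous_on_topological intro!: exI[of _ "{_}"] open_discrete)
    then show ?thesis by (simp add: z_def Bcontfun_inverse)
  qed
  have lin: "apply_bcontfun (\<Sum>i<k. a i *\<^sub>R z i) d = h d (\<Sum>i<k. a i *\<^sub>R y i)"
    for k :: nat and a :: "nat \<Rightarrow> real" and d
  proof -
    interpret bounded_linear "h d" unfolding h_def by (rule F)
    show ?thesis by (induction k) (auto simp: z zero add scaleR)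
  qed
  have "norm (\<Sum>i<k. a i *\<^sub>R z i) = norm (\<Sum>i<k. a i *\<^sub>R y i)" for k and a :: "nat \<Rightarrow> real"
  proof (rule antisym)
    let ?s = "\<Sum>i<k. a i *\<^sub>R y i" and ?t = "\<Sum>i<k. a i *\<^sub>R z i"
    show "norm ?t \<le> norm ?s" by (rule norm_bound) (simp add: lin h_def F)
    show "norm ?s \<le> norm ?t"
    proof (rule field_le_epsilon)
      fix e :: real assume e: "e > 0"
      define \<delta> where "\<delta> = e / (2 * (1 + (\<Sum>i<k. norm (y i))))"
      have S: "(\<Sum>i<k. norm (y i)) \<ge> 0" by (intro sum_nonneg) auto
      have \<delta>: "\<delta> > 0" using e S by (simp add: \<delta>_def)
      have "\<exists>q :: rat. \<bar>of_rat q - a i\<bar> < \<delta>" for i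
        using of_rat_dense[of "a i - \<delta>" "a i + \<delta>"] \<delta> by (metis abs_diff_less_iff less_add_same_cancel1 diff_less_eq less_trans add.commute)
      then obtain q :: "nat \<Rightarrow> rat" where q: "\<And>i. \<bar>of_rat (q i) - a i\<bar> < \<delta>" by metis
      define L where "L = map q [0..<k]"
      have comb: "comb L = (\<Sum>i<k. of_rat (q i) *\<^sub>R y i)" by (simp add: comb_def L_def)
      have "norm (comb L - ?s) = norm (\<Sum>i<k. (of_rat (q i) - a i) *\<^sub>R y i)"
        by (simp add: comb sum_subtractf scaleR_diff_left)
      also have "\<dots> \<le> (\<Sum>i<k. \<delta> * norm (y i))"
        by (rule sum_norm_le) (simp add: mult_right_mono less_imp_le[OF q])
      also have "\<dots> = \<delta> * (\<Sum>i<k. norm (y i))" by (simp add: sum_distrib_left)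
      also have "\<dots> \<le> \<delta> * (1 + (\<Sum>i<k. norm (y i)))" using \<delta> by simp
      also have "\<dots> = e / 2" using S by (simp add: \<delta>_def divide_simps) (simp add: algebra_simps)?
      finally have close: "norm (comb L - ?s) \<le> e / 2" .
      define d :: "nat discrete" where "d = discrete (to_nat L)"
      have hd: "h d = F (comb L)" by (simp add: h_def d_def discrete_inverse)
      have "norm (comb L) = h d ?s + h d (comb L - ?s)"
        using F(1)[of "comb L"] by (simp add: hd F(3) bounded_linear.linear linear_diff)
      also have "h d (comb L - ?s) \<le> e / 2"
        using close F(2)[of "comb L" "comb L - ?s"] by (simp add: hd)
      also have "h d ?s \<le> norm ?t" using norm_bounded[of ?t d] by (simp add: lin)
      finally show "norm ?s \<le> norm ?t + e"
        using close norm_triangle_ineq2[of ?s "comb L"] by (simp add: norm_minus_commute)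
    qed
  qed
  then show ?thesis by auto
qed

theorem spreading_model_in_linfty:
  fixes x :: "nat \<Rightarrow> 'a::real_normed_vector" and y :: "nat \<Rightarrow> 'b::real_normed_vector"
  assumes "spreading_model x y"
  shows "\<exists>z :: nat \<Rightarrow> linfty. spreading_model x z \<and> seq_equivalent y z"
proof -
  obtain z :: "nat \<Rightarrow> linfty" where z: "\<And>a k. norm (\<Sum>i<k. a i *\<^sub>R z i) = norm (\<Sum>i<k. a i *\<^sub>R y i)"
    using isometric_copy_in_linfty[of y] by auto
  have "spreading_model x z" using assms by (simp add: spreading_model_def z)
  moreover have "seq_equivalent y z"
    using z[of _ "Suc _"]
    by (auto simp: seq_equivalent_def dominated_def atLeast0AtMost lessThan_Suc_atMost intro!: exI[of _ 1])
  ultimately show ?thesis by auto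
qed

end

theory Submission
  imports Defs "HOL-Library.Ramsey" "HOL-Library.Diagonal_Subsequence"
begin

text \<open>
  A weakly null sequence whose spreading model is not equivalent to the basis of \<open>\<ell>\<^sub>1\<close> has small averages along all
  subsequences, uniformly, and conversely small averages force a sequence to be weakly null. After a perturbation
  into a countable dense set, such sequences together with moduli for their convergence are therefore coded by a closed
  subset of Baire space, on which domination is a union of closed relations. If there are uncountably many classes,
  pass to the closed set \<open>Y\<close> of points all of whose neighbourhoods meet uncountably many classes. Either domination
  is meager in some relatively open subset of \<open>Y\<^sup>2\<close> of the form \<open>V\<^sup>2\<close>, and a Cantor scheme produces a perfect
  antichain; or every relatively open \<open>V\<close> contains relatively open \<open>V\<^sub>1, V\<^sub>2\<close> with \<open>V\<^sub>1\<close> below \<open>V\<^sub>2\<close>, which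
  yields a strictly increasing sequence of spreading models.

  Given a strictly increasing sequence, generated by weakly null \<open>x\<^sub>0, x\<^sub>1, \<dots>\<close>, choose weights \<open>c\<^sub>i\<close> and vectors \<open>a\<^sub>i\<close>
  alternately, such that on \<open>a\<^sub>i\<close> the norm belonging to \<open>c\<^sub>i x\<^sub>i\<close> outweighs that of all other \<open>c\<^sub>j x\<^sub>j\<close> together. Then
  the spreading models of the sequences \<open>\<Sum>i\<in>A. c\<^sub>i x\<^sub>i\<close> are incomparable for sets \<open>A\<close> with infinite differences.
\<close>

section \<open>Unions of closed preorders on Baire space\<close>

text \<open>On codes, domination is only a countable union of closed relations, so it is split by
  the constant m into closed pieces \<open>R m\<close>, and both horns of the dichotomy are about
  these pieces. They are closed because a code stores a modulus: this turns the limit that defines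
  the norm of a spreading model into a continuous function of the code. Leaving out the models
  equivalent to the l1 basis costs a single class.

  An increasing sequence is far from an antichain. It helps because a model strictly above another
  is larger on some vectors by any prescribed factor. Even with a small weight it can win there
  against all earlier models, while later summands, whose weights are chosen afterwards, are
  negligible there. A weighted sum may generate no spreading model itself; a subsequence does, and
  passing to it changes none of the spreading norms of the summands. Infinite differences of the
  index sets are required because the witness with index i refutes only constants up to about
  i/4.\<close>

definition cyl :: "(nat \<Rightarrow> 'c) set \<Rightarrow> (nat \<Rightarrow> 'c) \<Rightarrow> nat \<Rightarrow> (nat \<Rightarrow> 'c) set"
  where "cyl Y p n = {q\<in>Y. \<forall>i<n. q i = p i}"

lemma cyl_self: "p \<in> Y \<Longrightarrow> p \<in> cyl Y p n"
  by (simp add: cyl_def)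

lemma cyl_antimono: "m \<le> n \<Longrightarrow> cyl Y p n \<subseteq> cyl Y p m"
  by (auto simp: cyl_def)

lemma cyl_subset: "p' \<in> cyl Y p n \<Longrightarrow> n \<le> m \<Longrightarrow> cyl Y p' m \<subseteq> cyl Y p n"
  by (auto simp: cyl_def)

text \<open>\<open>R m\<close> is to be read as domination with constant m. In \<open>closed\<close>
  the centre p of a cylinder is not yet known to lie in Y, so the assumption says that Y contains
  its limit points. The order axioms enter in \<open>closed_preorder_uncountable\<close>.\<close>

locale closed_preorder =
  fixes Y :: "(nat \<Rightarrow> 'c::countable) set" and R :: "nat \<Rightarrow> (nat \<Rightarrow> 'c) \<Rightarrow> (nat \<Rightarrow> 'c) \<Rightarrow> bool"
  assumes closed: "(\<And>n. cyl Y p n \<noteq> {}) \<Longrightarrow> p \<in> Y"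
    and R_mono: "p \<in> Y \<Longrightarrow> q \<in> Y \<Longrightarrow> R m p q \<Longrightarrow> m \<le> m' \<Longrightarrow> R m' p q"
    and R_closed: "p \<in> Y \<Longrightarrow> q \<in> Y \<Longrightarrow> \<not> R m p q \<Longrightarrow>
                     \<exists>n. \<forall>p'\<in>cyl Y p n. \<forall>q'\<in>cyl Y q n. \<not> R m p' q'"
begin

text \<open>The pairs in D are treated one at a time. Density moves the two centres of a pair into
  the open complement of \<open>R m\<close>; earlier separations survive because every new cylinder
  lies inside the old one with the same index.\<close>

lemma separate_pairs:
  assumes "finite D" and "\<And>i j. (i, j) \<in> D \<Longrightarrow> i \<noteq> j"
    and dense: "\<And>p q n. p \<in> V \<Longrightarrow> q \<in> V \<Longrightarrow> \<exists>p'\<in>cyl Y p n. \<exists>q'\<in>cyl Y q n. \<not> R m p' q'"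
    and V: "V \<subseteq> Y" "\<And>p n. p \<in> V \<Longrightarrow> n \<ge> l \<Longrightarrow> cyl Y p n \<subseteq> V"
    and g: "\<And>i. g i \<in> V"
  shows "\<exists>g' l'. l \<le> l' \<and> (\<forall>i. g' i \<in> cyl Y (g i) l) \<and>
           (\<forall>(i, j)\<in>D. \<forall>p\<in>cyl Y (g' i) l'. \<forall>q\<in>cyl Y (g' j) l'. \<not> R m p q)"
  using assms(1,2)
proof (induction D)
  case empty
  have "g i \<in> cyl Y (g i) l" for i using g V(1) cyl_self by blast
  then show ?case by (intro exI[of _ g] exI[of _ l]) auto
next
  case (insert d D)
  obtain i j where d: "d = (i, j)" by fastforce
  have ij: "i \<noteq> j" using insert.prems d by auto
  obtain g' l' where l': "l \<le> l'" and g': "\<And>i. g' i \<in> cyl Y (g i) l"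
    and D: "\<And>i j p q. (i, j) \<in> D \<Longrightarrow> p \<in> cyl Y (g' i) l' \<Longrightarrow> q \<in> cyl Y (g' j) l' \<Longrightarrow> \<not> R m p q"
    using insert.IH insert.prems by blast
  have g'V: "g' i \<in> V" for i using g' V(2)[OF g, of l] by auto
  obtain p q where p: "p \<in> cyl Y (g' i) l'" and q: "q \<in> cyl Y (g' j) l'" and pq: "\<not> R m p q"
    using dense[OF g'V g'V] by blast
  have Y: "p \<in> Y" "q \<in> Y" using p q by (auto simp: cyl_def)
  obtain n where n: "\<And>p' q'. p' \<in> cyl Y p n \<Longrightarrow> q' \<in> cyl Y q n \<Longrightarrow> \<not> R m p' q'"
    using R_closed[OF Y pq] by blast
  \<comment> \<open>As \<open>i \<noteq> j\<close>, both centres can be replaced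
    independently.\<close>
  define h where "h = g'(i := p, j := q)"
  define k where "k = max l' n"
  have h: "h t \<in> cyl Y (g' t) l'" for t
    using p q ij cyl_self[of "g' t" Y l'] V(1) g'V by (auto simp: h_def)
  have hk: "cyl Y (h t) k \<subseteq> cyl Y (g' t) l'" for t
    using cyl_subset[OF h] by (simp add: k_def)
  show ?case
  proof (intro exI[of _ h] exI[of _ k] conjI allI ballI)
    show "l \<le> k" using l' by (simp add: k_def)
    show "h t \<in> cyl Y (g t) l" for t using h cyl_subset[OF g' l'] by blast
    fix e assume e: "e \<in> insert d D"
    obtain a b where ab: "e = (a, b)" by fastforce
    have "\<not> R m p' q'" if p': "p' \<in> cyl Y (h a) k" and q': "q' \<in> cyl Y (h b) k" for p' q'
    proof (cases "(a, b) \<in> D")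
      case True
      then show ?thesis using D hk p' q' by blast
    next
      case False
      then have "a = i" "b = j" using e ab d by auto
      then have "p' \<in> cyl Y p k" "q' \<in> cyl Y q k" using p' q' ij by (auto simp: h_def)
      then show ?thesis using n cyl_antimono[of n k Y] by (fastforce simp: k_def)
    qed
    then show "case e of (i, j) \<Rightarrow> \<forall>p\<in>cyl Y (h i) k. \<forall>q\<in>cyl Y (h j) k. \<not> R m p q"
      using ab by auto
  qed
qed

text \<open>A Cantor scheme indexed by the finite sets \<open>A \<inter> {..<n}\<close>.\<close>

lemma cantor_scheme:
  assumes V: "V \<subseteq> Y" "V \<noteq> {}" "\<And>p n. p \<in> V \<Longrightarrow> n \<ge> l \<Longrightarrow> cyl Y p n \<subseteq> V"
    and dense: "\<And>m p q n. p \<in> V \<Longrightarrow> q \<in> V \<Longrightarrow> \<exists>p'\<in>cyl Y p n. \<exists>q'\<in>cyl Y q n. \<not> R m p' q'"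
  shows "\<exists>f :: nat set \<Rightarrow> nat \<Rightarrow> 'c. (\<forall>A. f A \<in> Y) \<and> (\<forall>A B m. A \<noteq> B \<longrightarrow> \<not> R m (f A) (f B))"
proof -
  \<comment> \<open>A stage consists of centres \<open>fst s A\<close> and one common cylinder
    length \<open>snd s\<close>. The bound \<open>n \<le> snd s\<close> sends the lengths to
    infinity, so branches converge; \<open>l \<le> snd s\<close> keeps the cylinders inside
    V.\<close>
  define P where "P n s \<longleftrightarrow> (\<forall>A. fst s A \<in> V) \<and> n \<le> snd s \<and> l \<le> snd s \<and>
      (\<forall>A\<subseteq>{..<n}. \<forall>B\<subseteq>{..<n}. A \<noteq> B \<longrightarrow>
        (\<forall>p\<in>cyl Y (fst s A) (snd s). \<forall>q\<in>cyl Y (fst s B) (snd s). \<not> R n p q))"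
    for n and s :: "(nat set \<Rightarrow> nat \<Rightarrow> 'c) \<times> nat"
  define Q where "Q n s s' \<longleftrightarrow> snd s \<le> snd s' \<and> (\<forall>A. fst s' A \<in> cyl Y (fst s (A \<inter> {..<n})) (snd s))"
    for n and s s' :: "(nat set \<Rightarrow> nat \<Rightarrow> 'c) \<times> nat"
  obtain p0 where p0: "p0 \<in> V" using V by auto
  have "\<exists>s. \<forall>n. P n (s n) \<and> Q n (s n) (s (Suc n))"
  proof (rule dependent_nat_choice)
    show "\<exists>s. P 0 s" using p0 by (intro exI[of _ "(\<lambda>_. p0, l)"]) (simp add: P_def)
    fix s n assume s: "P n s"
    \<comment> \<open>Every pair occurs in both orders, so the limits become incomparable.\<close>
    define D :: "(nat set \<times> nat set) set" where "D = Pow {..<Suc n} \<times> Pow {..<Suc n} - Id"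
    \<comment> \<open>Starting from \<open>Suc (snd s)\<close> rather than \<open>snd s\<close>
      ensures \<open>Suc n \<le> l'\<close>.\<close>
    have "\<exists>g' l'. Suc (snd s) \<le> l' \<and> (\<forall>A. g' A \<in> cyl Y (fst s (A \<inter> {..<n})) (Suc (snd s))) \<and>
           (\<forall>(A, B)\<in>D. \<forall>p\<in>cyl Y (g' A) l'. \<forall>q\<in>cyl Y (g' B) l'. \<not> R (Suc n) p q)"
    proof (rule separate_pairs)
      show "cyl Y p n \<subseteq> V" if "p \<in> V" "n \<ge> Suc (snd s)" for p n
        using V(3) that s by (auto simp: P_def)
    qed (use V dense s in \<open>auto simp: D_def P_def\<close>)
    then obtain g' l' where gl: "Suc (snd s) \<le> l'"
        "\<And>A. g' A \<in> cyl Y (fst s (A \<inter> {..<n})) (Suc (snd s))"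
        "\<forall>(A, B)\<in>D. \<forall>p\<in>cyl Y (g' A) l'. \<forall>q\<in>cyl Y (g' B) l'. \<not> R (Suc n) p q" by blast
    have Q: "Q n s (g', l')"
      using gl(1) gl(2) cyl_antimono[of "snd s" "Suc (snd s)" Y] by (auto simp: Q_def)
    moreover have "P (Suc n) (g', l')"
    proof -
      have "g' A \<in> V" for A
        using Q V(3)[of "fst s (A \<inter> {..<n})" "snd s"] s by (auto simp: P_def Q_def)
      moreover have "\<not> R (Suc n) p q" if "A \<subseteq> {..<Suc n}" "B \<subseteq> {..<Suc n}" "A \<noteq> B"
          "p \<in> cyl Y (g' A) l'" "q \<in> cyl Y (g' B) l'" for A B p q
        using gl(3) that unfolding D_def by blast
      ultimately show ?thesis using gl(1) s by (simp add: P_def)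
    qed
    ultimately show "\<exists>s'. P (Suc n) s' \<and> Q n s s'" by blast
  qed
  then obtain s where P: "\<And>n. P n (s n)" and Q: "\<And>n. Q n (s n) (s (Suc n))" by blast
  define l where "l n = snd (s n)" for n
  define g where "g A n = fst (s n) (A \<inter> {..<n})" for A n
  have l_mono: "l m \<le> l n" if "m \<le> n" for m n
    using that by (rule lift_Suc_mono_le[rotated]) (use Q in \<open>auto simp: l_def Q_def\<close>)
  have l_ge: "n \<le> l n" for n using P[of n] unfolding l_def P_def by blast
  have gY: "g A n \<in> Y" for A n using P[of n] V(1) unfolding g_def P_def by blast
  have step: "g A (Suc n) \<in> cyl Y (g A n) (l n)" for A n
  proof -
    have "A \<inter> {..<Suc n} \<inter> {..<n} = A \<inter> {..<n}" by auto
    moreover have "fst (s (Suc n)) (A \<inter> {..<Suc n}) \<in> cyl Y (fst (s n) (A \<inter> {..<Suc n} \<inter> {..<n})) (snd (s n))"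
      using Q[of n] unfolding Q_def by blast
    ultimately show ?thesis by (simp add: g_def l_def)
  qed
  have g_cyl: "g A n \<in> cyl Y (g A m) (l m)" if "m \<le> n" for A m n
    using that
  proof (induction n rule: dec_induct)
    case base then show ?case using gY by (simp add: cyl_self)
  next
    case (step n)
    then show ?case using \<open>g A (Suc n) \<in> cyl Y (g A n) (l n)\<close> l_mono[of m n] by (auto simp: cyl_def)
  qed
  \<comment> \<open>By \<open>l_ge\<close>, the cylinder length at stage \<open>Suc i\<close>
    exceeds i, so coordinate i is final there.\<close>
  define f where "f A i = g A (Suc i) i" for A i
  have agree: "f A i = g A n i" if "i < l n" for A i n
  proof (cases "n \<le> Suc i")
    case True
    then show ?thesis using g_cyl[OF True, of A] that by (simp add: f_def cyl_def)
  next
    case False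
    then show ?thesis using g_cyl[of "Suc i" n A] l_ge[of "Suc i"] by (simp add: f_def cyl_def)
  qed
  have fY: "f A \<in> Y" for A
  proof (rule closed)
    fix n
    have "f A i = g A n i" if "i < n" for i using agree that l_ge[of n] by simp
    then have "g A n \<in> cyl Y (f A) n" using gY by (simp add: cyl_def)
    then show "cyl Y (f A) n \<noteq> {}" by blast
  qed
  have fcyl: "f A \<in> cyl Y (g A n) (l n)" for A n using fY agree by (simp add: cyl_def)
  have "\<not> R m (f A) (f B)" if "A \<noteq> B" for A B m
  proof -
    obtain t where t: "t \<in> A \<longleftrightarrow> t \<notin> B" using \<open>A \<noteq> B\<close> by blast
    \<comment> \<open>At stage n the truncations of A and B differ, and \<open>R_mono\<close>
      carries the failure of \<open>R n\<close> down to \<open>R m\<close>.\<close>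
    define n where "n = max m (Suc t)"
    have "A \<inter> {..<n} \<noteq> B \<inter> {..<n}" using t by (force simp: n_def)
    moreover have "\<forall>A\<subseteq>{..<n}. \<forall>B\<subseteq>{..<n}. A \<noteq> B \<longrightarrow>
        (\<forall>p\<in>cyl Y (fst (s n) A) (snd (s n)). \<forall>q\<in>cyl Y (fst (s n) B) (snd (s n)). \<not> R n p q)"
      using P[of n] by (simp add: P_def)
    ultimately have "\<not> R n (f A) (f B)"
      using fcyl[of A n] fcyl[of B n] unfolding g_def l_def by (meson Int_lower2)
    then show ?thesis using R_mono[OF fY fY, of m A B n] by (auto simp: n_def)
  qed
  then show ?thesis using fY by blast
qed

end

section \<open>The kernel modulo countably many classes, and the dichotomy\<close>

locale closed_preorder_uncountable = closed_preorder +
  fixes le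
  assumes le_iff: "le p q \<longleftrightarrow> (\<exists>m. R m p q)"
    and le_refl: "p \<in> Y \<Longrightarrow> le p p"
    and le_trans: "p \<in> Y \<Longrightarrow> q \<in> Y \<Longrightarrow> r \<in> Y \<Longrightarrow> le p q \<Longrightarrow> le q r \<Longrightarrow> le p r"
    and uncountable_classes: "S \<subseteq> Y \<Longrightarrow> countable S \<Longrightarrow> \<exists>p\<in>Y. \<forall>q\<in>S. \<not> (le p q \<and> le q p)"
begin

text \<open>The sigma-ideal of sets meeting only countably many classes. Representatives are taken
  in Y rather than in U, so that they serve for every subset of U as well.\<close>

definition small :: "(nat \<Rightarrow> 'a) set \<Rightarrow> bool"
  where "small U \<longleftrightarrow> (\<exists>S\<subseteq>Y. countable S \<and> (\<forall>p\<in>U. \<exists>q\<in>S. le p q \<and> le q p))"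

lemma small_UN:
  assumes "countable I" "\<And>i. i \<in> I \<Longrightarrow> small (U i)"
  shows "small (\<Union>i\<in>I. U i)"
proof -
  obtain S where S: "\<And>i. i \<in> I \<Longrightarrow> S i \<subseteq> Y \<and> countable (S i) \<and> (\<forall>p\<in>U i. \<exists>q\<in>S i. le p q \<and> le q p)"
    using assms(2) unfolding small_def by metis
  then show ?thesis unfolding small_def
    by (intro exI[of _ "\<Union>i\<in>I. S i"] conjI countable_UN assms(1)) blast+
qed

lemma small_subset: "small U \<Longrightarrow> U' \<subseteq> U \<Longrightarrow> small U'"
  unfolding small_def by blast

text \<open>The Cantor-Bendixson kernel with respect to the ideal \<open>small\<close>; this is the
  set called Y in the overview.\<close>

definition kernel where "kernel = {p\<in>Y. \<forall>n. \<not> small (cyl Y p n)}"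

lemma kernel_subset: "kernel \<subseteq> Y"
  by (auto simp: kernel_def)

text \<open>There are only countably many finite words over a countable alphabet, so the small
  cylinders form a countable family; they cover the complement of the kernel.\<close>

lemma small_outside_kernel: "small (Y - kernel)"
proof -
  define U where "U s = {q\<in>Y. map q [0..<length s] = s}" for s :: "'a list"
  have U: "U (map p [0..<n]) = cyl Y p n" for p n
    by (auto simp: U_def cyl_def)
  have "Y - kernel \<subseteq> (\<Union>s\<in>{s. small (U s)}. U s)"
  proof
    fix p assume "p \<in> Y - kernel"
    then obtain n where "p \<in> Y" "small (cyl Y p n)" by (auto simp: kernel_def)
    then show "p \<in> (\<Union>s\<in>{s. small (U s)}. U s)"
      using U[of p n] cyl_self[of p Y n] by (intro UN_I[of "map p [0..<n]"]) auto
  qed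
  moreover have "small (\<Union>s\<in>{s. small (U s)}. U s)" by (rule small_UN) auto
  ultimately show ?thesis using small_subset by blast
qed

lemma not_small_kernel: "\<not> small U \<Longrightarrow> U \<subseteq> Y \<Longrightarrow> \<not> small (U \<inter> kernel)"
proof
  assume U: "\<not> small U" "U \<subseteq> Y" and s: "small (U \<inter> kernel)"
  have "small (\<Union>W\<in>{U \<inter> kernel, Y - kernel}. W)"
    by (rule small_UN) (use s small_outside_kernel in auto)
  moreover have "U \<subseteq> (\<Union>W\<in>{U \<inter> kernel, Y - kernel}. W)"
    using U(2) by auto
  ultimately show False using U(1) small_subset by blast
qed

lemma not_small_Y: "\<not> small Y"
proof
  assume "small Y"
  then obtain S where "S \<subseteq> Y" "countable S" and S: "\<forall>p\<in>Y. \<exists>q\<in>S. le p q \<and> le q p"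
    unfolding small_def by blast
  then obtain p where "p \<in> Y" "\<forall>q\<in>S. \<not> (le p q \<and> le q p)" using uncountable_classes by blast
  then show False using S by blast
qed

lemma kernel_cyl: "p \<in> kernel \<Longrightarrow> cyl kernel p n = cyl Y p n \<inter> kernel"
  by (auto simp: cyl_def kernel_def)

text \<open>If one class exhausted a neighbourhood in the kernel, the whole cylinder in Y would be
  small, because the rest of it lies outside the kernel. This supplies strictness in
  \<open>increasing_sequence\<close>.\<close>

lemma kernel_not_equivalent:
  assumes "p \<in> kernel" "q \<in> Y"
  shows "\<exists>p'\<in>cyl kernel p n. \<not> (le p' q \<and> le q p')"
proof (rule ccontr)
  assume "\<not> ?thesis"
  then have "small (cyl kernel p n)" using assms(2) unfolding small_def
    by (intro exI[of _ "{q}"]) auto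
  moreover have "cyl Y p n \<subseteq> Y" by (auto simp: cyl_def)
  ultimately show False using not_small_kernel[of "cyl Y p n"] assms(1)
    unfolding kernel_cyl[OF assms(1)] by (auto simp: kernel_def)
qed

lemma kernel_closed: "(\<And>n. cyl kernel p n \<noteq> {}) \<Longrightarrow> p \<in> kernel"
proof -
  assume *: "\<And>n. cyl kernel p n \<noteq> {}"
  have "cyl Y p n \<noteq> {}" for n using *[of n] kernel_subset by (auto simp: cyl_def)
  then have "p \<in> Y" by (rule closed)
  moreover have "\<not> small (cyl Y p n)" for n
  proof -
    obtain q where "q \<in> kernel" and q: "\<forall>i<n. q i = p i" using *[of n] by (auto simp: cyl_def)
    moreover have "cyl Y q n = cyl Y p n" using q by (auto simp: cyl_def)
    ultimately show ?thesis by (auto simp: kernel_def dest: spec[of _ n])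
  qed
  ultimately show "p \<in> kernel" by (simp add: kernel_def)
qed

sublocale K: closed_preorder kernel R
proof
  fix m p q assume pq: "p \<in> kernel" "q \<in> kernel" "\<not> R m p q"
  then obtain n where "\<forall>p'\<in>cyl Y p n. \<forall>q'\<in>cyl Y q n. \<not> R m p' q'"
    using R_closed[of p q m] kernel_subset by blast
  then show "\<exists>n. \<forall>p'\<in>cyl kernel p n. \<forall>q'\<in>cyl kernel q n. \<not> R m p' q'"
    using kernel_cyl[OF pq(1)] kernel_cyl[OF pq(2)] by blast
next
  show "p \<in> kernel" if "\<And>n. cyl kernel p n \<noteq> {}" for p
    using that by (rule kernel_closed)
next
  show "R m' p q" if "p \<in> kernel" "q \<in> kernel" "R m p q" "m \<le> m'" for m p q m'
    using that R_mono kernel_subset by blast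
qed

text \<open>If every relatively open subset of the kernel contains two relatively open sets \<open>V, W\<close> with all of \<open>V\<close> below
  all of \<open>W\<close>, then choosing such pairs repeatedly inside the upper set gives an increasing sequence;
  it can be made strict because a relatively open set meets uncountably many classes.\<close>

lemma increasing_sequence:
  assumes p0: "p0 \<in> kernel"
    and below: "\<And>p0 n0. p0 \<in> kernel \<Longrightarrow> \<exists>m. \<exists>p\<in>cyl kernel p0 n0. \<exists>q\<in>cyl kernel p0 n0. \<exists>n.
       \<forall>p'\<in>cyl kernel p n. \<forall>q'\<in>cyl kernel q n. R m p' q'"
  shows "\<exists>s. \<forall>i. s i \<in> Y \<and> le (s i) (s (Suc i)) \<and> \<not> le (s (Suc i)) (s i)"
proof -
  have below': "\<exists>p\<in>kernel. \<exists>q\<in>kernel. \<exists>n. cyl kernel p n \<subseteq> cyl kernel p0 n0 \<and>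
      cyl kernel q n \<subseteq> cyl kernel p0 n0 \<and> (\<forall>p'\<in>cyl kernel p n. \<forall>q'\<in>cyl kernel q n. le p' q')"
    if p0: "p0 \<in> kernel" for p0 n0
  proof -
    obtain m p q n where pq: "p \<in> cyl kernel p0 n0" "q \<in> cyl kernel p0 n0"
      and R: "\<forall>p'\<in>cyl kernel p n. \<forall>q'\<in>cyl kernel q n. R m p' q'"
      using below[OF p0, of n0] by blast
    have "cyl kernel p (max n n0) \<subseteq> cyl kernel p n" "cyl kernel q (max n n0) \<subseteq> cyl kernel q n"
      by (auto intro!: cyl_antimono)
    then have "\<forall>p'\<in>cyl kernel p (max n n0). \<forall>q'\<in>cyl kernel q (max n n0). le p' q'"
      using R le_iff by blast
    moreover have "cyl kernel p (max n n0) \<subseteq> cyl kernel p0 n0" "cyl kernel q (max n n0) \<subseteq> cyl kernel p0 n0"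
      using pq by (simp_all add: cyl_subset)
    moreover have "p \<in> kernel" "q \<in> kernel" using pq by (auto simp: cyl_def)
    ultimately show ?thesis by blast
  qed
  \<comment> \<open>\<open>s\<close> is the point chosen last, and \<open>cyl kernel q n\<close> is
    a reservoir above it in which the next pair of neighbourhoods is sought.\<close>
  define P where "P t \<longleftrightarrow> (case t of (s, q, n) \<Rightarrow> s \<in> kernel \<and> q \<in> kernel \<and> (\<forall>q'\<in>cyl kernel q n. le s q'))"
    for t
  have "\<exists>t. \<forall>i::nat. P (t i) \<and> le (fst (t i)) (fst (t (Suc i))) \<and> \<not> le (fst (t (Suc i))) (fst (t i))"
  proof (rule dependent_nat_choice)
    obtain p q n where "p \<in> kernel" "q \<in> kernel"
      "\<forall>p'\<in>cyl kernel p n. \<forall>q'\<in>cyl kernel q n. le p' q'"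
      using below'[OF p0] by blast
    then have "P (p, q, n)" using cyl_self[of p kernel n] by (auto simp: P_def)
    then show "\<exists>t. P t" ..
    fix t assume "P t"
    then obtain s q n where t: "t = (s, q, n)" and sq: "s \<in> kernel" "q \<in> kernel"
      and s_le: "\<And>q'. q' \<in> cyl kernel q n \<Longrightarrow> le s q'" by (cases t) (auto simp: P_def)
    obtain p1 q1 n1 where 1: "p1 \<in> kernel" "q1 \<in> kernel" "cyl kernel p1 n1 \<subseteq> cyl kernel q n"
      "\<And>p' q'. p' \<in> cyl kernel p1 n1 \<Longrightarrow> q' \<in> cyl kernel q1 n1 \<Longrightarrow> le p' q'"
      using below'[OF sq(2), of n] by blast
    \<comment> \<open>Since s' lies in the reservoir, \<open>le s s'\<close> holds anyway;
      inequivalence therefore means that \<open>le s' s\<close> fails.\<close>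
    obtain s' where s': "s' \<in> cyl kernel p1 n1" "\<not> (le s' s \<and> le s s')"
      using kernel_not_equivalent[OF 1(1)] sq kernel_subset by blast
    have "le s s'" using s_le s' 1(3) by blast
    then show "\<exists>t'. P t' \<and> le (fst t) (fst t') \<and> \<not> le (fst t') (fst t)"
      using s' 1 by (intro exI[of _ "(s', q1, n1)"]) (auto simp: P_def t cyl_def)
  qed
  then obtain t where "\<And>i::nat. P (t i) \<and> le (fst (t i)) (fst (t (Suc i))) \<and> \<not> le (fst (t (Suc i))) (fst (t i))"
    by blast
  moreover have "fst (t i) \<in> Y" if "P (t i)" for i
    using that kernel_subset by (auto simp: P_def split: prod.splits)
  ultimately show ?thesis by (intro exI[of _ "\<lambda>i. fst (t i)"]) blast
qed

theorem antichain_or_increasing: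
  "(\<exists>f :: nat set \<Rightarrow> nat \<Rightarrow> 'a. (\<forall>A. f A \<in> Y) \<and> (\<forall>A B. A \<noteq> B \<longrightarrow> \<not> le (f A) (f B))) \<or>
   (\<exists>s. \<forall>i. s i \<in> Y \<and> le (s i) (s (Suc i)) \<and> \<not> le (s (Suc i)) (s i))"
proof (cases "\<forall>p0\<in>kernel. \<forall>n0. \<exists>m. \<exists>p\<in>cyl kernel p0 n0. \<exists>q\<in>cyl kernel p0 n0. \<exists>n.
       \<forall>p'\<in>cyl kernel p n. \<forall>q'\<in>cyl kernel q n. R m p' q'")
  case True
  have "kernel \<noteq> {}"
    using not_small_kernel[OF not_small_Y] by (auto simp: small_def)
  then show ?thesis using increasing_sequence True by blast
next
  case False
  \<comment> \<open>On the square of this neighbourhood the complement of each \<open>R m\<close>,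
    relatively open by \<open>R_closed\<close>, is dense. This is the meager case.\<close>
  then obtain p0 n0 where p0: "p0 \<in> kernel" and
    dense: "\<And>m p q n. p \<in> cyl kernel p0 n0 \<Longrightarrow> q \<in> cyl kernel p0 n0 \<Longrightarrow>
       \<exists>p'\<in>cyl kernel p n. \<exists>q'\<in>cyl kernel q n. \<not> R m p' q'" by blast
  have "\<exists>f :: nat set \<Rightarrow> nat \<Rightarrow> 'a. (\<forall>A. f A \<in> kernel) \<and> (\<forall>A B m. A \<noteq> B \<longrightarrow> \<not> R m (f A) (f B))"
  proof (rule K.cantor_scheme)
    show "cyl kernel p0 n0 \<noteq> {}" using cyl_self[OF p0] by blast
    show "cyl kernel p n \<subseteq> cyl kernel p0 n0" if "p \<in> cyl kernel p0 n0" "n \<ge> n0" for p n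
      using cyl_subset that by blast
    show "cyl kernel p0 n0 \<subseteq> kernel" by (auto simp: cyl_def)
  qed (rule dense)
  then obtain f :: "nat set \<Rightarrow> nat \<Rightarrow> 'a" where f: "\<And>A. f A \<in> kernel" "\<And>A B m. A \<noteq> B \<Longrightarrow> \<not> R m (f A) (f B)"
    by metis
  have "f A \<in> Y" for A using f(1) kernel_subset by blast
  moreover have "\<not> le (f A) (f B)" if "A \<noteq> B" for A B using f(2)[OF that] by (simp add: le_iff)
  ultimately show ?thesis by blast
qed

end

section \<open>Sequences generating spreading models\<close>

text \<open>Mediates between index choices that increase on an initial segment, as in
  \<open>spreading_model\<close>, and total increasing sequences, as in
  \<open>spreads\<close>.\<close>

lemma extend_strict_mono:
  fixes n :: "nat \<Rightarrow> nat"
  assumes n: "strict_mono_on {..<k} n" and r: "0 < k \<Longrightarrow> r \<le> n 0"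
  shows "\<exists>n'. strict_mono n' \<and> (\<forall>i<k. n' i = n i) \<and> r \<le> n' 0"
proof -
  define n' where "n' i = (if i < k then n i else (\<Sum>l<k. n l) + r + i)" for i
  have "n' i < n' (Suc i)" for i
  proof -
    have "n i \<le> (\<Sum>l<k. n l)" if "i < k" by (rule member_le_sum) (use that in auto)
    then show ?thesis using n by (auto simp: n'_def strict_mono_on_def)
  qed
  then have "strict_mono n'" by (simp add: strict_mono_Suc_iff)
  moreover have "\<forall>i<k. n' i = n i" "r \<le> n' 0" using r by (simp_all add: n'_def)
  ultimately show ?thesis by blast
qed

lemma strict_mono_ge_add:
  fixes n :: "nat \<Rightarrow> nat"
  assumes "strict_mono n" "r \<le> n 0"
  shows "r + i \<le> n i"
proof (induction i)
  case (Suc i)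
  then show ?case using assms(1) by (metis add_Suc_right Suc_leI le_less_trans lessI strict_mono_less)
qed (use assms in simp)

text \<open>\<open>spreads x \<phi>\<close> says, without mentioning the model, that \<open>x\<close> generates a spreading model, with modulus \<open>\<phi>\<close>.\<close>

definition spreads :: "(nat \<Rightarrow> 'a::real_normed_vector) \<Rightarrow> (nat \<Rightarrow> nat) \<Rightarrow> bool"
  where "spreads x \<phi> \<longleftrightarrow> (\<forall>j k n n' a. strict_mono n \<and> strict_mono n' \<and> max k (\<phi> j) \<le> n 0 \<and> max k (\<phi> j) \<le> n' 0 \<and>
     (\<forall>i<k. \<bar>a i\<bar> \<le> 1) \<longrightarrow>
     \<bar>norm (\<Sum>i<k. a i *\<^sub>R x (n i)) - norm (\<Sum>i<k. a i *\<^sub>R x (n' i))\<bar> \<le> 1 / real (Suc j))"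

text \<open>The norm of the spreading model. Under \<open>spreads\<close> all admissible index
  choices agree in the limit, so blocks of consecutive indices suffice.\<close>

definition spread_norm :: "(nat \<Rightarrow> 'a::real_normed_vector) \<Rightarrow> nat \<Rightarrow> (nat \<Rightarrow> real) \<Rightarrow> real"
  where "spread_norm x k a = lim (\<lambda>r. norm (\<Sum>i<k. a i *\<^sub>R x (r + i)))"

lemma spreads_scaled:
  assumes "spreads x \<phi>" "strict_mono n" "strict_mono n'" "max k (\<phi> j) \<le> n 0" "max k (\<phi> j) \<le> n' 0"
    and a: "\<And>i. i < k \<Longrightarrow> \<bar>a i\<bar> \<le> A" and A: "0 < A"
  shows "\<bar>norm (\<Sum>i<k. a i *\<^sub>R x (n i)) - norm (\<Sum>i<k. a i *\<^sub>R x (n' i))\<bar> \<le> A / real (Suc j)"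
proof -
  define b where "b i = a i / A" for i
  have "\<forall>i<k. \<bar>b i\<bar> \<le> 1" using a A by (simp add: b_def)
  then have "\<bar>norm (\<Sum>i<k. b i *\<^sub>R x (n i)) - norm (\<Sum>i<k. b i *\<^sub>R x (n' i))\<bar> \<le> 1 / real (Suc j)"
    using assms(1-5) unfolding spreads_def by blast
  moreover have "norm (\<Sum>i<k. a i *\<^sub>R x (m i)) = A * norm (\<Sum>i<k. b i *\<^sub>R x (m i))" for m
  proof -
    have "(\<Sum>i<k. a i *\<^sub>R x (m i)) = A *\<^sub>R (\<Sum>i<k. b i *\<^sub>R x (m i))"
      using A by (simp add: b_def scaleR_sum_right)
    then show ?thesis using A by simp
  qed
  ultimately have "A * \<bar>norm (\<Sum>i<k. b i *\<^sub>R x (n i)) - norm (\<Sum>i<k. b i *\<^sub>R x (n' i))\<bar> \<le> A * (1 / real (Suc j))"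
    using A by (intro mult_left_mono) auto
  then show ?thesis using A
    by (simp only: \<open>\<And>m. norm (\<Sum>i<k. a i *\<^sub>R x (m i)) = A * norm (\<Sum>i<k. b i *\<^sub>R x (m i))\<close>)
       (simp add: abs_mult right_diff_distrib[symmetric])
qed

lemma coeff_bound:
  fixes a :: "nat \<Rightarrow> real"
  shows "\<exists>A>0. \<forall>i<k. \<bar>a i\<bar> \<le> A"
proof -
  have "\<bar>a i\<bar> \<le> 1 + (\<Sum>i<k. \<bar>a i\<bar>)" if "i < k" for i
    using member_le_sum[of i "{..<k}" "\<lambda>i. \<bar>a i\<bar>"] that by auto
  moreover have "0 \<le> (\<Sum>i<k. \<bar>a i\<bar>)" by (intro sum_nonneg) auto
  then have "0 < 1 + (\<Sum>i<k. \<bar>a i\<bar>)" by linarith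
  ultimately show ?thesis by blast
qed

lemma ex_inverse_Suc_le:
  fixes A e :: real
  assumes "0 < e"
  shows "\<exists>j. A / real (Suc j) \<le> e"
proof -
  obtain j where "A / e \<le> real j" using real_arch_simple by blast
  then have "A \<le> e * real (Suc j)" using assms by (simp add: field_simps add_increasing2)
  then show ?thesis by (intro exI[of _ j]) (simp add: field_simps)
qed

lemma spread_norm_LIMSEQ:
  assumes "spreads x \<phi>"
  shows "(\<lambda>r. norm (\<Sum>i<k. a i *\<^sub>R x (r + i))) \<longlonglongrightarrow> spread_norm x k a"
proof -
  let ?s = "\<lambda>r. norm (\<Sum>i<k. a i *\<^sub>R x (r + i))"
  obtain A where A: "0 < A" "\<And>i. i < k \<Longrightarrow> \<bar>a i\<bar> \<le> A" using coeff_bound by blast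
  have "Cauchy ?s"
  proof (rule metric_CauchyI)
    fix e :: real assume "0 < e"
    then obtain j where "A / real (Suc j) \<le> e / 2" using ex_inverse_Suc_le[of "e / 2"] by auto
    moreover have "dist (?s m) (?s n) \<le> A / real (Suc j)" if "m \<ge> max k (\<phi> j)" "n \<ge> max k (\<phi> j)" for m n
      unfolding dist_real_def
      by (rule spreads_scaled[OF assms]) (use that A in \<open>auto simp: strict_mono_def\<close>)
    ultimately show "\<exists>M. \<forall>m\<ge>M. \<forall>n\<ge>M. dist (?s m) (?s n) < e"
      using \<open>0 < e\<close> by (intro exI[of _ "max k (\<phi> j)"]) (smt (verit) field_sum_of_halves)
  qed
  then show ?thesis unfolding spread_norm_def
    by (simp add: Cauchy_convergent convergent_LIMSEQ_iff[symmetric])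
qed

lemma spread_norm_approx:
  assumes x: "spreads x \<phi>" and n: "strict_mono n" "max k (\<phi> j) \<le> n 0"
    and a: "\<And>i. i < k \<Longrightarrow> \<bar>a i\<bar> \<le> A" and A: "0 < A"
  shows "\<bar>norm (\<Sum>i<k. a i *\<^sub>R x (n i)) - spread_norm x k a\<bar> \<le> A / real (Suc j)"
proof (rule LIMSEQ_le_const2)
  show "(\<lambda>r. \<bar>norm (\<Sum>i<k. a i *\<^sub>R x (n i)) - norm (\<Sum>i<k. a i *\<^sub>R x (r + i))\<bar>)
      \<longlonglongrightarrow> \<bar>norm (\<Sum>i<k. a i *\<^sub>R x (n i)) - spread_norm x k a\<bar>"
    by (intro tendsto_intros spread_norm_LIMSEQ[OF x])
  have "\<bar>norm (\<Sum>i<k. a i *\<^sub>R x (n i)) - norm (\<Sum>i<k. a i *\<^sub>R x (r + i))\<bar> \<le> A / real (Suc j)"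
    if "r \<ge> max k (\<phi> j)" for r
    by (rule spreads_scaled[OF x]) (use that n a A in \<open>auto simp: strict_mono_def\<close>)
  then show "\<exists>N. \<forall>r\<ge>N. \<bar>norm (\<Sum>i<k. a i *\<^sub>R x (n i)) - norm (\<Sum>i<k. a i *\<^sub>R x (r + i))\<bar> \<le> A / real (Suc j)"
    by blast
qed

lemma spread_norm_nonneg: "spreads x \<phi> \<Longrightarrow> 0 \<le> spread_norm x k a"
  by (rule LIMSEQ_le_const[OF spread_norm_LIMSEQ]) auto

lemma norm_sum_scaleR_le:
  assumes "\<And>i. i < k \<Longrightarrow> norm (v i) \<le> M"
  shows "norm (\<Sum>i<k. a i *\<^sub>R v i) \<le> M * (\<Sum>i<k. \<bar>a i\<bar>)"
  unfolding sum_distrib_left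
  by (rule sum_norm_le) (use assms in \<open>auto simp: mult.commute[of M] intro!: mult_left_mono\<close>)

lemma spread_norm_le:
  assumes "spreads x \<phi>" "\<And>n. norm (x n) \<le> M"
  shows "spread_norm x k a \<le> M * (\<Sum>i<k. \<bar>a i\<bar>)"
  by (rule LIMSEQ_le_const2[OF spread_norm_LIMSEQ[OF assms(1)]])
     (use assms(2) in \<open>auto intro!: norm_sum_scaleR_le\<close>)

lemma spreads_subseq:
  assumes "spreads x \<phi>" "strict_mono h"
  shows "spreads (x \<circ> h) \<phi>"
  unfolding spreads_def
proof (intro allI impI, elim conjE)
  fix j k and n n' :: "nat \<Rightarrow> nat" and a :: "nat \<Rightarrow> real"
  assume n: "strict_mono n" "strict_mono n'" "max k (\<phi> j) \<le> n 0" "max k (\<phi> j) \<le> n' 0"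
    and a: "\<forall>i<k. \<bar>a i\<bar> \<le> 1"
  have "max k (\<phi> j) \<le> h (n 0)" "max k (\<phi> j) \<le> h (n' 0)"
    using n seq_suble[OF assms(2)] order_trans by blast+
  then show "\<bar>norm (\<Sum>i<k. a i *\<^sub>R (x \<circ> h) (n i)) - norm (\<Sum>i<k. a i *\<^sub>R (x \<circ> h) (n' i))\<bar> \<le> 1 / real (Suc j)"
    using spreads_scaled[OF assms(1), of "h \<circ> n" "h \<circ> n'" k j a 1] n a assms(2)
    by (simp add: strict_mono_o)
qed

lemma spread_norm_eqI:
  assumes x: "spreads x \<phi>" and e: "\<And>e. 0 < e \<Longrightarrow> \<exists>N. \<forall>r\<ge>N. \<bar>norm (\<Sum>i<k. a i *\<^sub>R x (r + i)) - c\<bar> \<le> e"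
  shows "spread_norm x k a = c"
proof (rule LIMSEQ_unique[OF spread_norm_LIMSEQ[OF x]])
  show "(\<lambda>r. norm (\<Sum>i<k. a i *\<^sub>R x (r + i))) \<longlonglongrightarrow> c"
  proof (rule LIMSEQ_I)
    fix e :: real assume "0 < e"
    then obtain N where "\<And>r. r \<ge> N \<Longrightarrow> \<bar>norm (\<Sum>i<k. a i *\<^sub>R x (r + i)) - c\<bar> \<le> e / 2"
      using e[of "e / 2"] by auto
    then show "\<exists>N. \<forall>r\<ge>N. norm (norm (\<Sum>i<k. a i *\<^sub>R x (r + i)) - c) < e"
      using \<open>0 < e\<close> by (intro exI[of _ N]) fastforce
  qed
qed

lemma spread_norm_subseq:
  assumes x: "spreads x \<phi>" and h: "strict_mono h"
  shows "spread_norm (x \<circ> h) k a = spread_norm x k a"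
proof (rule spread_norm_eqI[OF spreads_subseq[OF x h]])
  fix e :: real assume "0 < e"
  obtain A where A: "0 < A" "\<And>i. i < k \<Longrightarrow> \<bar>a i\<bar> \<le> A" using coeff_bound by blast
  obtain j where j: "A / real (Suc j) \<le> e" using ex_inverse_Suc_le[OF \<open>0 < e\<close>] by blast
  have "\<bar>norm (\<Sum>i<k. a i *\<^sub>R (x \<circ> h) (r + i)) - spread_norm x k a\<bar> \<le> e" if "r \<ge> max k (\<phi> j)" for r
  proof -
    have "max k (\<phi> j) \<le> h r" using that seq_suble[OF h, of r] by simp
    then show ?thesis
      using spread_norm_approx[OF x, of "\<lambda>i. h (r + i)" k j a A] A j h by (auto simp: strict_mono_def)
  qed
  then show "\<exists>N. \<forall>r\<ge>N. \<bar>norm (\<Sum>i<k. a i *\<^sub>R (x \<circ> h) (r + i)) - spread_norm x k a\<bar> \<le> e" by blast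
qed

text \<open>The definition ties the error to the number of coefficients. Padding with zero
  coefficients to length \<open>max k r\<close> gives the error \<open>\<epsilon> r\<close> to short
  combinations that start far out.\<close>

lemma spreading_model_padded:
  assumes "spreading_model x y"
  shows "\<exists>\<epsilon>. \<epsilon> \<longlonglongrightarrow> 0 \<and>
    (\<forall>k r n a. strict_mono n \<and> max k r \<le> n 0 \<and> 0 < r \<and> (\<forall>i<k. \<bar>a i\<bar> \<le> 1) \<longrightarrow>
      \<bar>norm (\<Sum>i<k. a i *\<^sub>R x (n i)) - norm (\<Sum>i<k. a i *\<^sub>R y i)\<bar> < \<epsilon> r)"
proof -
  obtain \<epsilon> where \<epsilon>: "decseq \<epsilon>" "\<epsilon> \<longlonglongrightarrow> 0" and
    *: "\<And>k n a. 1 \<le> k \<Longrightarrow> k \<le> n 0 \<Longrightarrow> strict_mono_on {..<k} n \<Longrightarrow> (\<forall>i<k. a i \<in> {-1..1}) \<Longrightarrow>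
        \<bar>norm (\<Sum>i<k. a i *\<^sub>R x (n i)) - norm (\<Sum>i<k. a i *\<^sub>R y i)\<bar> < \<epsilon> k"
    using assms unfolding spreading_model_def by auto
  have "\<bar>norm (\<Sum>i<k. a i *\<^sub>R x (n i)) - norm (\<Sum>i<k. a i *\<^sub>R y i)\<bar> < \<epsilon> r"
    if n: "strict_mono n" "max k r \<le> n 0" "0 < r" and a: "\<forall>i<k. \<bar>a i\<bar> \<le> 1" for k r n a
  proof -
    define b where "b i = (if i < k then a i else 0)" for i
    have pad: "(\<Sum>i<max k r. b i *\<^sub>R v i) = (\<Sum>i<k. a i *\<^sub>R v i)" for v :: "nat \<Rightarrow> 'c::real_normed_vector"
      by (rule sum.mono_neutral_cong_right) (auto simp: b_def)
    have b: "\<forall>i<max k r. b i \<in> {-1..1}" using a by (auto simp: b_def abs_le_iff minus_le_iff)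
    have "strict_mono_on {..<max k r} n" using n(1) by (simp add: strict_mono_on_def strict_mono_def)
    then have "\<bar>norm (\<Sum>i<max k r. b i *\<^sub>R x (n i)) - norm (\<Sum>i<max k r. b i *\<^sub>R y i)\<bar> < \<epsilon> (max k r)"
      using n(2,3) b by (intro *[of "max k r" n b]) simp_all
    also have "\<epsilon> (max k r) \<le> \<epsilon> r" using \<epsilon>(1) by (simp add: decseq_def)
    finally show ?thesis by (simp add: pad)
  qed
  then show ?thesis using \<epsilon>(2) by blast
qed

lemma spreading_model_spreads:
  assumes "spreading_model x y"
  shows "\<exists>\<phi>. spreads x \<phi>"
proof -
  obtain \<epsilon> where \<epsilon>: "\<epsilon> \<longlonglongrightarrow> 0" and
    *: "\<And>k r n a. strict_mono n \<and> max k r \<le> n 0 \<and> 0 < r \<and> (\<forall>i<k. \<bar>a i\<bar> \<le> 1) \<Longrightarrow>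
      \<bar>norm (\<Sum>i<k. a i *\<^sub>R x (n i)) - norm (\<Sum>i<k. a i *\<^sub>R y i)\<bar> < \<epsilon> r"
    using spreading_model_padded[OF assms] by blast
  have "\<exists>r>0. 2 * \<epsilon> r \<le> 1 / real (Suc j)" for j
  proof -
    have "\<forall>\<^sub>F r in sequentially. \<epsilon> r < 1 / (2 * real (Suc j))"
      using \<epsilon> by (rule order_tendstoD) simp
    then obtain N where "\<epsilon> r < 1 / (2 * real (Suc j))" if "r \<ge> N" for r
      by (auto simp: eventually_sequentially)
    from this[of "Suc N"] show ?thesis by (intro exI[of _ "Suc N"]) (simp add: field_simps)
  qed
  then obtain \<phi> where \<phi>: "\<And>j. 0 < \<phi> j" "\<And>j. 2 * \<epsilon> (\<phi> j) \<le> 1 / real (Suc j)" by metis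
  have "spreads x \<phi>"
    unfolding spreads_def
  proof (intro allI impI, elim conjE)
    fix j k and n n' :: "nat \<Rightarrow> nat" and a :: "nat \<Rightarrow> real"
    assume n: "strict_mono n" "strict_mono n'" "max k (\<phi> j) \<le> n 0" "max k (\<phi> j) \<le> n' 0"
      and a: "\<forall>i<k. \<bar>a i\<bar> \<le> 1"
    show "\<bar>norm (\<Sum>i<k. a i *\<^sub>R x (n i)) - norm (\<Sum>i<k. a i *\<^sub>R x (n' i))\<bar> \<le> 1 / real (Suc j)"
      using *[of n k "\<phi> j" a] *[of n' k "\<phi> j" a] n a \<phi>[of j] by (smt (verit))
  qed
  then show ?thesis by blast
qed

lemma spreading_model_norm:
  assumes "spreading_model x y"
  shows "norm (\<Sum>i<k. a i *\<^sub>R y i) = spread_norm x k a"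
proof -
  obtain \<phi> where \<phi>: "spreads x \<phi>" using spreading_model_spreads[OF assms] by blast
  obtain \<epsilon> where \<epsilon>: "\<epsilon> \<longlonglongrightarrow> 0" and
    *: "\<And>k r n a. strict_mono n \<and> max k r \<le> n 0 \<and> 0 < r \<and> (\<forall>i<k. \<bar>a i\<bar> \<le> 1) \<Longrightarrow>
      \<bar>norm (\<Sum>i<k. a i *\<^sub>R x (n i)) - norm (\<Sum>i<k. a i *\<^sub>R y i)\<bar> < \<epsilon> r"
    using spreading_model_padded[OF assms] by blast
  obtain A where A: "0 < A" "\<And>i. i < k \<Longrightarrow> \<bar>a i\<bar> \<le> A" using coeff_bound by blast
  have scale: "norm (\<Sum>i<k. a i *\<^sub>R v i) = A * norm (\<Sum>i<k. (a i / A) *\<^sub>R v i)"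
    for v :: "nat \<Rightarrow> 'c::real_normed_vector"
  proof -
    have "(\<Sum>i<k. a i *\<^sub>R v i) = A *\<^sub>R (\<Sum>i<k. (a i / A) *\<^sub>R v i)"
      using A(1) by (simp add: scaleR_sum_right)
    then show ?thesis using A(1) by simp
  qed
  show ?thesis
  proof (rule sym, rule spread_norm_eqI[OF \<phi>])
    fix e :: real assume "0 < e"
    have "\<forall>\<^sub>F r in sequentially. \<epsilon> r < e / A"
      using \<epsilon> by (rule order_tendstoD) (use \<open>0 < e\<close> A in simp)
    then obtain N where N: "\<And>r. r \<ge> N \<Longrightarrow> \<epsilon> r < e / A" by (auto simp: eventually_sequentially)
    show "\<exists>N. \<forall>r\<ge>N. \<bar>norm (\<Sum>i<k. a i *\<^sub>R x (r + i)) - norm (\<Sum>i<k. a i *\<^sub>R y i)\<bar> \<le> e"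
    proof (intro exI[of _ "max k (Suc N)"] allI impI)
      fix r assume r: "r \<ge> max k (Suc N)"
      have "\<bar>norm (\<Sum>i<k. (a i / A) *\<^sub>R x (r + i)) - norm (\<Sum>i<k. (a i / A) *\<^sub>R y i)\<bar> < \<epsilon> (Suc N)"
        by (rule *) (use r A in \<open>auto simp: strict_mono_def\<close>)
      also have "\<dots> < e / A" using N by simp
      finally have "A * \<bar>norm (\<Sum>i<k. (a i / A) *\<^sub>R x (r + i)) - norm (\<Sum>i<k. (a i / A) *\<^sub>R y i)\<bar> < e"
        using A(1) by (simp add: field_simps)
      then show "\<bar>norm (\<Sum>i<k. a i *\<^sub>R x (r + i)) - norm (\<Sum>i<k. a i *\<^sub>R y i)\<bar> \<le> e"
        unfolding scale using A(1) by (simp add: abs_mult right_diff_distrib[symmetric])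
    qed
  qed
qed

text \<open>The worst deviation \<open>g k\<close> over combinations of length k is finite by the
  norm bound and tends to 0. Its tail supremum \<open>s\<close> is decreasing, and the added 1/(k+1)
  makes the inequality strict.\<close>

lemma spreading_modelI:
  assumes x: "spreads x \<phi>" and M: "\<And>n. norm (x n) \<le> M"
    and y: "\<And>k a. norm (\<Sum>i<k. a i *\<^sub>R y i) = spread_norm x k a"
  shows "spreading_model x y"
proof -
  define err where "err k = {\<bar>norm (\<Sum>i<k. a i *\<^sub>R x (n i)) - spread_norm x k a\<bar> |
      n a. strict_mono n \<and> k \<le> n 0 \<and> (\<forall>i<k. \<bar>a i\<bar> \<le> 1)}" for k
  define g where "g k = Sup (err k)" for k
  have M0: "0 \<le> M" using M[of 0] norm_ge_zero order_trans by blast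
  have bound: "e \<le> M * real k" if err: "e \<in> err k" for e k
  proof -
    obtain n a where e: "e = \<bar>norm (\<Sum>i<k. a i *\<^sub>R x (n i)) - spread_norm x k a\<bar>" and a: "\<forall>i<k. \<bar>a i\<bar> \<le> 1"
      using err unfolding err_def by blast
    have "(\<Sum>i<k. \<bar>a i\<bar>) \<le> (\<Sum>i<k. 1)" by (rule sum_mono) (use a in auto)
    then have "M * (\<Sum>i<k. \<bar>a i\<bar>) \<le> M * real k" using M0 by (intro mult_left_mono) auto
    moreover have "norm (\<Sum>i<k. a i *\<^sub>R x (n i)) \<le> M * (\<Sum>i<k. \<bar>a i\<bar>)"
      by (rule norm_sum_scaleR_le) (rule M)
    ultimately show ?thesis
      using spread_norm_le[OF x M, of k a] spread_norm_nonneg[OF x, of k a]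
        norm_ge_zero[of "\<Sum>i<k. a i *\<^sub>R x (n i)"]
      unfolding e by linarith
  qed
  have err_ne: "err k \<noteq> {}" for k
  proof -
    have "\<bar>norm (\<Sum>i<k. 0 *\<^sub>R x (k + i)) - spread_norm x k (\<lambda>i. 0)\<bar> \<in> err k"
      unfolding err_def mem_Collect_eq
      by (intro exI[of _ "\<lambda>i. k + i"] exI[of _ "\<lambda>i. 0"]) (auto simp: strict_mono_def)
    then show ?thesis by blast
  qed
  have le_g: "e \<le> g k" if "e \<in> err k" for e k
    unfolding g_def by (rule cSup_upper[OF that]) (use bound in \<open>auto simp: bdd_above_def\<close>)
  have g_le: "g k \<le> 1 / real (Suc j)" if "\<phi> j \<le> k" for j k
    unfolding g_def
  proof (rule cSup_least[OF err_ne])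
    fix e assume "e \<in> err k"
    then obtain n a where e: "e = \<bar>norm (\<Sum>i<k. a i *\<^sub>R x (n i)) - spread_norm x k a\<bar>"
      and "\<forall>i<k. \<bar>a i\<bar> \<le> 1" "strict_mono n" "k \<le> n 0"
      unfolding err_def by blast
    then show "e \<le> 1 / real (Suc j)"
      unfolding e using that by (intro spread_norm_approx[OF x]) auto
  qed
  have g_nonneg: "0 \<le> g k" for k
  proof -
    obtain e where "e \<in> err k" using err_ne by blast
    moreover from this have "0 \<le> e" by (auto simp: err_def)
    ultimately show ?thesis using le_g by fastforce
  qed
  have g0: "g \<longlonglongrightarrow> 0"
  proof (rule LIMSEQ_I)
    fix e :: real assume "0 < e"
    then obtain j where "1 / real (Suc j) \<le> e / 2" using ex_inverse_Suc_le half_gt_zero by blast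
    then show "\<exists>N. \<forall>k\<ge>N. norm (g k - 0) < e"
      using g_le[of j] g_nonneg \<open>0 < e\<close> by (intro exI[of _ "\<phi> j"]) fastforce
  qed
  then have "Bseq g" by (rule convergent_imp_Bseq[OF convergentI])
  then obtain B where B: "\<And>k. g k \<le> B" by (auto simp: Bseq_def abs_le_iff)
  define s where "s k = (SUP m\<in>{k..}. g m)" for k
  have bdd: "bdd_above (g ` {k..})" for k using B by (auto simp: bdd_above_def)
  have g_s: "g k \<le> s k" for k unfolding s_def by (rule cSUP_upper) (auto simp: bdd)
  have s_dec: "s m \<le> s k" if "k \<le> m" for k m
    unfolding s_def by (rule cSUP_subset_mono) (use that bdd in auto)
  have s0: "s \<longlonglongrightarrow> 0"
  proof (rule LIMSEQ_I)
    fix e :: real assume "0 < e"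
    then obtain N where N: "\<And>k. k \<ge> N \<Longrightarrow> g k < e / 2"
      using order_tendstoD(2)[OF g0, of "e / 2"] by (auto simp: eventually_sequentially)
    have "s k \<le> e / 2" if "k \<ge> N" for k
      unfolding s_def by (rule cSUP_least) (use N that in \<open>auto intro: less_imp_le\<close>)
    moreover have "0 \<le> s k" for k using g_s[of k] g_nonneg[of k] by simp
    ultimately show "\<exists>N. \<forall>k\<ge>N. norm (s k - 0) < e"
      using \<open>0 < e\<close> by (intro exI[of _ N]) fastforce
  qed
  define \<epsilon> where "\<epsilon> k = s k + 1 / real (Suc k)" for k
  show ?thesis
    unfolding spreading_model_def
  proof (intro exI[of _ \<epsilon>] conjI allI impI; (elim conjE)?)
    show "decseq \<epsilon>"
      unfolding decseq_def \<epsilon>_def by (auto intro!: add_mono s_dec simp: frac_le)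
    have "(\<lambda>k. s k + 1 / real (Suc k)) \<longlonglongrightarrow> 0 + 0"
      by (intro tendsto_add s0 LIMSEQ_Suc[OF lim_1_over_n])
    then show "\<epsilon> \<longlonglongrightarrow> 0" by (simp add: \<epsilon>_def[abs_def])
    fix k n and a :: "nat \<Rightarrow> real"
    assume k: "1 \<le> k" and n: "k \<le> n 0" "strict_mono_on {..<k} n" and a: "\<forall>i<k. a i \<in> {-1..1}"
    obtain n' where n': "strict_mono n'" "\<forall>i<k. n' i = n i" "k \<le> n' 0"
      using extend_strict_mono[OF n(2), of k] n(1) by blast
    have "\<bar>norm (\<Sum>i<k. a i *\<^sub>R x (n' i)) - spread_norm x k a\<bar> \<in> err k"
      unfolding err_def mem_Collect_eq
      by (rule exI[of _ n'], rule exI[of _ a]) (use n' a in \<open>auto simp: abs_le_iff minus_le_iff\<close>)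
    then have "\<bar>norm (\<Sum>i<k. a i *\<^sub>R x (n' i)) - spread_norm x k a\<bar> \<le> s k"
      by (rule order_trans[OF le_g g_s])
    moreover have "0 < 1 / real (Suc k)" by simp
    ultimately have "\<bar>norm (\<Sum>i<k. a i *\<^sub>R x (n' i)) - norm (\<Sum>i<k. a i *\<^sub>R y i)\<bar> < \<epsilon> k"
      unfolding \<epsilon>_def y by linarith
    then show "\<bar>norm (\<Sum>i<k. a i *\<^sub>R x (n i)) - norm (\<Sum>i<k. a i *\<^sub>R y i)\<bar> < \<epsilon> k"
      using n' by simp
  qed
qed

section \<open>Ramsey's theorem and subsequences generating spreading models\<close>

lemma ramsey_oscillation:
  fixes x :: "nat \<Rightarrow> 'a::real_normed_vector" and k :: nat
  assumes M: "\<And>n. norm (x n) \<le> M" and \<delta>: "0 < \<delta>"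
  shows "\<exists>r :: nat \<Rightarrow> nat. strict_mono r \<and> (\<forall>n n'. strict_mono n \<and> strict_mono n' \<longrightarrow>
    \<bar>norm (\<Sum>i<k. a i *\<^sub>R x (r (n i))) - norm (\<Sum>i<k. a i *\<^sub>R x (r (n' i)))\<bar> \<le> \<delta>)"
proof -
  define v where "v n = norm (\<Sum>i<k. a i *\<^sub>R x (n i))" for n :: "nat \<Rightarrow> nat"
  \<comment> \<open>The colour of a k-element set tells which interval of length \<delta> contains
    the norm along its increasing enumeration. The bound M leaves finitely many colours, and equal
    colours mean norms within \<delta>.\<close>
  define c where "c X = nat \<lfloor>v (\<lambda>i. sorted_list_of_set X ! i) / \<delta>\<rfloor>" for X
  define s where "s = Suc (nat \<lfloor>M * (\<Sum>i<k. \<bar>a i\<bar>) / \<delta>\<rfloor>)"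
  have v: "0 \<le> v n" "v n \<le> M * (\<Sum>i<k. \<bar>a i\<bar>)" for n
    unfolding v_def using M by (auto intro!: norm_sum_scaleR_le)
  have "c X < s" for X
    unfolding c_def s_def less_Suc_eq_le using v(2) \<delta> by (intro nat_mono floor_mono divide_right_mono) auto
  then obtain Z t where Z: "infinite Z" "\<And>X. X \<subseteq> Z \<Longrightarrow> finite X \<Longrightarrow> card X = k \<Longrightarrow> c X = t"
    using Ramsey[of "UNIV :: nat set" k c s] by auto
  define r where "r = enumerate Z"
  have r: "strict_mono r" unfolding r_def by (rule strict_mono_enumerate[OF Z(1)])
  have rZ: "r i \<in> Z" for i unfolding r_def by (rule enumerate_in_set[OF Z(1)])
  have color: "nat \<lfloor>v (\<lambda>i. r (n i)) / \<delta>\<rfloor> = t" if n: "strict_mono n" for n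
  proof -
    let ?l = "map (\<lambda>i. r (n i)) [0..<k]"
    have rn: "strict_mono (\<lambda>i. r (n i))" using r n by (simp add: strict_mono_def)
    then have "sorted_wrt (<) ?l" by (simp add: sorted_wrt_map sorted_wrt_iff_nth_less strict_mono_def)
    then have l: "sorted_list_of_set (set ?l) = ?l"
      using sorted_list_of_set.idem_if_sorted_distinct[of ?l] by (simp add: strict_sorted_iff)
    have "card (set ?l) = k"
      using distinct_card[of ?l] \<open>sorted_wrt (<) ?l\<close> by (simp add: strict_sorted_iff)
    then have "c (set ?l) = t" using Z(2)[of "set ?l"] rZ by auto
    moreover have "v (\<lambda>i. ?l ! i) = v (\<lambda>i. r (n i))" unfolding v_def by simp
    ultimately show ?thesis unfolding c_def l by simp
  qed
  have "\<bar>v (\<lambda>i. r (n i)) - v (\<lambda>i. r (n' i))\<bar> \<le> \<delta>" if "strict_mono n" "strict_mono n'" for n n'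
  proof -
    have "\<lfloor>v (\<lambda>i. r (n i)) / \<delta>\<rfloor> = \<lfloor>v (\<lambda>i. r (n' i)) / \<delta>\<rfloor>"
      using color[OF that(1)] color[OF that(2)] v(1) \<delta>
      by (simp add: eq_nat_nat_iff[symmetric])
    then have "\<bar>v (\<lambda>i. r (n i)) / \<delta> - v (\<lambda>i. r (n' i)) / \<delta>\<bar> \<le> 1" by linarith
    then have "\<bar>v (\<lambda>i. r (n i)) - v (\<lambda>i. r (n' i))\<bar> / \<delta> \<le> 1"
      using \<delta> by (simp add: diff_divide_distrib[symmetric])
    then show ?thesis using \<delta> by (simp add: field_simps)
  qed
  then show ?thesis using r unfolding v_def by blast
qed

lemma ramsey_oscillation_finite:
  fixes x :: "nat \<Rightarrow> 'a::real_normed_vector" and k :: nat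
  assumes "finite F" and M: "\<And>n. norm (x n) \<le> M" and \<delta>: "0 < \<delta>"
  shows "\<exists>r :: nat \<Rightarrow> nat. strict_mono r \<and> (\<forall>a\<in>F. \<forall>n n'. strict_mono n \<and> strict_mono n' \<longrightarrow>
    \<bar>norm (\<Sum>i<k. a i *\<^sub>R x (r (n i))) - norm (\<Sum>i<k. a i *\<^sub>R x (r (n' i)))\<bar> \<le> \<delta>)"
  using assms(1)
proof (induction F)
  case empty
  show ?case by (intro exI[of _ id]) (simp add: strict_mono_def)
next
  case (insert b F)
  then obtain r :: "nat \<Rightarrow> nat" where r: "strict_mono r" and F: "\<And>a n n'. a \<in> F \<Longrightarrow> strict_mono n \<Longrightarrow> strict_mono n' \<Longrightarrow>
    \<bar>norm (\<Sum>i<k. a i *\<^sub>R x (r (n i))) - norm (\<Sum>i<k. a i *\<^sub>R x (r (n' i)))\<bar> \<le> \<delta>" by blast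
  obtain r' :: "nat \<Rightarrow> nat" where r': "strict_mono r'" and b: "\<And>n n'. strict_mono n \<Longrightarrow> strict_mono n' \<Longrightarrow>
    \<bar>norm (\<Sum>i<k. b i *\<^sub>R x (r (r' (n i)))) - norm (\<Sum>i<k. b i *\<^sub>R x (r (r' (n' i))))\<bar> \<le> \<delta>"
    using ramsey_oscillation[of "\<lambda>n. x (r n)" M \<delta> b k] M \<delta> by blast
  have mono: "strict_mono (\<lambda>i. r' (n i))" if "strict_mono n" for n :: "nat \<Rightarrow> nat"
    using r' that by (simp add: strict_mono_def)
  have rr: "strict_mono (\<lambda>i. r (r' i))" using r r' by (simp add: strict_mono_def)
  have "\<bar>norm (\<Sum>i<k. a i *\<^sub>R x (r (r' (n i)))) - norm (\<Sum>i<k. a i *\<^sub>R x (r (r' (n' i))))\<bar> \<le> \<delta>"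
    if "a \<in> insert b F" "strict_mono n" "strict_mono n'" for a n n'
    using that b[of n n'] F[of a "\<lambda>i. r' (n i)" "\<lambda>i. r' (n' i)"] mono by (cases "a = b") auto
  with rr show ?case by (intro exI[of _ "\<lambda>i. r (r' i)"]) blast
qed

lemma ramsey_oscillation_uniform:
  fixes x :: "nat \<Rightarrow> 'a::real_normed_vector" and k :: nat
  assumes M: "\<And>n. norm (x n) \<le> M" and \<delta>: "0 < \<delta>"
  shows "\<exists>r :: nat \<Rightarrow> nat. strict_mono r \<and> (\<forall>a n n'. (\<forall>i<k. \<bar>a i\<bar> \<le> 1) \<and> strict_mono n \<and> strict_mono n' \<longrightarrow>
    \<bar>norm (\<Sum>i<k. a i *\<^sub>R x (r (n i))) - norm (\<Sum>i<k. a i *\<^sub>R x (r (n' i)))\<bar> \<le> \<delta>)"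
proof -
  have M0: "0 \<le> M" using M[of 0] norm_ge_zero order_trans by blast
  \<comment> \<open>Rounding the coefficients to multiples of 1/q moves each norm by at most M k /
    q, hence by at most \<delta>/4. Two roundings cost \<delta>/2, the other half being the
    tolerance on the finite grid.\<close>
  define q where "q = Suc (nat \<lceil>4 * M * real k / \<delta>\<rceil>)"
  have q: "4 * M * real k \<le> \<delta> * real q"
  proof -
    have "4 * M * real k / \<delta> \<le> real q" unfolding q_def by linarith
    then show ?thesis using \<delta> by (simp add: field_simps)
  qed
  have q0: "0 < real q" by (simp add: q_def)
  define G where "G = (\<lambda>t::int. of_int t / real q) ` {- int q..int q}"
  define F where "F = PiE {..<k} (\<lambda>_. G)"
  have "finite F" unfolding F_def G_def by (intro finite_PiE) auto
  then obtain r :: "nat \<Rightarrow> nat" where r: "strict_mono r" and F: "\<And>a n n'. a \<in> F \<Longrightarrow> strict_mono n \<Longrightarrow> strict_mono n' \<Longrightarrow>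
    \<bar>norm (\<Sum>i<k. a i *\<^sub>R x (r (n i))) - norm (\<Sum>i<k. a i *\<^sub>R x (r (n' i)))\<bar> \<le> \<delta> / 2"
    using ramsey_oscillation_finite[of F x M "\<delta> / 2" k] M \<delta> by auto
  have "\<bar>norm (\<Sum>i<k. a i *\<^sub>R x (r (n i))) - norm (\<Sum>i<k. a i *\<^sub>R x (r (n' i)))\<bar> \<le> \<delta>"
    if a: "\<forall>i<k. \<bar>a i\<bar> \<le> 1" and n: "strict_mono n" "strict_mono n'" for a n n'
  proof -
    define b where "b = (\<lambda>i\<in>{..<k}. of_int \<lfloor>a i * real q\<rfloor> / real q :: real)"
    have "\<lfloor>a i * real q\<rfloor> \<in> {- int q..int q}" if "i < k" for i
    proof -
      have "- 1 \<le> a i" "a i \<le> 1" using a that by (auto simp: abs_le_iff minus_le_iff)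
      then have "- 1 * real q \<le> a i * real q" "a i * real q \<le> 1 * real q"
        using mult_right_mono[of "-1" "a i" "real q"] mult_right_mono[of "a i" 1 "real q"] q0 by simp_all
      then show ?thesis by (simp add: le_floor_iff floor_le_iff)
    qed
    then have b: "b \<in> F" by (auto simp: F_def G_def b_def)
    have ab: "\<bar>a i - b i\<bar> \<le> 1 / real q" if "i < k" for i
    proof -
      have "\<bar>a i * real q - of_int \<lfloor>a i * real q\<rfloor>\<bar> \<le> 1" by linarith
      moreover have "a i - b i = (a i * real q - of_int \<lfloor>a i * real q\<rfloor>) / real q"
        using that q0 by (simp add: b_def field_simps)
      ultimately show ?thesis using q0 by (simp add: divide_right_mono)
    qed
    have near: "\<bar>norm (\<Sum>i<k. a i *\<^sub>R x (m i)) - norm (\<Sum>i<k. b i *\<^sub>R x (m i))\<bar> \<le> \<delta> / 4" for m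
    proof -
      have "\<bar>norm (\<Sum>i<k. a i *\<^sub>R x (m i)) - norm (\<Sum>i<k. b i *\<^sub>R x (m i))\<bar>
          \<le> norm (\<Sum>i<k. (a i - b i) *\<^sub>R x (m i))"
        using norm_triangle_ineq3 by (simp add: scaleR_diff_left sum_subtractf)
      also have "\<dots> \<le> M * (\<Sum>i<k. \<bar>a i - b i\<bar>)" by (rule norm_sum_scaleR_le) (rule M)
      also have "\<dots> \<le> M * (\<Sum>i<k. 1 / real q)" using M0 ab by (intro mult_left_mono sum_mono) auto
      also have "\<dots> \<le> \<delta> / 4" using q q0 by (simp add: field_simps)
      finally show ?thesis .
    qed
    show ?thesis using near[of "\<lambda>i. r (n i)"] near[of "\<lambda>i. r (n' i)"] F[OF b n] by linarith
  qed
  then show ?thesis using r by blast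
qed

theorem Brunel_Sucheston:
  fixes x :: "nat \<Rightarrow> 'a::real_normed_vector"
  assumes M: "\<And>n. norm (x n) \<le> M"
  shows "\<exists>h \<phi>. strict_mono h \<and> spreads (x \<circ> h) \<phi>"
proof -
  \<comment> \<open>One index s governs both length and tolerance, so a single diagonal sequence
    serves all lengths and tolerances.\<close>
  define P where "P s h \<longleftrightarrow> (\<forall>a n n'. (\<forall>i<s. \<bar>a i\<bar> \<le> 1) \<and> strict_mono n \<and> strict_mono n' \<longrightarrow>
    \<bar>norm (\<Sum>i<s. a i *\<^sub>R x (h (n i))) - norm (\<Sum>i<s. a i *\<^sub>R x (h (n' i)))\<bar> \<le> 1 / real (Suc s))"
    for s and h :: "nat \<Rightarrow> nat"
  interpret subseqs P
  proof
    fix s and h :: "nat \<Rightarrow> nat"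
    show "\<exists>r. strict_mono r \<and> P s (h \<circ> r)"
      unfolding P_def using ramsey_oscillation_uniform[of "\<lambda>n. x (h n)" M "1 / real (Suc s)" s] M by simp
  qed
  have P_diag: "P s (diagseq \<circ> (+) (Suc s))" for s
  proof (rule diagseq_holds)
    fix r h :: "nat \<Rightarrow> nat" and s assume r: "strict_mono r" and h: "P s h"
    have mono: "strict_mono (\<lambda>i. r (n i))" if "strict_mono n" for n :: "nat \<Rightarrow> nat"
      using r that by (simp add: strict_mono_def)
    show "P s (h \<circ> r)"
      unfolding P_def
    proof (intro allI impI, elim conjE)
      fix n n' :: "nat \<Rightarrow> nat" and a :: "nat \<Rightarrow> real"
      assume "\<forall>i<s. \<bar>a i\<bar> \<le> 1" "strict_mono n" "strict_mono n'"
      then show "\<bar>norm (\<Sum>i<s. a i *\<^sub>R x ((h \<circ> r) (n i))) - norm (\<Sum>i<s. a i *\<^sub>R x ((h \<circ> r) (n' i)))\<bar> \<le> 1 / real (Suc s)"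
        using h[unfolded P_def, rule_format, of a "\<lambda>i. r (n i)" "\<lambda>i. r (n' i)"] mono by simp
    qed
  qed
  \<comment> \<open>\<open>P_diag\<close> concerns the diagonal sequence from \<open>Suc s\<close>
    on; after the shift by one it covers all indices from s on.\<close>
  define h where "h = (\<lambda>n. diagseq (Suc n))"
  have "strict_mono h" using subseq_diagseq by (simp add: h_def strict_mono_def)
  moreover have "spreads (x \<circ> h) id"
    unfolding spreads_def
  proof (intro allI impI, elim conjE)
    fix j k and n n' :: "nat \<Rightarrow> nat" and a :: "nat \<Rightarrow> real"
    assume n: "strict_mono n" "strict_mono n'" "max k (id j) \<le> n 0" "max k (id j) \<le> n' 0"
      and a: "\<forall>i<k. \<bar>a i\<bar> \<le> 1"
    \<comment> \<open>Padding with zeros to length s makes the identity a modulus.\<close>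
    define s where "s = max k j"
    define b where "b i = (if i < k then a i else 0)" for i
    have pad: "(\<Sum>i<s. b i *\<^sub>R v i) = (\<Sum>i<k. a i *\<^sub>R v i)" for v :: "nat \<Rightarrow> 'a"
      by (rule sum.mono_neutral_cong_right) (auto simp: b_def s_def)
    have s: "s \<le> n i" "s \<le> n' i" for i
      using strict_mono_ge_add[of n s i] strict_mono_ge_add[of n' s i] n by (auto simp: s_def)
    have shift: "strict_mono (\<lambda>i. m i - s)" if "strict_mono m" "\<And>i. s \<le> m i" for m :: "nat \<Rightarrow> nat"
      using that by (simp add: strict_mono_def diff_less_mono)
    have eq: "(diagseq \<circ> (+) (Suc s)) (m i - s) = h (m i)" if "s \<le> m i" for m :: "nat \<Rightarrow> nat" and i
      using that by (simp add: h_def)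
    have "\<bar>norm (\<Sum>i<s. b i *\<^sub>R x ((diagseq \<circ> (+) (Suc s)) (n i - s))) -
           norm (\<Sum>i<s. b i *\<^sub>R x ((diagseq \<circ> (+) (Suc s)) (n' i - s)))\<bar> \<le> 1 / real (Suc s)"
      using P_diag[of s] shift[OF n(1) s(1)] shift[OF n(2) s(2)] a unfolding P_def by (simp add: b_def)
    then have "\<bar>norm (\<Sum>i<s. b i *\<^sub>R x (h (n i))) - norm (\<Sum>i<s. b i *\<^sub>R x (h (n' i)))\<bar> \<le> 1 / real (Suc s)"
      by (simp only: eq s)
    also have "\<dots> \<le> 1 / real (Suc j)" by (simp add: s_def frac_le)
    finally show "\<bar>norm (\<Sum>i<k. a i *\<^sub>R (x \<circ> h) (n i)) - norm (\<Sum>i<k. a i *\<^sub>R (x \<circ> h) (n' i))\<bar> \<le> 1 / real (Suc j)"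
      by (simp add: pad)
  qed
  ultimately show ?thesis by blast
qed

section \<open>Weakly null sequences\<close>

text \<open>Tychonoff's theorem. On linear functionals the product topology is the weak*
  topology.\<close>

lemma compact_bounded_functions: "compact {f :: 'i \<Rightarrow> real. \<forall>i. \<bar>f i\<bar> \<le> b i}"
proof -
  have "compactin (product_topology (\<lambda>_. euclidean) UNIV) (PiE UNIV (\<lambda>i. {- b i..b i}))"
    by (subst compactin_PiE) auto
  moreover have "PiE UNIV (\<lambda>i. {- b i..b i}) = {f :: 'i \<Rightarrow> real. \<forall>i. \<bar>f i\<bar> \<le> b i}"
    by (auto simp: PiE_def Pi_def abs_le_iff minus_le_iff)
  moreover have "product_topology (\<lambda>_ :: 'i. euclideanreal) UNIV = euclidean"
    by (simp add: open_fun_def topology_eq)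
  ultimately show ?thesis by simp
qed

lemma bounded_linear_norm_le_1:
  assumes "linear f" "\<And>v. \<bar>f v\<bar> \<le> norm v"
  shows "bounded_linear (f :: 'a::real_normed_vector \<Rightarrow> real)"
  using assms by (intro bounded_linear_intro[of _ 1]) (auto simp: linear_add linear_cmul)

text \<open>That \<open>G\<close> does not depend on \<open>f\<close> is due to the weak* compactness of the dual ball.\<close>

lemma weakly_null_uniform_gap:
  fixes x :: "nat \<Rightarrow> 'a::real_normed_vector"
  assumes x: "weakly_null x" and \<eta>: "0 < \<eta>"
  shows "\<exists>G\<ge>m. \<forall>f. linear f \<and> (\<forall>v. \<bar>f v\<bar> \<le> norm v) \<longrightarrow> (\<exists>n\<in>{m..G}. \<bar>f (x n)\<bar> < \<eta>)"
proof -
  define B where "B = {f :: 'a \<Rightarrow> real. \<forall>v. \<bar>f v\<bar> \<le> norm v}"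
  define L where "L = {f :: 'a \<Rightarrow> real. (\<forall>u v. f (u + v) = f u + f v) \<and> (\<forall>c v. f (c *\<^sub>R v) = c *\<^sub>R f v)}"
  have coord: "continuous_on UNIV (\<lambda>f :: 'a \<Rightarrow> real. f v)" for v
    by (rule continuous_on_product_coordinates)
  have "closed L" unfolding L_def
    by (intro closed_Collect_conj closed_Collect_all closed_Collect_eq continuous_intros coord)
  then have "compact (B \<inter> L)"
    unfolding B_def by (intro compact_Int_closed compact_bounded_functions)
  have linL: "linear f \<longleftrightarrow> f \<in> L" for f
    by (auto simp: L_def linear_iff)
  define U where "U n = {f :: 'a \<Rightarrow> real. \<bar>f (x n)\<bar> < \<eta>}" for n
  have "open (U n)" for n unfolding U_def
    by (intro open_Collect_less continuous_intros coord)
  moreover have "B \<inter> L \<subseteq> (\<Union>n\<in>{m..}. U n)"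
  proof
    fix f assume f: "f \<in> B \<inter> L"
    then have "bounded_linear f" using bounded_linear_norm_le_1[of f] by (auto simp: linL B_def)
    then have "(\<lambda>n. f (x n)) \<longlonglongrightarrow> 0" using x unfolding weakly_null_def by blast
    then obtain N where "\<And>n. n \<ge> N \<Longrightarrow> norm (f (x n) - 0) < \<eta>" using LIMSEQ_D[OF _ \<eta>] by meson
    from this[of "max N m"] show "f \<in> (\<Union>n\<in>{m..}. U n)"
      by (intro UN_I[of "max N m"]) (simp_all add: U_def)
  qed
  ultimately obtain D where D: "D \<subseteq> {m..}" "finite D" "B \<inter> L \<subseteq> (\<Union>n\<in>D. U n)"
    by (rule compactE_image[OF \<open>compact (B \<inter> L)\<close>])
  have "\<exists>n\<in>{m..Max (insert m D)}. \<bar>f (x n)\<bar> < \<eta>" if "linear f" "\<forall>v. \<bar>f v\<bar> \<le> norm v" for f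
  proof -
    have "f \<in> B \<inter> L" using that by (simp add: B_def linL)
    then obtain n where "n \<in> D" "f \<in> U n" using D(3) by blast
    then show ?thesis using D by (intro bexI[of _ n]) (auto simp: U_def)
  qed
  then show ?thesis using D(2) by (intro exI[of _ "Max (insert m D)"]) auto
qed

text \<open>The functional norming the sum over \<open>F\<close> nearly vanishes on suitably chosen vectors
  in the remaining positions.\<close>

lemma spread_norm_suppression:
  assumes x: "weakly_null x" "spreads x \<phi>"
  shows "spread_norm x k (\<lambda>i. if i \<in> F then a i else 0) \<le> spread_norm x k a"
proof (rule field_le_epsilon)
  fix e :: real assume e: "0 < e"
  let ?b = "\<lambda>i. if i \<in> F then a i else 0"
  obtain A where A: "0 < A" "\<And>i. i < k \<Longrightarrow> \<bar>a i\<bar> \<le> A" using coeff_bound by blast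
  obtain j where j: "A / real (Suc j) \<le> e / 4" using ex_inverse_Suc_le[of "e / 4"] e by auto
  define \<eta> where "\<eta> = e / (2 * A * real (Suc k))"
  have \<eta>: "0 < \<eta>" using e A by (simp add: \<eta>_def)
  obtain G where G: "\<And>m. m \<le> G m"
    "\<And>m f. linear f \<Longrightarrow> \<forall>v. \<bar>f v\<bar> \<le> norm v \<Longrightarrow> \<exists>n\<in>{m..G m}. \<bar>f (x n)\<bar> < \<eta>"
    using weakly_null_uniform_gap[OF x(1) \<eta>] by metis
  \<comment> \<open>Any choice of one position from each interval \<open>{m l..G (m l)}\<close> is
    increasing, so single vectors can be moved independently of each other.\<close>
  define m where "m = rec_nat (max k (\<phi> j)) (\<lambda>_ r. Suc (G r))"
  have m0: "m 0 = max k (\<phi> j)" and mS: "m (Suc l) = Suc (G (m l))" for l by (simp_all add: m_def)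
  have m: "strict_mono m" using G(1) by (simp add: strict_mono_Suc_iff mS less_Suc_eq_le)
  let ?v = "\<Sum>i<k. ?b i *\<^sub>R x (m i)"
  obtain f where f: "bounded_linear f" "\<forall>v. \<bar>f v\<bar> \<le> norm v" "f ?v = norm ?v"
    using norming_functional by blast
  have lin: "linear f" using f(1) by (rule bounded_linear.linear)
  \<comment> \<open>f depends on m, so the intervals had to be fixed before f was known; hence the
    need for a bound G uniform in f.\<close>
  have "\<forall>l. \<exists>q. q \<in> {m l..G (m l)} \<and> \<bar>f (x q)\<bar> < \<eta>"
    using G(2)[OF lin f(2)] by blast
  then obtain p :: "nat \<Rightarrow> nat" where p: "\<And>l. p l \<in> {m l..G (m l)}" "\<And>l. \<bar>f (x (p l))\<bar> < \<eta>"
    unfolding choice_iff by blast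
  \<comment> \<open>Only the vectors outside F are moved. Both m and n start beyond the modulus, so
    each sum approximates its spreading norm.\<close>
  define n where "n l = (if l \<in> F then m l else p l)" for l
  have n_in: "m l \<le> n l" "n l \<le> G (m l)" for l using p(1)[of l] G(1) by (auto simp: n_def)
  have n: "strict_mono n"
    unfolding strict_mono_Suc_iff
  proof
    fix l show "n l < n (Suc l)" using n_in(2)[of l] n_in(1)[of "Suc l"] by (simp add: mS)
  qed
  have "norm ?v - A * real k * \<eta> \<le> f (\<Sum>i<k. a i *\<^sub>R x (n i))"
  proof -
    have "?b i * f (x (m i)) - A * \<eta> \<le> a i * f (x (n i))" if "i < k" for i
    proof (cases "i \<in> F")
      case False
      have "\<bar>a i * f (x (p i))\<bar> \<le> A * \<eta>"
        unfolding abs_mult using A(2)[OF that] p(2)[of i] by (intro mult_mono) auto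
      then show ?thesis using False by (simp add: n_def)
    qed (use A \<eta> in \<open>simp add: n_def\<close>)
    then have "(\<Sum>i<k. ?b i * f (x (m i)) - A * \<eta>) \<le> (\<Sum>i<k. a i * f (x (n i)))"
      by (intro sum_mono) auto
    then have "(\<Sum>i<k. ?b i * f (x (m i))) - A * real k * \<eta> \<le> (\<Sum>i<k. a i * f (x (n i)))"
      by (simp add: sum_subtractf mult.commute mult.left_commute)
    moreover have "f (\<Sum>i<k. c i *\<^sub>R x (q i)) = (\<Sum>i<k. c i * f (x (q i)))" for c and q :: "nat \<Rightarrow> nat"
      by (simp add: linear_sum[OF lin] linear_cmul[OF lin])
    ultimately show ?thesis unfolding f(3)[symmetric] by simp
  qed
  also have "\<dots> \<le> norm (\<Sum>i<k. a i *\<^sub>R x (n i))" using f(2) by (auto simp: abs_le_iff)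
  also have "\<dots> \<le> spread_norm x k a + e / 4"
  proof -
    have "\<bar>norm (\<Sum>i<k. a i *\<^sub>R x (n i)) - spread_norm x k a\<bar> \<le> A / real (Suc j)"
      by (rule spread_norm_approx[OF x(2) n]) (use n_in(1)[of 0] m0 A in auto)
    then show ?thesis using j by linarith
  qed
  finally have "norm ?v \<le> spread_norm x k a + e / 4 + A * real k * \<eta>" by simp
  moreover have "spread_norm x k ?b \<le> norm ?v + e / 4"
  proof -
    have "\<bar>norm ?v - spread_norm x k ?b\<bar> \<le> A / real (Suc j)"
      by (rule spread_norm_approx[OF x(2) m]) (use m0 A in auto)
    then show ?thesis using j by linarith
  qed
  moreover have "A * real k * \<eta> \<le> e / 2"
  proof -
    have "A * real k * \<eta> = e / 2 * (real k / real (Suc k))" using A(1) by (simp add: \<eta>_def divide_simps)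
    also have "\<dots> \<le> e / 2 * 1" using e by (intro mult_left_mono) auto
    finally show ?thesis by simp
  qed
  ultimately show "spread_norm x k ?b \<le> spread_norm x k a + e" by linarith
qed

section \<open>Lower l1 estimates and averages\<close>

lemma spread_norm_ge_sum:
  assumes x: "spreads x \<phi>" and M: "\<And>n. norm (x n) \<le> M"
    and \<delta>: "\<And>T. T \<ge> T0 \<Longrightarrow> \<delta> * real T \<le> spread_norm x T (\<lambda>_. 1)"
  shows "\<delta> * \<bar>\<Sum>l<k. a l\<bar> \<le> spread_norm x k a"
proof -
  define S where "S = (\<Sum>l<k. \<bar>a l\<bar>)"
  have M0: "0 \<le> M" using M[of 0] norm_ge_zero order_trans by blast
  \<comment> \<open>Add T consecutive translates of the block with coefficients a and collect the
    terms by coefficient. The resulting sums \<open>u l\<close> of T consecutive vectors differ from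
    \<open>u 0\<close> only in end terms, so the error is independent of T and vanishes after
    division by T.\<close>
  have main: "\<bar>\<Sum>l<k. a l\<bar> * spread_norm x T (\<lambda>_. 1) - 2 * real k * M * S \<le> real T * spread_norm x k a" for T
  proof (rule LIMSEQ_le)
    show "(\<lambda>r. \<bar>\<Sum>l<k. a l\<bar> * norm (\<Sum>t<T. 1 *\<^sub>R x (r + t)) - 2 * real k * M * S)
        \<longlonglongrightarrow> \<bar>\<Sum>l<k. a l\<bar> * spread_norm x T (\<lambda>_. 1) - 2 * real k * M * S"
      by (intro tendsto_intros spread_norm_LIMSEQ[OF x])
    have "(\<lambda>r. \<Sum>t<T. norm (\<Sum>l<k. a l *\<^sub>R x ((r + t) + l))) \<longlonglongrightarrow> (\<Sum>t<T. spread_norm x k a)"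
      by (intro tendsto_sum LIMSEQ_ignore_initial_segment[OF spread_norm_LIMSEQ[OF x]])
    then show "(\<lambda>r. \<Sum>t<T. norm (\<Sum>l<k. a l *\<^sub>R x ((r + t) + l))) \<longlonglongrightarrow> real T * spread_norm x k a"
      by simp
    have "\<bar>\<Sum>l<k. a l\<bar> * norm (\<Sum>t<T. 1 *\<^sub>R x (r + t)) - 2 * real k * M * S
        \<le> (\<Sum>t<T. norm (\<Sum>l<k. a l *\<^sub>R x (r + t + l)))" for r
    proof -
      define u where "u l = (\<Sum>t<T. x (r + l + t))" for l
      have step: "norm (u (Suc l) - u l) \<le> 2 * M" for l
      proof -
        have "u (Suc l) - u l = (\<Sum>t<T. x (r + l + Suc t) - x (r + l + t))"
          by (simp add: u_def sum_subtractf)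
        also have "\<dots> = x (r + l + T) - x (r + l)" by (subst sum_lessThan_telescope) simp
        finally show ?thesis using norm_triangle_ineq4[of "x (r + l + T)" "x (r + l)"] M[of "r + l + T"] M[of "r + l"]
          by simp
      qed
      have near: "norm (u l - u 0) \<le> 2 * real l * M" for l
      proof (induction l)
        case (Suc l)
        then show ?case
          using step[of l] norm_triangle_ineq[of "u (Suc l) - u l" "u l - u 0"] by (simp add: algebra_simps)
      qed simp
      have "norm (\<Sum>l<k. a l *\<^sub>R (u l - u 0)) \<le> 2 * real k * M * S"
        unfolding S_def
      proof (rule norm_sum_scaleR_le)
        fix l assume "l < k"
        then have "2 * real l * M \<le> 2 * real k * M" using M0 by (intro mult_right_mono) auto
        then show "norm (u l - u 0) \<le> 2 * real k * M" using near[of l] by simp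
      qed
      moreover have "(\<Sum>l<k. a l *\<^sub>R u l) = (\<Sum>l<k. a l) *\<^sub>R u 0 + (\<Sum>l<k. a l *\<^sub>R (u l - u 0))"
        by (simp add: scaleR_diff_right sum_subtractf scaleR_sum_left)
      ultimately have "\<bar>\<Sum>l<k. a l\<bar> * norm (u 0) - 2 * real k * M * S \<le> norm (\<Sum>l<k. a l *\<^sub>R u l)"
        using norm_diff_ineq[of "(\<Sum>l<k. a l) *\<^sub>R u 0" "\<Sum>l<k. a l *\<^sub>R (u l - u 0)"] by simp
      also have "(\<Sum>l<k. a l *\<^sub>R u l) = (\<Sum>t<T. \<Sum>l<k. a l *\<^sub>R x (r + t + l))"
        unfolding u_def scaleR_sum_right by (subst sum.swap) (simp add: ac_simps)
      also have "norm \<dots> \<le> (\<Sum>t<T. norm (\<Sum>l<k. a l *\<^sub>R x (r + t + l)))" by (rule norm_sum)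
      finally show ?thesis by (simp add: u_def)
    qed
    then show "\<exists>N. \<forall>r\<ge>N. \<bar>\<Sum>l<k. a l\<bar> * norm (\<Sum>t<T. 1 *\<^sub>R x (r + t)) - 2 * real k * M * S
        \<le> (\<Sum>t<T. norm (\<Sum>l<k. a l *\<^sub>R x (r + t + l)))" by blast
  qed
  show ?thesis
  proof (rule field_le_epsilon)
    fix e :: real assume "0 < e"
    obtain T :: nat where T: "2 * real k * M * S / e \<le> real T" using real_arch_simple by blast
    define T' where "T' = max (Suc T) T0"
    have "2 * real k * M * S \<le> e * real T'"
    proof -
      have "2 * real k * M * S \<le> e * real T" using T \<open>0 < e\<close> by (simp add: field_simps)
      also have "\<dots> \<le> e * real T'" using \<open>0 < e\<close> by (simp add: T'_def)
      finally show ?thesis .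
    qed
    moreover have "\<bar>\<Sum>l<k. a l\<bar> * (\<delta> * real T') \<le> \<bar>\<Sum>l<k. a l\<bar> * spread_norm x T' (\<lambda>_. 1)"
      by (intro mult_left_mono \<delta>) (auto simp: T'_def)
    ultimately have "real T' * (\<delta> * \<bar>\<Sum>l<k. a l\<bar>) \<le> real T' * (spread_norm x k a + e)"
      using main[of T'] by (simp add: algebra_simps)
    then show "\<delta> * \<bar>\<Sum>l<k. a l\<bar> \<le> spread_norm x k a + e"
      by (rule mult_left_le_imp_le) (simp add: T'_def)
  qed
qed

text \<open>Split the coefficients by sign. Suppression bounds the norm of each part by that of the
  whole, and \<open>spread_norm_ge_sum\<close> bounds it from below; two parts give the factor 2.
  The contrapositive yields the small averages stored in codes.\<close>

lemma weakly_null_spread_norm_ge_l1: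
  assumes x: "weakly_null x" "spreads x \<phi>" and M: "\<And>n. norm (x n) \<le> M"
    and \<delta>: "\<And>T. T \<ge> T0 \<Longrightarrow> \<delta> * real T \<le> spread_norm x T (\<lambda>_. 1)"
  shows "\<delta> * (\<Sum>l<k. \<bar>a l\<bar>) \<le> 2 * spread_norm x k a"
proof (cases "0 \<le> \<delta>")
  case True
  define P where "P = {l. 0 \<le> a l}"
  define s where "s F = (\<Sum>l<k. if l \<in> F then a l else 0)" for F
  have "\<delta> * \<bar>s F\<bar> \<le> spread_norm x k a" for F
  proof -
    have "\<delta> * \<bar>s F\<bar> \<le> spread_norm x k (\<lambda>l. if l \<in> F then a l else 0)"
      unfolding s_def by (rule spread_norm_ge_sum[OF x(2) M]) (rule \<delta>)
    then show ?thesis using spread_norm_suppression[OF x, of k F a] by simp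
  qed
  from this[of P] this[of "- P"] have "\<delta> * (\<bar>s P\<bar> + \<bar>s (- P)\<bar>) \<le> 2 * spread_norm x k a"
    by (simp add: distrib_left)
  moreover have "(\<Sum>l<k. \<bar>a l\<bar>) = s P - s (- P)"
    unfolding s_def sum_subtractf[symmetric] by (rule sum.cong) (auto simp: P_def)
  then have "\<delta> * (\<Sum>l<k. \<bar>a l\<bar>) \<le> \<delta> * (\<bar>s P\<bar> + \<bar>s (- P)\<bar>)" using True by (intro mult_left_mono) auto
  ultimately show ?thesis by simp
next
  case False
  have "0 \<le> (\<Sum>l<k. \<bar>a l\<bar>)" by (simp add: sum_nonneg)
  then have "\<delta> * (\<Sum>l<k. \<bar>a l\<bar>) \<le> 0" using False by (simp add: mult_nonpos_nonneg)
  then show ?thesis using spread_norm_nonneg[OF x(2), of k a] by simp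
qed

text \<open>If a functional exceeded e infinitely often with one sign, its averages along those
  indices would stay above e, against the small norm averages along the same indices.\<close>

lemma weakly_null_averages:
  fixes x :: "nat \<Rightarrow> 'a::real_normed_vector"
  assumes "\<And>j. \<exists>K\<ge>1. \<forall>n. strict_mono n \<and> K \<le> n 0 \<longrightarrow> norm (\<Sum>i<K. x (n i)) \<le> real K / real (Suc j)"
  shows "weakly_null x"
  unfolding weakly_null_def
proof (intro allI impI)
  fix f :: "'a \<Rightarrow> real" assume f: "bounded_linear f"
  then obtain C where C: "0 < C" "\<And>v. norm (f v) \<le> norm v * C" using bounded_linear.pos_bounded by blast
  have one_sided: "finite {n. e < c * f (x n)}" if e: "0 < e" and c: "\<bar>c\<bar> = 1" for e c
  proof (rule ccontr)
    assume inf: "infinite {n. e < c * f (x n)}"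
    obtain j where j: "C / real (Suc j) \<le> e / 2" using ex_inverse_Suc_le[of "e / 2" C] e by auto
    obtain K :: nat where K: "K \<ge> 1" "\<And>n. strict_mono n \<Longrightarrow> K \<le> n 0 \<Longrightarrow> norm (\<Sum>i<K. x (n i)) \<le> real K / real (Suc j)"
      using assms[of j] by blast
    define n where "n i = enumerate {n. e < c * f (x n)} (K + i)" for i
    have n: "strict_mono n"
      using strict_mono_enumerate[OF inf] by (simp add: n_def strict_mono_def)
    have "K \<le> n 0" using le_enumerate[OF inf, of K] by (simp add: n_def)
    have "real K * e = (\<Sum>i<K. e)" by simp
    also have "\<dots> \<le> (\<Sum>i<K. c * f (x (n i)))"
      using enumerate_in_set[OF inf] by (intro sum_mono) (auto simp: n_def intro: less_imp_le)
    also have "\<dots> = c * f (\<Sum>i<K. x (n i))"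
      by (simp add: sum_distrib_left linear_sum[OF bounded_linear.linear[OF f]])
    also have "\<dots> \<le> \<bar>c * f (\<Sum>i<K. x (n i))\<bar>" by simp
    also have "\<dots> \<le> norm (\<Sum>i<K. x (n i)) * C" using C(2)[of "\<Sum>i<K. x (n i)"] c by (simp add: abs_mult)
    also have "\<dots> \<le> real K / real (Suc j) * C" using K(2)[OF n \<open>K \<le> n 0\<close>] C(1) by (intro mult_right_mono) auto
    also have "\<dots> = real K * (C / real (Suc j))" by simp
    also have "\<dots> \<le> real K * (e / 2)" by (intro mult_left_mono j) simp
    finally show False using K(1) e by simp
  qed
  show "(\<lambda>n. f (x n)) \<longlonglongrightarrow> 0"
  proof (rule LIMSEQ_I)
    fix e :: real assume "0 < e"
    then have "finite ({n. e / 2 < 1 * f (x n)} \<union> {n. e / 2 < (-1) * f (x n)})"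
      by (intro finite_UnI one_sided) auto
    then obtain N where N: "\<forall>n\<in>{n. e / 2 < 1 * f (x n)} \<union> {n. e / 2 < (-1) * f (x n)}. n < N"
      unfolding finite_nat_set_iff_bounded ..
    have "norm (f (x n) - 0) < e" if "n \<ge> N" for n
    proof -
      have "\<not> e / 2 < f (x n)" "\<not> e / 2 < - f (x n)" using N that by (auto simp: not_less[symmetric])
      then show ?thesis using \<open>0 < e\<close> by (simp add: abs_less_iff)
    qed
    then show "\<exists>N. \<forall>n\<ge>N. norm (f (x n) - 0) < e" by blast
  qed
qed

section \<open>Spreading models in the space of bounded sequences\<close>

lemma seq_compact_bounded_functions:
  fixes g :: "nat \<Rightarrow> nat \<Rightarrow> real"
  assumes "\<And>r i. \<bar>g r i\<bar> \<le> M"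
  shows "\<exists>\<psi> s. strict_mono s \<and> (\<forall>i. (\<lambda>r. g (s r) i) \<longlonglongrightarrow> \<psi> i)"
proof -
  have "seq_compact {f :: nat \<Rightarrow> real. \<forall>i. \<bar>f i\<bar> \<le> M}"
    by (rule compact_imp_seq_compact) (rule compact_bounded_functions)
  moreover have "\<forall>r. g r \<in> {f. \<forall>i. \<bar>f i\<bar> \<le> M}" using assms by simp
  ultimately obtain \<psi> s where "strict_mono (s :: nat \<Rightarrow> nat)" and lim: "(g \<circ> s) \<longlonglongrightarrow> \<psi>"
    unfolding seq_compact_def by blast
  moreover have "(\<lambda>r. g (s r) i) \<longlonglongrightarrow> \<psi> i" for i
    using isCont_tendsto_compose[OF continuous_on_interior[OF continuous_on_product_coordinates[of i]] lim]
    by (simp add: comp_def)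
  ultimately show ?thesis by blast
qed

text \<open>For every rational list \<open>L\<close> one coordinate of the model is a limit, as \<open>r\<close> tends to infinity, of functionals
  norming \<open>\<Sum>i. L ! i *\<^sub>R x (r + i)\<close>.\<close>

theorem spreads_realized:
  fixes x :: "nat \<Rightarrow> 'a::real_normed_vector"
  assumes x: "spreads x \<phi>" and M: "\<And>n. norm (x n) \<le> M"
  shows "\<exists>y :: nat \<Rightarrow> linfty. spreading_model x y"
proof -
  define c where "c L i = (if i < length L then of_rat (L ! i) else 0 :: real)" for L i
  have "\<exists>\<psi>. (\<forall>k a. \<bar>\<Sum>i<k. a i * \<psi> i\<bar> \<le> spread_norm x k a) \<and> (\<forall>i. \<bar>\<psi> i\<bar> \<le> M) \<and>
           (\<Sum>i<length L. c L i * \<psi> i) = spread_norm x (length L) (c L)" for L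
  proof -
    have "\<exists>f. bounded_linear f \<and> (\<forall>v. \<bar>f v\<bar> \<le> norm v) \<and>
        f (\<Sum>i<length L. c L i *\<^sub>R x (r + i)) = norm (\<Sum>i<length L. c L i *\<^sub>R x (r + i))" for r
      by (rule norming_functional)
    then obtain f :: "nat \<Rightarrow> 'a \<Rightarrow> real" where f: "\<And>r. bounded_linear (f r)" "\<And>r v. \<bar>f r v\<bar> \<le> norm v"
      "\<And>r. f r (\<Sum>i<length L. c L i *\<^sub>R x (r + i)) = norm (\<Sum>i<length L. c L i *\<^sub>R x (r + i))" by metis
    have bd: "\<bar>f r (x n)\<bar> \<le> M" for r n using f(2) M order_trans by blast
    obtain \<psi> s where s: "strict_mono (s :: nat \<Rightarrow> nat)" and lim: "\<And>i. (\<lambda>r. f (s r) (x (s r + i))) \<longlonglongrightarrow> \<psi> i"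
      using seq_compact_bounded_functions[of "\<lambda>r i. f r (x (r + i))" M] bd by blast
    have norm_lim: "(\<lambda>r. norm (\<Sum>i<k. a i *\<^sub>R x (s r + i))) \<longlonglongrightarrow> spread_norm x k a" for k a
      using LIMSEQ_subseq_LIMSEQ[OF spread_norm_LIMSEQ[OF x] s] by (simp add: comp_def)
    have f_lim: "(\<lambda>r. f (s r) (\<Sum>i<k. a i *\<^sub>R x (s r + i))) \<longlonglongrightarrow> (\<Sum>i<k. a i * \<psi> i)" for k a
    proof -
      have "f (s r) (\<Sum>i<k. a i *\<^sub>R x (s r + i)) = (\<Sum>i<k. a i * f (s r) (x (s r + i)))" for r
        using bounded_linear.linear[OF f(1)] by (simp add: linear_sum linear_cmul)
      then show ?thesis by (simp add: tendsto_intros lim)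
    qed
    have "\<bar>\<Sum>i<k. a i * \<psi> i\<bar> \<le> spread_norm x k a" for k a
      by (rule LIMSEQ_le[OF tendsto_rabs[OF f_lim] norm_lim]) (use f(2) in blast)
    moreover have "\<bar>\<psi> i\<bar> \<le> M" for i
      by (rule LIMSEQ_le_const2[OF tendsto_rabs[OF lim]]) (use bd in blast)
    moreover have "(\<Sum>i<length L. c L i * \<psi> i) = spread_norm x (length L) (c L)"
      using LIMSEQ_unique[OF f_lim[where k = "length L" and a = "c L", unfolded f(3)]
          norm_lim[where k = "length L" and a = "c L"]] .
    ultimately show ?thesis by blast
  qed
  then obtain \<Psi> where \<Psi>: "\<And>L k a. \<bar>\<Sum>i<k. a i * \<Psi> L i\<bar> \<le> spread_norm x k a" "\<And>L i. \<bar>\<Psi> L i\<bar> \<le> M"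
    "\<And>L. (\<Sum>i<length L. c L i * \<Psi> L i) = spread_norm x (length L) (c L)" by metis
  define h :: "nat discrete \<Rightarrow> nat \<Rightarrow> real" where "h d = \<Psi> (from_nat (of_discrete d))" for d
  define y :: "nat \<Rightarrow> linfty" where "y i = Bcontfun (\<lambda>d. h d i)" for i
  have y: "apply_bcontfun (y i) d = h d i" for i d
  proof -
    have "(\<lambda>d. h d i) \<in> bcontfun"
      by (rule bcontfun_normI[of _ M])
        (auto simp: h_def \<Psi> continuous_on_topological intro!: exI[of _ "{_}"] open_discrete)
    then show ?thesis by (simp add: y_def Bcontfun_inverse)
  qed
  have sum: "apply_bcontfun (\<Sum>i<k. a i *\<^sub>R y i) d = (\<Sum>i<k. a i * h d i)" for k :: nat and a d
    by (induction k) (simp_all add: y)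
  have "norm (\<Sum>i<k. a i *\<^sub>R y i) = spread_norm x k a" for k a
  proof (rule antisym)
    let ?t = "\<Sum>i<k. a i *\<^sub>R y i"
    show "norm ?t \<le> spread_norm x k a" by (rule norm_bound) (simp add: sum h_def \<Psi>)
    show "spread_norm x k a \<le> norm ?t"
    proof (rule field_le_epsilon)
      fix e :: real assume e: "0 < e"
      have M0: "0 \<le> M" using M[of 0] norm_ge_zero order_trans by blast
      define \<delta> where "\<delta> = e / (2 * (M + 1) * real (Suc k))"
      have \<delta>: "0 < \<delta>" using e M0 by (simp add: \<delta>_def)
      have "\<exists>q :: rat. \<bar>of_rat q - a i\<bar> < \<delta>" for i
        using of_rat_dense[of "a i - \<delta>" "a i + \<delta>"] \<delta>
        by (auto simp: abs_less_iff algebra_simps)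
      then obtain q :: "nat \<Rightarrow> rat" where q: "\<And>i. \<bar>of_rat (q i) - a i\<bar> < \<delta>" by metis
      define L where "L = map q [0..<k]"
      have L: "length L = k" and cL: "\<And>i. i < k \<Longrightarrow> c L i = of_rat (q i)" by (simp_all add: L_def c_def)
      \<comment> \<open>The coordinate of the rational list L norms the combination with
        coefficients \<open>c L\<close>, which are close to a.\<close>
      define d where "d = discrete (to_nat L)"
      have hd: "h d = \<Psi> L" by (simp add: h_def d_def discrete_inverse)
      have diff: "M * (\<Sum>i<k. \<bar>c L i - a i\<bar>) \<le> e / 2"
      proof -
        have "(\<Sum>i<k. \<bar>c L i - a i\<bar>) \<le> (\<Sum>i<k. \<delta>)" using q by (intro sum_mono) (auto simp: cL intro: less_imp_le)
        then have "M * (\<Sum>i<k. \<bar>c L i - a i\<bar>) \<le> M * (real k * \<delta>)" using M0 by (intro mult_left_mono) auto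
        also have "\<dots> \<le> (M + 1) * (real (Suc k) * \<delta>)" using M0 \<delta> by (intro mult_mono) auto
        also have "\<dots> = e / 2" using M0 by (simp add: \<delta>_def divide_simps del: of_nat_Suc)
        finally show ?thesis .
      qed
      have "spread_norm x k a \<le> spread_norm x k (c L) + e / 2"
      proof (rule LIMSEQ_le)
        show "(\<lambda>r. norm (\<Sum>i<k. a i *\<^sub>R x (r + i))) \<longlonglongrightarrow> spread_norm x k a"
          "(\<lambda>r. norm (\<Sum>i<k. c L i *\<^sub>R x (r + i)) + e / 2) \<longlonglongrightarrow> spread_norm x k (c L) + e / 2"
          by (intro tendsto_intros spread_norm_LIMSEQ[OF x])+
        have "norm (\<Sum>i<k. a i *\<^sub>R x (r + i)) \<le> norm (\<Sum>i<k. c L i *\<^sub>R x (r + i)) + e / 2" for r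
        proof -
          have "norm (\<Sum>i<k. (c L i - a i) *\<^sub>R x (r + i)) \<le> M * (\<Sum>i<k. \<bar>c L i - a i\<bar>)"
            by (rule norm_sum_scaleR_le) (rule M)
          moreover have "(\<Sum>i<k. (c L i - a i) *\<^sub>R x (r + i))
              = (\<Sum>i<k. c L i *\<^sub>R x (r + i)) - (\<Sum>i<k. a i *\<^sub>R x (r + i))"
            by (simp add: scaleR_diff_left sum_subtractf)
          ultimately show ?thesis
            using diff norm_triangle_ineq2[of "\<Sum>i<k. a i *\<^sub>R x (r + i)" "\<Sum>i<k. c L i *\<^sub>R x (r + i)"]
            by (simp add: norm_minus_commute)
        qed
        then show "\<exists>N. \<forall>r\<ge>N. norm (\<Sum>i<k. a i *\<^sub>R x (r + i)) \<le> norm (\<Sum>i<k. c L i *\<^sub>R x (r + i)) + e / 2"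
          by blast
      qed
      also have "spread_norm x k (c L) = (\<Sum>i<k. c L i * h d i)" using \<Psi>(3)[of L] by (simp add: L hd)
      also have "\<dots> = (\<Sum>i<k. (c L i - a i) * h d i) + (\<Sum>i<k. a i * h d i)"
        by (simp add: sum.distrib[symmetric] left_diff_distrib)
      also have "(\<Sum>i<k. (c L i - a i) * h d i) \<le> e / 2"
      proof -
        have "(\<Sum>i<k. (c L i - a i) * h d i) \<le> \<bar>\<Sum>i<k. (c L i - a i) * h d i\<bar>" by simp
        also have "\<dots> \<le> M * (\<Sum>i<k. \<bar>c L i - a i\<bar>)"
          using norm_sum_scaleR_le[of k "h d" M "\<lambda>i. c L i - a i"] by (simp add: hd \<Psi>(2))
        finally show ?thesis using diff by simp
      qed
      also have "(\<Sum>i<k. a i * h d i) \<le> norm ?t"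
        using norm_bounded[of ?t d] by (simp add: sum abs_le_iff)
      finally show "spread_norm x k a \<le> norm ?t + e" by simp
    qed
  qed
  then show ?thesis using spreading_modelI[OF x M] by blast
qed

text \<open>For coefficients in [-1,1] and distinct indices from k on, the perturbation is at most
  the geometric tail \<theta> * 2 / 2^k, which the error sequence absorbs.\<close>

lemma spreading_model_perturb:
  fixes x x' :: "nat \<Rightarrow> 'a::real_normed_vector"
  assumes y: "spreading_model x y" and \<theta>: "\<And>n. norm (x' n - x n) \<le> \<theta> / 2 ^ n"
  shows "spreading_model x' y"
proof -
  obtain \<epsilon> where \<epsilon>: "decseq \<epsilon>" "\<epsilon> \<longlonglongrightarrow> 0" and
    *: "\<And>k n a. 1 \<le> k \<Longrightarrow> k \<le> n 0 \<Longrightarrow> strict_mono_on {..<k} n \<Longrightarrow> (\<forall>i<k. a i \<in> {-1..1}) \<Longrightarrow>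
        \<bar>norm (\<Sum>i<k. a i *\<^sub>R x (n i)) - norm (\<Sum>i<k. a i *\<^sub>R y i)\<bar> < \<epsilon> k"
    using y unfolding spreading_model_def by auto
  have \<theta>0: "0 \<le> \<theta>" using order_trans[OF norm_ge_zero \<theta>[of 0]] by simp
  show ?thesis
    unfolding spreading_model_def
  proof (intro exI[of _ "\<lambda>k. \<epsilon> k + 2 * \<theta> / 2 ^ k"] conjI allI impI; (elim conjE)?)
    show "decseq (\<lambda>k. \<epsilon> k + 2 * \<theta> / 2 ^ k)"
      unfolding decseq_def
      using \<epsilon>(1) \<theta>0 by (auto simp: decseq_def intro!: add_mono divide_left_mono power_increasing)
    have "(\<lambda>k. \<epsilon> k + 2 * \<theta> * (1 / 2) ^ k) \<longlonglongrightarrow> 0 + 2 * \<theta> * 0"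
      by (intro tendsto_intros \<epsilon>(2) LIMSEQ_realpow_zero) auto
    then show "(\<lambda>k. \<epsilon> k + 2 * \<theta> / 2 ^ k) \<longlonglongrightarrow> 0" by (simp add: power_one_over)
    fix k n and a :: "nat \<Rightarrow> real"
    assume k: "1 \<le> k" and n: "k \<le> n 0" "strict_mono_on {..<k} n" and a: "\<forall>i<k. a i \<in> {-1..1}"
    obtain n' where n': "strict_mono n'" "\<forall>i<k. n' i = n i" "k \<le> n' 0"
      using extend_strict_mono[OF n(2), of k] n(1) by blast
    have "norm (\<Sum>i<k. a i *\<^sub>R (x' (n i) - x (n i))) \<le> (\<Sum>i<k. \<theta> / 2 ^ k * (1 / 2) ^ i)"
    proof (rule sum_norm_le)
      fix i assume "i \<in> {..<k}"
      then have i: "i < k" by simp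
      have "k + i \<le> n i" using strict_mono_ge_add[OF n'(1,3), of i] n'(2) i by simp
      have "norm (a i *\<^sub>R (x' (n i) - x (n i))) \<le> 1 * (\<theta> / 2 ^ n i)"
        unfolding norm_scaleR using a i \<theta> by (intro mult_mono) auto
      also have "\<dots> \<le> \<theta> / 2 ^ (k + i)"
        using \<theta>0 \<open>k + i \<le> n i\<close> by (simp add: frac_le)
      also have "\<dots> = \<theta> / 2 ^ k * (1 / 2) ^ i" by (simp add: power_add power_one_over)
      finally show "norm (a i *\<^sub>R (x' (n i) - x (n i))) \<le> \<theta> / 2 ^ k * (1 / 2) ^ i" .
    qed
    also have "\<dots> = \<theta> / 2 ^ k * (\<Sum>i<k. (1 / 2) ^ i)" by (simp add: sum_distrib_left)
    also have "\<dots> \<le> \<theta> / 2 ^ k * 2"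
      using \<theta>0 by (intro mult_left_mono) (simp_all add: geometric_sum)
    finally have "norm (\<Sum>i<k. a i *\<^sub>R (x' (n i) - x (n i))) \<le> 2 * \<theta> / 2 ^ k" by (simp add: mult.commute)
    moreover have "(\<Sum>i<k. a i *\<^sub>R (x' (n i) - x (n i))) = (\<Sum>i<k. a i *\<^sub>R x' (n i)) - (\<Sum>i<k. a i *\<^sub>R x (n i))"
      by (simp add: scaleR_diff_right sum_subtractf)
    ultimately have "\<bar>norm (\<Sum>i<k. a i *\<^sub>R x' (n i)) - norm (\<Sum>i<k. a i *\<^sub>R x (n i))\<bar> \<le> 2 * \<theta> / 2 ^ k"
      using norm_triangle_ineq3 order_trans by metis
    then show "\<bar>norm (\<Sum>i<k. a i *\<^sub>R x' (n i)) - norm (\<Sum>i<k. a i *\<^sub>R y i)\<bar> < \<epsilon> k + 2 * \<theta> / 2 ^ k"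
      using *[OF k n a] by linarith
  qed
qed

section \<open>Antichains from increasing sequences\<close>

text \<open>The constant is a natural number, so that domination becomes a countable union of
  relations with fixed constant.\<close>

definition spread_dominated :: "(nat \<Rightarrow> 'a::real_normed_vector) \<Rightarrow> (nat \<Rightarrow> 'b::real_normed_vector) \<Rightarrow> bool"
  where "spread_dominated x x' \<longleftrightarrow> (\<exists>m::nat. \<forall>k a. spread_norm x k a \<le> real m * spread_norm x' k a)"

lemma dominated_iff_spread_dominated:
  assumes y: "spreading_model x y" and y': "spreading_model x' y'"
  shows "dominated y y' \<longleftrightarrow> spread_dominated x x'"
proof
  assume "dominated y y'"
  then obtain C where C: "C \<ge> 1" "\<And>k a. norm (\<Sum>n=0..k. a n *\<^sub>R y n) \<le> C * norm (\<Sum>n=0..k. a n *\<^sub>R y' n)"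
    unfolding dominated_def by blast
  obtain m :: nat where m: "C \<le> real m" using real_arch_simple by blast
  have "spread_norm x k a \<le> real m * spread_norm x' k a" for k a
    unfolding spreading_model_norm[OF y, symmetric] spreading_model_norm[OF y', symmetric]
  proof (cases k)
    case (Suc k')
    have "norm (\<Sum>i<k. a i *\<^sub>R y i) \<le> C * norm (\<Sum>i<k. a i *\<^sub>R y' i)"
      using C(2)[of a k'] by (simp add: Suc atLeast0AtMost lessThan_Suc_atMost)
    also have "\<dots> \<le> real m * norm (\<Sum>i<k. a i *\<^sub>R y' i)" using m by (intro mult_right_mono) auto
    finally show "norm (\<Sum>i<k. a i *\<^sub>R y i) \<le> real m * norm (\<Sum>i<k. a i *\<^sub>R y' i)" .
  qed simp
  then show "spread_dominated x x'" unfolding spread_dominated_def by blast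
next
  assume "spread_dominated x x'"
  then obtain m :: nat where m: "\<And>k a. spread_norm x k a \<le> real m * spread_norm x' k a"
    unfolding spread_dominated_def by blast
  have "norm (\<Sum>n=0..k. a n *\<^sub>R y n) \<le> (real m + 1) * norm (\<Sum>n=0..k. a n *\<^sub>R y' n)" for k a
  proof -
    have "norm (\<Sum>n=0..k. a n *\<^sub>R y n) \<le> real m * norm (\<Sum>n=0..k. a n *\<^sub>R y' n)"
      using m[of "Suc k" a] spreading_model_norm[OF y, of a "Suc k"] spreading_model_norm[OF y', of a "Suc k"]
      by (simp only: atLeast0AtMost lessThan_Suc_atMost)
    then show ?thesis by (simp add: distrib_right add_increasing2)
  qed
  then show "dominated y y'" unfolding dominated_def by (intro exI[of _ "real m + 1"]) auto
qed

lemma spread_dominated_refl: "spread_dominated x x"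
  unfolding spread_dominated_def by (intro exI[of _ 1]) simp

lemma spread_dominated_trans:
  assumes "spread_dominated x x'" "spread_dominated x' x''"
  shows "spread_dominated x x''"
proof -
  obtain m m' :: nat where m: "\<And>k a. spread_norm x k a \<le> real m * spread_norm x' k a"
    and m': "\<And>k a. spread_norm x' k a \<le> real m' * spread_norm x'' k a"
    using assms unfolding spread_dominated_def by blast
  have "spread_norm x k a \<le> real (m * m') * spread_norm x'' k a" for k a
    using order_trans[OF m[of k a] mult_left_mono[OF m'[of k a], of "real m"]] by (simp add: mult.assoc)
  then show ?thesis unfolding spread_dominated_def by blast
qed

lemma weakly_null_subseq:
  assumes "weakly_null x" "strict_mono h"
  shows "weakly_null (x \<circ> h)"
  unfolding weakly_null_def
proof (intro allI impI)
  fix f :: "'a \<Rightarrow> real" assume "bounded_linear f"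
  then have "(\<lambda>n. f (x n)) \<longlonglongrightarrow> 0" using assms(1) unfolding weakly_null_def by blast
  from LIMSEQ_subseq_LIMSEQ[OF this assms(2)] show "(\<lambda>n. f ((x \<circ> h) n)) \<longlonglongrightarrow> 0" by (simp add: comp_def)
qed

text \<open>The norms converge; if their limit were 0, all spreading norms would vanish. So the
  norms are bounded away from 0 eventually, and dropping the earlier vectors changes no spreading
  norm.\<close>

lemma nondegenerate_tail:
  fixes z :: "nat \<Rightarrow> 'a::real_normed_vector"
  assumes z: "weakly_null z" "spreads z \<psi>" "\<And>n. norm (z n) \<le> M" and pos: "0 < spread_norm z k a"
  shows "\<exists>z' :: nat \<Rightarrow> 'a. weakly_null z' \<and> seminormalized z' \<and> spreads z' \<psi> \<and>
    (\<forall>k a. spread_norm z' k a = spread_norm z k a)"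
proof -
  define \<beta> where "\<beta> = spread_norm z 1 (\<lambda>_. 1)"
  have \<beta>: "(\<lambda>r. norm (z r)) \<longlonglongrightarrow> \<beta>"
    using spread_norm_LIMSEQ[OF z(2), of "\<lambda>_. 1" 1] by (simp add: \<beta>_def)
  have "\<beta> \<noteq> 0"
  proof
    assume "\<beta> = 0"
    then have "z \<longlonglongrightarrow> 0" using \<beta> by (simp add: tendsto_norm_zero_iff)
    then have "(\<lambda>r. z (r + i)) \<longlonglongrightarrow> 0" for i by (rule LIMSEQ_ignore_initial_segment)
    then have "(\<lambda>r. norm (\<Sum>i<k. a i *\<^sub>R z (r + i))) \<longlonglongrightarrow> norm (\<Sum>i<k. a i *\<^sub>R (0 :: 'a))"
      by (intro tendsto_norm tendsto_sum tendsto_scaleR tendsto_const)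
    from LIMSEQ_unique[OF spread_norm_LIMSEQ[OF z(2)] this] pos show False by simp
  qed
  moreover have "0 \<le> \<beta>" unfolding \<beta>_def by (rule spread_norm_nonneg[OF z(2)])
  ultimately have "0 < \<beta> / 2" "\<beta> / 2 < \<beta>" by auto
  then obtain N where N: "\<And>r. r \<ge> N \<Longrightarrow> \<beta> / 2 < norm (z r)"
    using order_tendstoD(1)[OF \<beta> \<open>\<beta> / 2 < \<beta>\<close>] unfolding eventually_sequentially by blast
  define z' where "z' = z \<circ> (\<lambda>n. n + N)"
  have mono: "strict_mono (\<lambda>n. n + N)" by (simp add: strict_mono_def)
  have "\<beta> / 2 \<le> (INF n. norm (z' n))"
    by (rule cINF_greatest) (use N in \<open>auto simp: z'_def intro: less_imp_le\<close>)
  then have "seminormalized z'"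
    unfolding seminormalized_def using \<open>0 < \<beta> / 2\<close> z(3) by (auto simp: z'_def bdd_above_def)
  moreover have "weakly_null z'" unfolding z'_def by (rule weakly_null_subseq[OF z(1) mono])
  ultimately show ?thesis
    using spreads_subseq[OF z(2) mono] spread_norm_subseq[OF z(2) mono] unfolding z'_def by blast
qed

text \<open>The series of the \<open>w j *\<^sub>R x j\<close> has a geometric majorant, so weak
  nullness and the limits of norms pass through it term by term. The estimate is the triangle
  inequality with the i-th summand singled out, taken along a subsequence generating a spreading
  model.\<close>

lemma weighted_combination:
  fixes x :: "nat \<Rightarrow> nat \<Rightarrow> 'a::banach"
  assumes x: "\<And>i. weakly_null (x i)" "\<And>i. spreads (x i) (\<phi> i)" "\<And>i n. norm (x i n) \<le> M i"
    and w: "\<And>j. 0 \<le> w j" "\<And>j. w j * M j \<le> (1 / 2) ^ j"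
  shows "\<exists>(z :: nat \<Rightarrow> 'a) \<psi>. weakly_null z \<and> spreads z \<psi> \<and> (\<forall>n. norm (z n) \<le> 2) \<and>
    (\<forall>i k a. \<bar>spread_norm z k a - w i * spread_norm (x i) k a\<bar>
      \<le> (\<Sum>j. if j = i then 0 else w j * spread_norm (x j) k a))"
proof -
  have geo: "summable (\<lambda>j. (1 / 2 :: real) ^ j)" by (simp add: summable_geometric)
  have wx: "norm (w j *\<^sub>R x j n) \<le> (1 / 2) ^ j" for j n
    using mult_left_mono[OF x(3)[of j n] w(1)[of j]] w by (simp add: order_trans)
  have sm: "summable (\<lambda>j. w j *\<^sub>R x j n)" for n
    by (rule summable_comparison_test'[OF geo]) (rule wx)
  define z where "z n = (\<Sum>j. w j *\<^sub>R x j n)" for n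
  have z_sums: "(\<lambda>j. w j *\<^sub>R x j n) sums z n" for n unfolding z_def by (rule summable_sums[OF sm])
  have z_bound: "norm (z n) \<le> 2" for n
  proof -
    have sn: "summable (\<lambda>j. norm (w j *\<^sub>R x j n))"
      by (rule summable_comparison_test'[OF geo]) (use wx in simp)
    have "norm (z n) \<le> (\<Sum>j. norm (w j *\<^sub>R x j n))" unfolding z_def by (rule summable_norm[OF sn])
    also have "\<dots> \<le> (\<Sum>j. (1 / 2) ^ j)" by (rule suminf_le[OF wx sn geo])
    finally show ?thesis by (simp add: suminf_geometric)
  qed
  have z_null: "weakly_null z"
    unfolding weakly_null_def
  proof (intro allI impI)
    fix f :: "'a \<Rightarrow> real" assume f: "bounded_linear f"
    then obtain C where C: "0 < C" "\<And>v. norm (f v) \<le> norm v * C" using bounded_linear.pos_bounded by blast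
    have fz: "f (z n) = (\<Sum>j. f (w j *\<^sub>R x j n))" for n
      unfolding z_def by (rule bounded_linear.suminf[OF f sm])
    have "(\<lambda>n. \<Sum>j. f (w j *\<^sub>R x j n)) \<longlonglongrightarrow> (\<Sum>j. 0)"
    proof (rule tannerys_theorem[THEN conjunct2, THEN conjunct2])
      show "(\<lambda>n. f (w j *\<^sub>R x j n)) \<longlonglongrightarrow> 0" for j
        using x(1)[of j] f tendsto_mult_right_zero[of "\<lambda>n. f (x j n)" sequentially "w j"]
        unfolding weakly_null_def by (simp add: linear_cmul[OF bounded_linear.linear[OF f]])
      have "norm (f (w j *\<^sub>R x j n)) \<le> (1 / 2) ^ j * C" for j n
        using order_trans[OF C(2) mult_right_mono[OF wx[of j n], of C]] C(1) by simp
      then show "\<forall>\<^sub>F (j, n) in sequentially \<times>\<^sub>F sequentially. norm (f (w j *\<^sub>R x j n)) \<le> (1 / 2) ^ j * C"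
        by (intro always_eventually) auto
      show "summable (\<lambda>j. (1 / 2) ^ j * C)" by (rule summable_mult2[OF geo])
    qed simp
    then show "(\<lambda>n. f (z n)) \<longlonglongrightarrow> 0" by (simp add: fz)
  qed
  obtain h \<psi> where h: "strict_mono h" and \<psi>: "spreads (z \<circ> h) \<psi>"
    using Brunel_Sucheston[of z 2] z_bound by blast
  have "\<bar>spread_norm (z \<circ> h) k a - w i * spread_norm (x i) k a\<bar>
      \<le> (\<Sum>j. if j = i then 0 else w j * spread_norm (x j) k a)" for i k a
  proof -
    define u where "u j r = (\<Sum>l<k. a l *\<^sub>R x j (h (r + l)))" for j r
    define g where "g j r = (if j = i then 0 else w j * norm (u j r))" for j r
    define S where "S = (\<Sum>l<k. \<bar>a l\<bar>)"
    have S: "0 \<le> S" unfolding S_def by (simp add: sum_nonneg)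
    have u_lim: "(\<lambda>r. norm (u j r)) \<longlonglongrightarrow> spread_norm (x j) k a" for j
      using spread_norm_LIMSEQ[OF spreads_subseq[OF x(2)[of j] h], of a k] spread_norm_subseq[OF x(2)[of j] h]
      by (simp add: u_def)
    have wu: "w j * norm (u j r) \<le> (1 / 2) ^ j * S" for j r
    proof -
      have "norm (u j r) \<le> M j * S" unfolding u_def S_def by (rule norm_sum_scaleR_le) (rule x(3))
      then have "w j * norm (u j r) \<le> w j * (M j * S)" by (rule mult_left_mono) (rule w(1))
      also have "\<dots> \<le> (1 / 2) ^ j * S" using mult_right_mono[OF w(2) S, of j] by (simp add: mult.assoc)
      finally show ?thesis .
    qed
    have g_bound: "norm (g j r) \<le> (1 / 2) ^ j * S" for j r
      using wu[of j r] w(1)[of j] S by (simp add: g_def abs_mult)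
    have geoS: "summable (\<lambda>j. (1 / 2) ^ j * S)" by (rule summable_mult2[OF geo])
    have "(\<lambda>r. \<Sum>j. g j r) \<longlonglongrightarrow> (\<Sum>j. if j = i then 0 else w j * spread_norm (x j) k a)"
    proof (rule tannerys_theorem[THEN conjunct2, THEN conjunct2])
      show "(\<lambda>r. g j r) \<longlonglongrightarrow> (if j = i then 0 else w j * spread_norm (x j) k a)" for j
        unfolding g_def by (cases "j = i") (auto intro!: tendsto_intros u_lim)
      show "\<forall>\<^sub>F (j, r) in sequentially \<times>\<^sub>F sequentially. norm (g j r) \<le> (1 / 2) ^ j * S"
        using g_bound by (intro always_eventually) auto
    qed (use geoS in auto)
    moreover have "(\<lambda>r. \<bar>norm (\<Sum>l<k. a l *\<^sub>R (z \<circ> h) (r + l)) - w i * norm (u i r)\<bar>)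
        \<longlonglongrightarrow> \<bar>spread_norm (z \<circ> h) k a - w i * spread_norm (x i) k a\<bar>"
      by (intro tendsto_intros spread_norm_LIMSEQ[OF \<psi>] u_lim)
    moreover have "\<bar>norm (\<Sum>l<k. a l *\<^sub>R (z \<circ> h) (r + l)) - w i * norm (u i r)\<bar> \<le> (\<Sum>j. g j r)" for r
    proof -
      let ?Z = "\<Sum>l<k. a l *\<^sub>R (z \<circ> h) (r + l)"
      have "(\<lambda>j. \<Sum>l<k. a l *\<^sub>R (w j *\<^sub>R x j (h (r + l)))) sums ?Z"
        unfolding comp_def by (intro sums_sum sums_scaleR_right z_sums)
      moreover have "(\<Sum>l<k. a l *\<^sub>R (w j *\<^sub>R x j (h (r + l)))) = w j *\<^sub>R u j r" for j
        by (simp add: u_def scaleR_sum_right mult.commute)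
      ultimately have "(\<lambda>j. w j *\<^sub>R u j r - (if j = i then w j *\<^sub>R u j r else 0)) sums (?Z - w i *\<^sub>R u i r)"
        using sums_diff[OF _ sums_single[of i "\<lambda>j. w j *\<^sub>R u j r"]] by simp
      then have eq: "?Z - w i *\<^sub>R u i r = (\<Sum>j. w j *\<^sub>R u j r - (if j = i then w j *\<^sub>R u j r else 0))"
        by (rule sums_unique)
      have ng: "norm (w j *\<^sub>R u j r - (if j = i then w j *\<^sub>R u j r else 0)) = g j r" for j
        using w(1)[of j] by (simp add: g_def)
      have "summable (\<lambda>j. g j r)"
        by (rule summable_comparison_test'[OF geoS]) (rule g_bound)
      then have "norm (?Z - w i *\<^sub>R u i r) \<le> (\<Sum>j. g j r)"
        using summable_norm[of "\<lambda>j. w j *\<^sub>R u j r - (if j = i then w j *\<^sub>R u j r else 0)"]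
        unfolding ng eq by simp
      moreover have "w i * norm (u i r) = norm (w i *\<^sub>R u i r)" using w(1)[of i] by simp
      ultimately show ?thesis using norm_triangle_ineq3[of ?Z "w i *\<^sub>R u i r"] by linarith
    qed
    ultimately show ?thesis by (meson LIMSEQ_le)
  qed
  moreover have "weakly_null (z \<circ> h)" by (rule weakly_null_subseq[OF z_null h])
  ultimately show ?thesis using \<psi> z_bound by (intro exI[of _ "z \<circ> h"] exI[of _ \<psi>]) auto
qed

lemma ex_small_multiplier:
  fixes u v :: "'i \<Rightarrow> real"
  assumes "finite J" "\<And>j. j \<in> J \<Longrightarrow> 0 < v j" "\<And>j. j \<in> J \<Longrightarrow> 0 \<le> u j"
  shows "\<exists>c>0. \<forall>j\<in>J. c * u j \<le> v j"
  using assms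
proof (induction J)
  case empty
  show ?case by (intro exI[of _ 1]) simp
next
  case (insert i J)
  then obtain c where c: "0 < c" "\<And>j. j \<in> J \<Longrightarrow> c * u j \<le> v j" by auto
  define c' where "c' = min c (v i / (u i + 1))"
  have "0 < v i" "0 \<le> u i" using insert.prems by auto
  then have c': "0 < c'" using c(1) by (simp add: c'_def)
  have "c' * u j \<le> v j" if "j \<in> insert i J" for j
  proof (cases "j = i")
    case True
    have "c' * u i \<le> v i / (u i + 1) * (u i + 1)" using c' \<open>0 \<le> u i\<close> \<open>0 < v i\<close> by (intro mult_mono) (auto simp: c'_def)
    then show ?thesis using True \<open>0 \<le> u i\<close> by simp
  next
    case False
    then have "j \<in> J" using that by simp
    have "c' * u j \<le> c * u j" using insert.prems(2)[OF that] by (intro mult_right_mono) (auto simp: c'_def)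
    then show ?thesis using c(2)[OF \<open>j \<in> J\<close>] by simp
  qed
  then show ?case using c' by blast
qed

text \<open>Each weight \<open>c i\<close> is chosen after the witnesses \<open>a j\<close> for \<open>j < i\<close>, and so small that the later terms do not
  matter on them; the witness \<open>a i\<close> is chosen after \<open>c i\<close>.\<close>

lemma weights_and_witnesses:
  fixes N :: "nat \<Rightarrow> nat \<Rightarrow> (nat \<Rightarrow> real) \<Rightarrow> real"
  assumes N: "\<And>i k a. 0 \<le> N i k a" and M: "\<And>i. 0 \<le> M i"
    and witness: "\<And>i D. 0 \<le> D \<Longrightarrow> \<exists>k a. 0 < N i k a \<and> D * (\<Sum>j<i. N j k a) \<le> N i k a"
  shows "\<exists>c k a. (\<forall>i. 0 < c i \<and> c i \<le> 1 \<and> c i * M i \<le> (1 / 2) ^ i \<and> 0 < N i (k i) (a i) \<and>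
     4 * real (Suc i) * (\<Sum>j<i. N j (k i) (a i)) \<le> c i * N i (k i) (a i) \<and>
     (\<forall>j<i. 4 * real (Suc j) * (c i * N i (k j) (a j)) \<le> (1 / 2) ^ i * (c j * N j (k j) (a j))))"
proof -
  define P where "P f i t \<longleftrightarrow> (case t of (c, k, a) \<Rightarrow> 0 < c \<and> c \<le> 1 \<and> c * M i \<le> (1 / 2) ^ i \<and> 0 < N i k a \<and>
     4 * real (Suc i) * (\<Sum>j<i. N j k a) \<le> c * N i k a \<and>
     (\<forall>j<i. case f j of (c', k', a') \<Rightarrow>
        4 * real (Suc j) * (c * N i k' a') \<le> (1 / 2) ^ i * (c' * N j k' a')))"
    for f :: "nat \<Rightarrow> real \<times> nat \<times> (nat \<Rightarrow> real)" and i t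
  have "\<exists>f. \<forall>i. P f i (f i)"
  proof (rule dependent_wf_choice[of less_than])
    show "P f i t = P g i t" if "\<And>j. (j, i) \<in> less_than \<Longrightarrow> f j = g j" for f g i t
      using that by (auto simp: P_def)
    fix i f assume IH: "\<And>j. (j, i) \<in> less_than \<Longrightarrow> P f j (f j)"
    define cc kk aa where "cc j = fst (f j)" and "kk j = fst (snd (f j))" and "aa j = snd (snd (f j))" for j
    have f: "f j = (cc j, kk j, aa j)" for j by (simp add: cc_def kk_def aa_def)
    have pos: "0 < cc j * N j (kk j) (aa j)" if "j < i" for j
      using IH[of j] that unfolding P_def f by (simp add: zero_less_mult_iff)
    have "\<exists>c>0. \<forall>j\<in>{..<i}. c * (4 * real (Suc j) * N i (kk j) (aa j)) \<le> (1 / 2) ^ i * (cc j * N j (kk j) (aa j))"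
      by (rule ex_small_multiplier) (use pos N in auto)
    then obtain c0 where c0: "0 < c0"
      "\<And>j. j < i \<Longrightarrow> c0 * (4 * real (Suc j) * N i (kk j) (aa j)) \<le> (1 / 2) ^ i * (cc j * N j (kk j) (aa j))" by auto
    \<comment> \<open>Three demands: negligible on the earlier witnesses, at most 1, and summable
      against the bounds M; \<open>M i + 1\<close> avoids division by zero.\<close>
    define c where "c = min c0 (min 1 ((1 / 2) ^ i / (M i + 1)))"
    have c: "0 < c" "c \<le> 1" "c \<le> c0" using c0(1) M[of i] by (auto simp: c_def)
    have "c * M i \<le> (1 / 2) ^ i / (M i + 1) * (M i + 1)" using c M[of i] by (intro mult_mono) (auto simp: c_def)
    then have cM: "c * M i \<le> (1 / 2) ^ i" using M[of i] by simp
    \<comment> \<open>The factor 1/c in D compensates for the weight c just chosen.\<close>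
    obtain k a where ka: "0 < N i k a" "4 * real (Suc i) / c * (\<Sum>j<i. N j k a) \<le> N i k a"
      using witness[of "4 * real (Suc i) / c" i] c(1) by auto
    have "4 * real (Suc i) * (\<Sum>j<i. N j k a) \<le> c * N i k a"
      using mult_left_mono[OF ka(2), of c] c(1) by simp
    moreover have "4 * real (Suc j) * (c * N i (kk j) (aa j)) \<le> (1 / 2) ^ i * (cc j * N j (kk j) (aa j))" if "j < i" for j
    proof -
      have "c * (4 * real (Suc j) * N i (kk j) (aa j)) \<le> c0 * (4 * real (Suc j) * N i (kk j) (aa j))"
        using c(3) N by (intro mult_right_mono) auto
      then show ?thesis using c0(2)[OF that] by (simp add: ac_simps)
    qed
    ultimately have "P f i (c, k, a)" using c cM ka(1) unfolding P_def f by simp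
    then show "\<exists>t. P f i t" ..
  qed (rule wf_less_than)
  then obtain f where f: "\<And>i. P f i (f i)" by blast
  define c k a where "c j = fst (f j)" and "k j = fst (snd (f j))" and "a j = snd (snd (f j))" for j
  have fj: "f j = (c j, k j, a j)" for j by (simp add: c_def k_def a_def)
  show ?thesis
    by (rule exI[of _ c], rule exI[of _ k], rule exI[of _ a]) (use f in \<open>simp add: P_def fj\<close>)
qed

text \<open>On the witness \<open>a i\<close> the spreading norm of \<open>\<Sum>j\<in>A. c j *\<^sub>R x j\<close> is at least a quarter of
  \<open>v = c i * N i (a i)\<close> if \<open>i \<in> A\<close>, and at most \<open>v / (i + 1)\<close> otherwise.\<close>

lemma antichain_of_increasing:
  fixes x :: "nat \<Rightarrow> nat \<Rightarrow> 'a::banach"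
  assumes x: "\<And>i. weakly_null (x i)" "\<And>i. spreads (x i) (\<phi> i)" "\<And>i n. norm (x i n) \<le> M i"
    and inc: "\<And>i. spread_dominated (x i) (x (Suc i))" "\<And>i. \<not> spread_dominated (x (Suc i)) (x i)"
  shows "\<exists>f :: nat set \<Rightarrow> nat \<Rightarrow> 'a. (\<forall>A. weakly_null (f A) \<and> seminormalized (f A) \<and> (\<exists>\<phi>. spreads (f A) \<phi>)) \<and>
     (\<forall>A B. A \<noteq> B \<longrightarrow> \<not> spread_dominated (f A) (f B))"
proof -
  \<comment> \<open>The shift leaves \<open>x i\<close> below \<open>X i\<close> and above every
    \<open>X j\<close> with \<open>j < i\<close>. A vector on which \<open>X i\<close> beats a large
    multiple of \<open>x i\<close> therefore beats all those \<open>X j\<close> together.\<close>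
  define X where "X i = x (Suc i)" for i
  define N where "N i k a = spread_norm (X i) k a" for i k a
  have X: "weakly_null (X i)" "spreads (X i) (\<phi> (Suc i))" "norm (X i n) \<le> M (Suc i)" for i n
    using x by (auto simp: X_def)
  have N0: "0 \<le> N i k a" for i k a unfolding N_def by (rule spread_norm_nonneg[OF X(2)])
  have M0: "0 \<le> M i" for i using x(3)[of i 0] norm_ge_zero order_trans by blast
  have dom: "spread_dominated (x j) (x i)" if "j \<le> i" for i j
    using that by (induction i rule: dec_induct) (auto intro: spread_dominated_refl spread_dominated_trans inc)
  have "\<exists>k a. 0 < N i k a \<and> D * (\<Sum>j<i. N j k a) \<le> N i k a" if D: "0 \<le> D" for i D
  proof -
    have "\<exists>m::nat. \<forall>k a. N j k a \<le> real m * spread_norm (x i) k a" if "j < i" for j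
      using dom[of "Suc j" i] that by (auto simp: spread_dominated_def N_def X_def)
    then obtain m :: "nat \<Rightarrow> nat" where m: "\<And>j k a. j < i \<Longrightarrow> N j k a \<le> real (m j) * spread_norm (x i) k a" by metis
    obtain m' :: nat where m': "D * (\<Sum>j<i. real (m j)) \<le> real m'" using real_arch_simple by blast
    obtain k a where ka: "real m' * spread_norm (x i) k a < N i k a"
      using inc(2)[of i] unfolding spread_dominated_def N_def X_def by (force simp: not_le)
    have n0: "0 \<le> spread_norm (x i) k a" by (rule spread_norm_nonneg[OF x(2)])
    have "D * (\<Sum>j<i. N j k a) \<le> D * (\<Sum>j<i. real (m j) * spread_norm (x i) k a)"
      using D m by (intro mult_left_mono sum_mono) auto
    also have "\<dots> = D * (\<Sum>j<i. real (m j)) * spread_norm (x i) k a" by (simp add: sum_distrib_right mult.assoc)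
    also have "\<dots> \<le> real m' * spread_norm (x i) k a" by (rule mult_right_mono[OF m' n0])
    finally have "D * (\<Sum>j<i. N j k a) \<le> N i k a" using ka by simp
    moreover have "0 < N i k a" using ka n0 by (meson mult_nonneg_nonneg of_nat_0_le_iff order.strict_trans1)
    ultimately show ?thesis by blast
  qed
  from weights_and_witnesses[of N "\<lambda>i. M (Suc i)", OF N0 M0 this]
  obtain c k a where "\<forall>i. 0 < c i \<and> c i \<le> 1 \<and> c i * M (Suc i) \<le> (1 / 2) ^ i \<and> 0 < N i (k i) (a i) \<and>
     4 * real (Suc i) * (\<Sum>j<i. N j (k i) (a i)) \<le> c i * N i (k i) (a i) \<and>
     (\<forall>j<i. 4 * real (Suc j) * (c i * N i (k j) (a j)) \<le> (1 / 2) ^ i * (c j * N j (k j) (a j)))" by blast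
  then have c: "\<And>i. 0 < c i" "\<And>i. c i \<le> 1" "\<And>i. c i * M (Suc i) \<le> (1 / 2) ^ i" "\<And>i. 0 < N i (k i) (a i)"
    "\<And>i. 4 * real (Suc i) * (\<Sum>j<i. N j (k i) (a i)) \<le> c i * N i (k i) (a i)"
    "\<And>i j. j < i \<Longrightarrow> 4 * real (Suc j) * (c i * N i (k j) (a j)) \<le> (1 / 2) ^ i * (c j * N j (k j) (a j))"
    by blast+
  define v where "v i = c i * N i (k i) (a i)" for i
  have v: "0 < v i" for i using c by (simp add: v_def)
  define w where "w A j = (if j \<in> A then c j else 0)" for A j
  have w: "0 \<le> w A j" "w A j \<le> c j" "w A j * M (Suc j) \<le> (1 / 2) ^ j" for A j
    using c(1)[of j] c(3)[of j] by (auto simp: w_def)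
  \<comment> \<open>Terms before i contribute at most v/(4(i+1)), those after i at most twice that,
    by the geometric factors. The total 3v/(4(i+1)) leaves v/4 of the main term if i is in A, and is
    below v/(i+1) otherwise.\<close>
  have rest: "(\<Sum>j. if j = i then 0 else w A j * N j (k i) (a i)) \<le> 3 / 4 * v i / real (Suc i)" for A i
  proof -
    define b where "b j = (if j \<in> {..<i} then N j (k i) (a i) else 0) + (1 / 2) ^ j * (v i / (4 * real (Suc i)))" for j
    have "b sums ((\<Sum>j<i. N j (k i) (a i)) + 1 / (1 - 1 / 2) * (v i / (4 * real (Suc i))))"
      unfolding b_def by (intro sums_add sums_If_finite_set sums_mult2 geometric_sums) auto
    then have b: "summable b" "(\<Sum>j. b j) = (\<Sum>j<i. N j (k i) (a i)) + 2 * (v i / (4 * real (Suc i)))"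
      by (simp_all add: sums_iff)
    have b0: "0 \<le> (1 / 2) ^ j * (v i / (4 * real (Suc i)))" for j using v[of i] by simp
    have le: "(if j = i then 0 else w A j * N j (k i) (a i)) \<le> b j" for j
    proof -
      consider "j = i" | "j < i" | "i < j" by linarith
      then show ?thesis
      proof cases
        case 1 then show ?thesis using b0[of j] by (simp add: b_def)
      next
        case 2
        have "w A j * N j (k i) (a i) \<le> 1 * N j (k i) (a i)"
          using w(2)[of A j] c(2)[of j] N0 by (intro mult_right_mono) auto
        then show ?thesis using 2 b0[of j] by (simp add: b_def)
      next
        case 3
        have "w A j * N j (k i) (a i) \<le> c j * N j (k i) (a i)" by (intro mult_right_mono w N0)
        also have "\<dots> \<le> (1 / 2) ^ j * v i / (4 * real (Suc i))"
          using c(6)[OF 3] by (simp add: v_def pos_le_divide_eq mult.commute)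
        finally show ?thesis using 3 by (simp add: b_def)
      qed
    qed
    have nonneg: "0 \<le> (if j = i then 0 else w A j * N j (k i) (a i))" for j using w(1)[of A j] N0 by simp
    have "summable (\<lambda>j. if j = i then 0 else w A j * N j (k i) (a i))"
      by (rule summable_comparison_test'[OF b(1)]) (use le nonneg in simp)
    then have "(\<Sum>j. if j = i then 0 else w A j * N j (k i) (a i)) \<le> (\<Sum>j. b j)"
      by (intro suminf_le le b(1))
    moreover have "(\<Sum>j<i. N j (k i) (a i)) \<le> v i / (4 * real (Suc i))"
      using c(5)[of i] by (simp add: v_def pos_le_divide_eq mult.commute)
    ultimately show ?thesis unfolding b(2) by (simp add: field_simps)
  qed
  have "\<exists>(z :: nat \<Rightarrow> 'a) \<psi>. weakly_null z \<and> spreads z \<psi> \<and> (\<forall>n. norm (z n) \<le> 2) \<and>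
      (\<forall>i. \<bar>spread_norm z (k i) (a i) - w A i * N i (k i) (a i)\<bar> \<le> 3 / 4 * v i / real (Suc i))" for A
  proof -
    obtain z :: "nat \<Rightarrow> 'a" and \<psi> where z: "weakly_null z" "spreads z \<psi>" "\<forall>n. norm (z n) \<le> 2"
      and est: "\<And>i k a. \<bar>spread_norm z k a - w A i * N i k a\<bar> \<le> (\<Sum>j. if j = i then 0 else w A j * N j k a)"
      using weighted_combination[where w = "w A", OF X w(1) w(3)] unfolding N_def by blast
    have "\<bar>spread_norm z (k i) (a i) - w A i * N i (k i) (a i)\<bar> \<le> 3 / 4 * v i / real (Suc i)" for i
      by (rule order_trans[OF est rest])
    then show ?thesis using z by blast
  qed
  then obtain z :: "nat set \<Rightarrow> nat \<Rightarrow> 'a" and \<psi>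
    where z: "\<And>A. weakly_null (z A)" "\<And>A. spreads (z A) (\<psi> A)" "\<And>A n. norm (z A n) \<le> 2"
    and est: "\<And>A i. \<bar>spread_norm (z A) (k i) (a i) - w A i * N i (k i) (a i)\<bar> \<le> 3 / 4 * v i / real (Suc i)"
    by metis
  have lower: "v i / 4 \<le> spread_norm (z A) (k i) (a i)" if "i \<in> A" for i A
  proof -
    have "3 / 4 * v i / real (Suc i) \<le> 3 / 4 * v i" using v[of i] by (simp add: divide_le_eq)
    then show ?thesis using est[of A i] that by (simp add: w_def v_def)
  qed
  have upper: "spread_norm (z A) (k i) (a i) \<le> v i / real (Suc i)" if "i \<notin> A" for i A
  proof -
    have "3 / 4 * v i / real (Suc i) \<le> v i / real (Suc i)" using v[of i] by (intro divide_right_mono) auto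
    then show ?thesis using est[of A i] that by (simp add: w_def)
  qed
  have not_dom: "\<not> spread_dominated (z A) (z B)" if inf: "infinite (A - B)" for A B
  proof
    assume "spread_dominated (z A) (z B)"
    then obtain m :: nat where m: "\<And>k a. spread_norm (z A) k a \<le> real m * spread_norm (z B) k a"
      unfolding spread_dominated_def by blast
    \<comment> \<open>On the witness \<open>a i\<close> the two norms differ by a factor of at least
      (i+1)/4, which exceeds m once i is at least 4m.\<close>
    obtain i where i: "i \<in> A - B" "4 * m \<le> i" using inf unfolding infinite_nat_iff_unbounded_le by blast
    have "v i / 4 \<le> spread_norm (z A) (k i) (a i)" using lower i(1) by simp
    also have "\<dots> \<le> real m * spread_norm (z B) (k i) (a i)" by (rule m)
    also have "\<dots> \<le> real m * (v i / real (Suc i))" using upper[of i B] i(1) by (intro mult_left_mono) auto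
    finally have "v i / 4 \<le> real m * (v i / real (Suc i))" .
    then have "v i * real (Suc i) \<le> v i * (4 * real m)" by (simp add: field_simps)
    then have "real (Suc i) \<le> 4 * real m" using v[of i] by simp
    then show False using i(2) by linarith
  qed
  \<comment> \<open>Every n owns two disjoint infinite columns, one for membership and one for
    non-membership. If A and B differ at n, then \<open>F A\<close> contains a column disjoint from
    \<open>F B\<close>. Also \<open>F A\<close> is never empty, even for empty A.\<close>
  define F where "F A = {prod_encode (2 * n + (if n \<in> A then 1 else 0), m) | n m. True}" for A :: "nat set"
  have F_inf: "infinite (F A - F B)" if AB: "A \<noteq> B" for A B
  proof -
    obtain n where n: "n \<in> A \<longleftrightarrow> n \<notin> B" using AB by blast
    have "prod_encode (2 * n + (if n \<in> A then 1 else 0), m) \<in> F A - F B" for m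
    proof -
      have "2 * n + (if n \<in> A then 1 else 0) \<noteq> 2 * n' + (if n' \<in> B then 1 else 0 :: nat)" for n'
      proof (cases "n = n'")
        case True
        then show ?thesis using n by auto
      next
        case False
        then show ?thesis by (cases "n \<in> A"; cases "n' \<in> B"; simp; presburger)
      qed
      then show ?thesis by (auto simp: F_def)
    qed
    then have "range (\<lambda>m. prod_encode (2 * n + (if n \<in> A then 1 else 0), m)) \<subseteq> F A - F B" by blast
    moreover have "inj (\<lambda>m. prod_encode (2 * n + (if n \<in> A then 1 else 0), m))" by (auto simp: inj_on_def)
    ultimately show ?thesis using range_inj_infinite finite_subset by blast
  qed
  have "\<exists>z' :: nat \<Rightarrow> 'a. weakly_null z' \<and> seminormalized z' \<and> spreads z' (\<psi> (F A)) \<and>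
      (\<forall>k a. spread_norm z' k a = spread_norm (z (F A)) k a)" for A
  proof -
    obtain i where "i \<in> F A" by (auto simp: F_def)
    then have "0 < spread_norm (z (F A)) (k i) (a i)" using lower[of i "F A"] v[of i] by simp
    then show ?thesis by (rule nondegenerate_tail[OF z(1,2,3)])
  qed
  then obtain f :: "nat set \<Rightarrow> nat \<Rightarrow> 'a" where f: "\<And>A. weakly_null (f A)" "\<And>A. seminormalized (f A)" "\<And>A. spreads (f A) (\<psi> (F A))"
    "\<And>A k a. spread_norm (f A) k a = spread_norm (z (F A)) k a" by metis
  have "\<not> spread_dominated (f A) (f B)" if "A \<noteq> B" for A B
    using not_dom[OF F_inf[OF that]] unfolding spread_dominated_def f(4) .
  moreover have "weakly_null (f A) \<and> seminormalized (f A) \<and> (\<exists>\<phi>. spreads (f A) \<phi>)" for A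
    using f(1-3)[of A] by blast
  ultimately show ?thesis by (intro exI[of _ f]) simp
qed

section \<open>Coding weakly null sequences\<close>

text \<open>A point of Baire space codes a sequence in the dense set \<open>range e\<close>, a modulus for its spreading model,
  the lengths of small averages, and (in the value at 0) a bound for the norms. The small averages make being
  weakly null, which is merely a coanalytic condition, into a closed one.\<close>

type_synonym code = "nat \<Rightarrow> nat \<times> nat \<times> nat \<times> nat"

definition code_seq :: "(nat \<Rightarrow> 'a) \<Rightarrow> code \<Rightarrow> nat \<Rightarrow> 'a"
  where "code_seq e p n = e (fst (p n))"

definition code_modulus :: "code \<Rightarrow> nat \<Rightarrow> nat"
  where "code_modulus p j = fst (snd (p j))"

definition code_average :: "code \<Rightarrow> nat \<Rightarrow> nat"
  where "code_average p j = fst (snd (snd (p j)))"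

definition code_bound :: "code \<Rightarrow> real"
  where "code_bound p = real (Suc (snd (snd (snd (p 0)))))"

definition codes :: "(nat \<Rightarrow> 'a::real_normed_vector) \<Rightarrow> code set"
  where "codes e = {p.
    (\<forall>n. norm (code_seq e p n) \<le> code_bound p \<and> 1 / code_bound p \<le> norm (code_seq e p n)) \<and>
    spreads (code_seq e p) (code_modulus p) \<and>
    (\<forall>j. 1 \<le> code_average p j) \<and>
    (\<forall>j n. strict_mono n \<and> code_average p j \<le> n 0 \<longrightarrow>
      norm (\<Sum>i<code_average p j. code_seq e p (n i)) \<le> real (code_average p j) / real (Suc j))}"

lemma code_bound_pos: "0 < code_bound p"
  by (simp add: code_bound_def)

lemma codesD:
  assumes "p \<in> codes e"
  shows "norm (code_seq e p n) \<le> code_bound p" "1 / code_bound p \<le> norm (code_seq e p n)"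
    "spreads (code_seq e p) (code_modulus p)" "1 \<le> code_average p j"
    "strict_mono n' \<Longrightarrow> code_average p j \<le> n' 0 \<Longrightarrow>
      norm (\<Sum>i<code_average p j. code_seq e p (n' i)) \<le> real (code_average p j) / real (Suc j)"
  using assms unfolding codes_def by blast+

lemma weakly_null_code_seq: "p \<in> codes e \<Longrightarrow> weakly_null (code_seq e p)"
  using codesD(4,5) by (intro weakly_null_averages) blast

lemma seminormalized_code_seq:
  assumes p: "p \<in> codes e"
  shows "seminormalized (code_seq e p)"
proof -
  have "1 / code_bound p \<le> (INF n. norm (code_seq e p n))"
    by (rule cINF_greatest) (use codesD(2)[OF p] in auto)
  then have "0 < (INF n. norm (code_seq e p n))"
    using code_bound_pos[of p] by (meson less_le_trans zero_less_divide_1_iff)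
  then show ?thesis
    unfolding seminormalized_def using codesD(1)[OF p] by (auto simp: bdd_above_def)
qed

lemma code_seq_cong: "\<forall>i<L. q i = p i \<Longrightarrow> n < L \<Longrightarrow> code_seq e q n = code_seq e p n"
  by (simp add: code_seq_def)

text \<open>Each instance of a defining condition reads only finitely many values of p, so it can be
  checked on a code q that agrees with p there.\<close>

lemma codes_closed:
  assumes "\<And>n. cyl (codes e) p n \<noteq> {}"
  shows "p \<in> codes e"
proof -
  have near: "\<exists>q\<in>codes e. \<forall>i<L. q i = p i" for L
    using assms[of L] by (auto simp: cyl_def)
  have "norm (code_seq e p n) \<le> code_bound p \<and> 1 / code_bound p \<le> norm (code_seq e p n)" for n
  proof -
    obtain q where q: "q \<in> codes e" "\<forall>i<Suc n. q i = p i" using near by blast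
    have "code_bound q = code_bound p" using q(2) by (simp add: code_bound_def)
    then show ?thesis using codesD(1,2)[OF q(1), of n] code_seq_cong[OF q(2), of n e] by simp
  qed
  moreover have "spreads (code_seq e p) (code_modulus p)"
    unfolding spreads_def
  proof (intro allI impI, elim conjE)
    fix j k and n n' :: "nat \<Rightarrow> nat" and a :: "nat \<Rightarrow> real"
    assume n: "strict_mono n" "strict_mono n'" "max k (code_modulus p j) \<le> n 0" "max k (code_modulus p j) \<le> n' 0"
      and a: "\<forall>i<k. \<bar>a i\<bar> \<le> 1"
    define L where "L = Suc (n k + n' k + j)"
    obtain q where q: "q \<in> codes e" "\<forall>i<L. q i = p i" using near by blast
    have "code_modulus q j = code_modulus p j" using q(2) by (simp add: code_modulus_def L_def)
    then have "\<bar>norm (\<Sum>i<k. a i *\<^sub>R code_seq e q (n i)) - norm (\<Sum>i<k. a i *\<^sub>R code_seq e q (n' i))\<bar> \<le> 1 / real (Suc j)"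
      using codesD(3)[OF q(1)] n a unfolding spreads_def by simp
    moreover have "code_seq e q (n i) = code_seq e p (n i)" "code_seq e q (n' i) = code_seq e p (n' i)" if "i < k" for i
      using strict_monoD[OF n(1) that] strict_monoD[OF n(2) that]
      by (auto intro!: code_seq_cong[OF q(2)] simp: L_def)
    ultimately show "\<bar>norm (\<Sum>i<k. a i *\<^sub>R code_seq e p (n i)) - norm (\<Sum>i<k. a i *\<^sub>R code_seq e p (n' i))\<bar> \<le> 1 / real (Suc j)"
      by simp
  qed
  moreover have "1 \<le> code_average p j" for j
  proof -
    obtain q where q: "q \<in> codes e" "\<forall>i<Suc j. q i = p i" using near by blast
    then show ?thesis using codesD(4)[OF q(1), of j] by (simp add: code_average_def)
  qed
  moreover have "norm (\<Sum>i<code_average p j. code_seq e p (n i)) \<le> real (code_average p j) / real (Suc j)"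
    if n: "strict_mono n" "code_average p j \<le> n 0" for j n
  proof -
    define L where "L = Suc (n (code_average p j) + j)"
    obtain q where q: "q \<in> codes e" "\<forall>i<L. q i = p i" using near by blast
    have "code_average q j = code_average p j" using q(2) by (simp add: code_average_def L_def)
    then have "norm (\<Sum>i<code_average p j. code_seq e q (n i)) \<le> real (code_average p j) / real (Suc j)"
      using codesD(5)[OF q(1) n(1), of j] n(2) by simp
    moreover have "code_seq e q (n i) = code_seq e p (n i)" if "i < code_average p j" for i
      using strict_monoD[OF n(1) that] by (auto intro!: code_seq_cong[OF q(2)] simp: L_def)
    ultimately show ?thesis by simp
  qed
  ultimately show ?thesis unfolding codes_def by simp
qed

text \<open>Codes agreeing far enough share the modulus at j and the k vectors from position r on.
  One and the same finite norm then approximates both spreading norms.\<close>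

lemma spread_norm_code_continuous:
  assumes p: "p \<in> codes e" and \<delta>: "0 < \<delta>"
  shows "\<exists>L. \<forall>q\<in>cyl (codes e) p L. \<bar>spread_norm (code_seq e q) k a - spread_norm (code_seq e p) k a\<bar> \<le> \<delta>"
proof -
  obtain A where A: "0 < A" "\<And>i. i < k \<Longrightarrow> \<bar>a i\<bar> \<le> A" using coeff_bound by blast
  obtain j where j: "A / real (Suc j) \<le> \<delta> / 2" using ex_inverse_Suc_le half_gt_zero[OF \<delta>] by blast
  define r where "r = max k (code_modulus p j)"
  have approx: "\<bar>norm (\<Sum>i<k. a i *\<^sub>R code_seq e q (r + i)) - spread_norm (code_seq e q) k a\<bar> \<le> A / real (Suc j)"
    if "q \<in> codes e" "code_modulus q j = code_modulus p j" for q
    by (rule spread_norm_approx[OF codesD(3)[OF that(1)]]) (use that A in \<open>auto simp: r_def strict_mono_def\<close>)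
  have "\<bar>spread_norm (code_seq e q) k a - spread_norm (code_seq e p) k a\<bar> \<le> \<delta>"
    if "q \<in> cyl (codes e) p (Suc (r + k + j))" for q
  proof -
    have q: "q \<in> codes e" "\<forall>i<Suc (r + k + j). q i = p i" using that by (auto simp: cyl_def)
    have "code_modulus q j = code_modulus p j" using q(2) by (simp add: code_modulus_def)
    moreover have "code_seq e q (r + i) = code_seq e p (r + i)" if "i < k" for i
      by (rule code_seq_cong[OF q(2)]) (use that in simp)
    then have "(\<Sum>i<k. a i *\<^sub>R code_seq e q (r + i)) = (\<Sum>i<k. a i *\<^sub>R code_seq e p (r + i))"
      by simp
    ultimately have "\<bar>norm (\<Sum>i<k. a i *\<^sub>R code_seq e p (r + i)) - spread_norm (code_seq e q) k a\<bar> \<le> A / real (Suc j)"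
      using approx[OF q(1)] by simp
    then show ?thesis using approx[OF p refl] j by linarith
  qed
  then show ?thesis by blast
qed

definition code_dominated :: "(nat \<Rightarrow> 'a::real_normed_vector) \<Rightarrow> nat \<Rightarrow> code \<Rightarrow> code \<Rightarrow> bool"
  where "code_dominated e m p q \<longleftrightarrow>
    (\<forall>k a. spread_norm (code_seq e p) k a \<le> real m * spread_norm (code_seq e q) k a)"

text \<open>Failure of domination with constant m shows as a strict gap on a single vector, and the
  two spreading norms of that vector depend continuously on the codes.\<close>

lemma codes_closed_preorder: "closed_preorder (codes e) (code_dominated e)"
proof
  show "p \<in> codes e" if "\<And>n. cyl (codes e) p n \<noteq> {}" for p
    using that by (rule codes_closed)
  show "code_dominated e m' p q"
    if "p \<in> codes e" "q \<in> codes e" "code_dominated e m p q" "m \<le> m'" for m m' p q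
    unfolding code_dominated_def
  proof (intro allI)
    fix k a
    have "real m * spread_norm (code_seq e q) k a \<le> real m' * spread_norm (code_seq e q) k a"
      using that(4) spread_norm_nonneg[OF codesD(3)[OF that(2)]] by (intro mult_right_mono) auto
    then show "spread_norm (code_seq e p) k a \<le> real m' * spread_norm (code_seq e q) k a"
      using that(3) order_trans unfolding code_dominated_def by blast
  qed
  fix m p q assume p: "p \<in> codes e" and q: "q \<in> codes e" and "\<not> code_dominated e m p q"
  then obtain k a where ka: "real m * spread_norm (code_seq e q) k a < spread_norm (code_seq e p) k a"
    unfolding code_dominated_def by (auto simp: not_le)
  define g where "g = spread_norm (code_seq e p) k a - real m * spread_norm (code_seq e q) k a"
  \<comment> \<open>An error \<delta> on the left and m \<delta> on the right add up to half of the
    gap.\<close>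
  define \<delta> where "\<delta> = g / (2 * (1 + real m))"
  have g: "0 < g" using ka by (simp add: g_def)
  have "1 + real m \<noteq> 0" by linarith
  then have half: "(1 + real m) * \<delta> = g / 2" unfolding \<delta>_def by (simp add: divide_simps)
  have \<delta>: "0 < \<delta>" using g by (simp add: \<delta>_def)
  have \<delta>_less: "\<delta> + real m * \<delta> < g" using half g unfolding distrib_right by linarith
  obtain L L' where L: "\<forall>p'\<in>cyl (codes e) p L. \<bar>spread_norm (code_seq e p') k a - spread_norm (code_seq e p) k a\<bar> \<le> \<delta>"
    and L': "\<forall>q'\<in>cyl (codes e) q L'. \<bar>spread_norm (code_seq e q') k a - spread_norm (code_seq e q) k a\<bar> \<le> \<delta>"
    using spread_norm_code_continuous[OF p \<delta>] spread_norm_code_continuous[OF q \<delta>] by meson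
  have "\<not> code_dominated e m p' q'" if "p' \<in> cyl (codes e) p (max L L')" "q' \<in> cyl (codes e) q (max L L')" for p' q'
  proof
    assume "code_dominated e m p' q'"
    then have "spread_norm (code_seq e p') k a \<le> real m * spread_norm (code_seq e q') k a"
      unfolding code_dominated_def by blast
    moreover have "p' \<in> cyl (codes e) p L" "q' \<in> cyl (codes e) q L'" using that by (auto simp: cyl_def)
    then have "spread_norm (code_seq e p) k a - \<delta> \<le> spread_norm (code_seq e p') k a"
      "spread_norm (code_seq e q') k a \<le> spread_norm (code_seq e q) k a + \<delta>"
      using L L' by (simp_all add: abs_le_iff) (smt (verit))+
    moreover from this(2) have "real m * spread_norm (code_seq e q') k a \<le> real m * (spread_norm (code_seq e q) k a + \<delta>)"
      by (rule mult_left_mono) simp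
    ultimately show False using \<delta>_less by (simp add: g_def distrib_left)
  qed
  then show "\<exists>n. \<forall>p'\<in>cyl (codes e) p n. \<forall>q'\<in>cyl (codes e) q n. \<not> code_dominated e m p' q'" by blast
qed

section \<open>The class of l1, and codes for all other models\<close>

definition l1_like :: "(nat \<Rightarrow> 'b::real_normed_vector) \<Rightarrow> bool"
  where "l1_like y \<longleftrightarrow> (\<exists>\<delta>>0. \<forall>k a. \<delta> * (\<Sum>i<k. \<bar>a i\<bar>) \<le> norm (\<Sum>i<k. a i *\<^sub>R y i))"

lemma seminormalized_bounded:
  "seminormalized x \<Longrightarrow> \<exists>M. \<forall>n. norm (x n) \<le> M"
  unfolding seminormalized_def bdd_above_def by auto

text \<open>The l1 norm is the largest possible up to a constant. Applied in both directions, this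
  makes all l1-like models of seminormalized sequences equivalent, so they form at most one
  class.\<close>

lemma l1_like_dominates:
  assumes x: "spreading_model x y" "seminormalized x" and z: "l1_like z"
  shows "dominated y z"
proof -
  obtain M where M: "\<And>n. norm (x n) \<le> M" using seminormalized_bounded[OF x(2)] by blast
  have M0: "0 \<le> M" using M[of 0] norm_ge_zero order_trans by blast
  obtain \<phi> where \<phi>: "spreads x \<phi>" using spreading_model_spreads[OF x(1)] by blast
  obtain \<delta> where \<delta>: "0 < \<delta>" "\<And>k a. \<delta> * (\<Sum>i<k. \<bar>a i\<bar>) \<le> norm (\<Sum>i<k. a i *\<^sub>R z i)"
    using z unfolding l1_like_def by blast
  have "norm (\<Sum>i<k. a i *\<^sub>R y i) \<le> (M / \<delta> + 1) * norm (\<Sum>i<k. a i *\<^sub>R z i)" for k a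
  proof -
    have "norm (\<Sum>i<k. a i *\<^sub>R y i) \<le> M * (\<Sum>i<k. \<bar>a i\<bar>)"
      unfolding spreading_model_norm[OF x(1)] by (rule spread_norm_le[OF \<phi> M])
    also have "\<dots> = M / \<delta> * (\<delta> * (\<Sum>i<k. \<bar>a i\<bar>))" using \<delta>(1) by simp
    also have "\<dots> \<le> M / \<delta> * norm (\<Sum>i<k. a i *\<^sub>R z i)" using M0 \<delta> by (intro mult_left_mono) auto
    also have "\<dots> \<le> (M / \<delta> + 1) * norm (\<Sum>i<k. a i *\<^sub>R z i)" by (intro mult_right_mono) auto
    finally show ?thesis .
  qed
  moreover have "1 \<le> M / \<delta> + 1" using M0 \<delta>(1) by simp
  ultimately show ?thesis
    unfolding dominated_def atLeast0AtMost lessThan_Suc_atMost[symmetric] by blast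
qed

lemma ex_code:
  fixes e x :: "nat \<Rightarrow> 'a::banach"
  assumes e: "\<And>v \<epsilon>. 0 < \<epsilon> \<Longrightarrow> \<exists>n. norm (e n - v) \<le> \<epsilon>"
    and x: "seminormalized x" "weakly_null x" "spreading_model x y" and y: "\<not> l1_like y"
  shows "\<exists>p\<in>codes e. spreading_model (code_seq e p) y"
proof -
  obtain M where M: "\<And>n. norm (x n) \<le> M" using seminormalized_bounded[OF x(1)] by blast
  define \<beta> where "\<beta> = (INF n. norm (x n))"
  have \<beta>: "0 < \<beta>" using x(1) by (simp add: seminormalized_def \<beta>_def)
  have \<beta>_le: "\<beta> \<le> norm (x n)" for n unfolding \<beta>_def by (rule cINF_lower) (auto intro: bdd_belowI[of _ 0])
  \<comment> \<open>The factor \<beta>/2 keeps all norms at least \<beta>/2; the factors 1/2^n make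
    the perturbation summable, so that y remains the model.\<close>
  have "\<exists>c. norm (e c - x n) \<le> \<beta> / 2 / 2 ^ n" for n by (rule e) (use \<beta> in simp)
  then obtain c where c: "\<And>n. norm (e (c n) - x n) \<le> \<beta> / 2 / 2 ^ n" by metis
  define x' where "x' n = e (c n)" for n
  have "\<beta> / 2 / 2 ^ n \<le> \<beta> / 2 / 1" for n using \<beta> by (intro divide_left_mono) auto
  then have near: "norm (x' n - x n) \<le> \<beta> / 2" for n
    using order_trans[OF c[of n], of "\<beta> / 2"] by (simp add: x'_def)
  have x'_le: "norm (x' n) \<le> M + \<beta> / 2" for n
    using norm_triangle_ineq[of "x' n - x n" "x n"] near[of n] M[of n] by simp
  have x'_ge: "\<beta> / 2 \<le> norm (x' n)" for n
    using norm_triangle_ineq2[of "x n" "x' n"] near[of n] \<beta>_le[of n] by (simp add: norm_minus_commute)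
  have x'y: "spreading_model x' y"
    by (rule spreading_model_perturb[OF x(3), of _ "\<beta> / 2"]) (use c in \<open>simp add: x'_def\<close>)
  obtain \<phi> where \<phi>: "spreads x' \<phi>" using spreading_model_spreads[OF x'y] by blast
  obtain \<phi>0 where \<phi>0: "spreads x \<phi>0" using spreading_model_spreads[OF x(3)] by blast
  have "\<exists>T\<ge>1. \<forall>n. strict_mono n \<and> T \<le> n 0 \<longrightarrow> norm (\<Sum>i<T. x' (n i)) \<le> real T / real (Suc j)" for j
  proof -
    define \<delta> where "\<delta> = 1 / (2 * real (Suc j))"
    \<comment> \<open>From \<open>\<phi> 0\<close> on, the modulus guarantees an error of at most 1,
      and \<open>2 * Suc j\<close> makes 1 at most \<delta> T. Together the norm of the sum is at
      most 2 \<delta> T = T/(j+1).\<close>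
    define T0 where "T0 = max (\<phi> 0) (2 * Suc j)"
    have "\<exists>T\<ge>T0. spread_norm x T (\<lambda>_. 1) < \<delta> * real T"
    proof (rule ccontr)
      assume "\<not> ?thesis"
      then have "\<And>T. T \<ge> T0 \<Longrightarrow> \<delta> * real T \<le> spread_norm x T (\<lambda>_. 1)" by (auto simp: not_less)
      from weakly_null_spread_norm_ge_l1[OF x(2) \<phi>0 M this]
      have "\<delta> * (\<Sum>i<k. \<bar>a i\<bar>) \<le> 2 * norm (\<Sum>i<k. a i *\<^sub>R y i)" for k a
        by (simp add: spreading_model_norm[OF x(3)])
      then have "l1_like y" unfolding l1_like_def
        by (intro exI[of _ "\<delta> / 2"]) (auto simp: \<delta>_def field_simps)
      then show False using y by blast
    qed
    then obtain T where T: "T \<ge> T0" "spread_norm x T (\<lambda>_. 1) < \<delta> * real T" by blast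
    have "norm (\<Sum>i<T. x' (n i)) \<le> real T / real (Suc j)" if n: "strict_mono n" "T \<le> n 0" for n
    proof -
      have "\<bar>norm (\<Sum>i<T. 1 *\<^sub>R x' (n i)) - spread_norm x' T (\<lambda>_. 1)\<bar> \<le> 1 / real (Suc 0)"
        by (rule spread_norm_approx[OF \<phi> n(1)]) (use n T(1) in \<open>auto simp: T0_def\<close>)
      then have "norm (\<Sum>i<T. x' (n i)) \<le> spread_norm x' T (\<lambda>_. 1) + 1" by simp
      moreover have "spread_norm x' T (\<lambda>_. 1) = spread_norm x T (\<lambda>_. 1)"
        using spreading_model_norm[OF x'y, of "\<lambda>_. 1" T] spreading_model_norm[OF x(3), of "\<lambda>_. 1" T] by simp
      moreover have "1 \<le> \<delta> * real T"
        using T(1) by (simp add: \<delta>_def T0_def field_simps)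
      ultimately have "norm (\<Sum>i<T. x' (n i)) \<le> 2 * (\<delta> * real T)" using T(2) by linarith
      also have "\<dots> = real T / real (Suc j)" by (simp add: \<delta>_def del: of_nat_Suc)
      finally show ?thesis .
    qed
    moreover have "1 \<le> T" using T(1) by (simp add: T0_def)
    ultimately show ?thesis by blast
  qed
  then obtain K where K: "\<And>j. 1 \<le> K j"
    "\<And>j n. strict_mono n \<Longrightarrow> K j \<le> n 0 \<Longrightarrow> norm (\<Sum>i<K j. x' (n i)) \<le> real (K j) / real (Suc j)" by metis
  obtain b :: nat where b: "max (M + \<beta> / 2) (2 / \<beta>) \<le> real b" using real_arch_simple by blast
  define p :: code where "p n = (c n, \<phi> n, K n, b)" for n
  have p: "code_seq e p = x'" "code_modulus p = \<phi>" "code_average p = K" "code_bound p = real (Suc b)"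
    by (auto simp: p_def code_seq_def code_modulus_def code_average_def code_bound_def x'_def)
  have "norm (x' n) \<le> real (Suc b)" for n using x'_le[of n] b by simp
  moreover have "1 / real (Suc b) \<le> norm (x' n)" for n
  proof -
    have "1 / real (Suc b) \<le> 1 / (2 / \<beta>)" using b \<beta> by (intro divide_left_mono) auto
    then show ?thesis using x'_ge[of n] by simp
  qed
  ultimately have "p \<in> codes e" unfolding codes_def mem_Collect_eq p using \<phi> K by blast
  then show ?thesis using x'y p(1) by blast
qed

section \<open>From codes to classes of spreading models\<close>

lemma dominated_refl: "dominated y y"
  unfolding dominated_def by (intro exI[of _ 1]) auto

lemma dominated_trans:
  assumes "dominated x y" "dominated y z"
  shows "dominated x z"
proof -
  obtain C D where C: "C \<ge> 1" "\<And>k a. norm (\<Sum>n=0..k. a n *\<^sub>R x n) \<le> C * norm (\<Sum>n=0..k. a n *\<^sub>R y n)"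
    and D: "D \<ge> 1" "\<And>k a. norm (\<Sum>n=0..k. a n *\<^sub>R y n) \<le> D * norm (\<Sum>n=0..k. a n *\<^sub>R z n)"
    using assms unfolding dominated_def by blast
  have "norm (\<Sum>n=0..k. a n *\<^sub>R x n) \<le> C * D * norm (\<Sum>n=0..k. a n *\<^sub>R z n)" for k a
    using order_trans[OF C(2)[of a k] mult_left_mono[OF D(2)[of a k], of C]] C(1) by (simp add: mult.assoc)
  moreover have "1 \<le> C * D" using C(1) D(1) mult_mono[of 1 C 1 D] by simp
  ultimately show ?thesis unfolding dominated_def by blast
qed

text \<open>Every model gets a label: \<open>None\<close> if it is l1-like, otherwise
  \<open>Some q\<close> for a representative q in S of one of its codes. Models with equal labels
  dominate each other, so a class is determined by its label.\<close>

lemma countable_SPw: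
  fixes e :: "nat \<Rightarrow> 'a::banach"
  assumes e: "\<And>v \<epsilon>. 0 < \<epsilon> \<Longrightarrow> \<exists>n. norm (e n - v) \<le> \<epsilon>"
    and S: "countable S" "S \<subseteq> codes e"
      "\<And>p. p \<in> codes e \<Longrightarrow> \<exists>q\<in>S. spread_dominated (code_seq e p) (code_seq e q) \<and> spread_dominated (code_seq e q) (code_seq e p)"
  shows "countable (SPw TYPE('a))"
proof -
  let ?W = "wn_spreading_models TYPE('a)"
  define E where "E = {(y, z). y \<in> ?W \<and> z \<in> ?W \<and> seq_equivalent y z}"
  define classified where "classified t y \<longleftrightarrow> (case t of None \<Rightarrow> l1_like y
      | Some q \<Rightarrow> \<exists>p\<in>codes e. spreading_model (code_seq e p) y \<and>
          spread_dominated (code_seq e p) (code_seq e q) \<and> spread_dominated (code_seq e q) (code_seq e p))"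
    for t and y :: "nat \<Rightarrow> linfty"
  have "\<exists>t. t \<in> insert None (Some ` S) \<and> classified t y" if y: "y \<in> ?W" for y
  proof (cases "l1_like y")
    case True
    then have "classified None y" by (simp add: classified_def)
    then show ?thesis by blast
  next
    case False
    obtain x :: "nat \<Rightarrow> 'a" where "seminormalized x" "weakly_null x" "spreading_model x y"
      using y unfolding wn_spreading_models_def by blast
    then obtain p where p: "p \<in> codes e" "spreading_model (code_seq e p) y" using ex_code[OF e _ _ _ False] by blast
    then obtain q where "q \<in> S" "spread_dominated (code_seq e p) (code_seq e q)" "spread_dominated (code_seq e q) (code_seq e p)"
      using S(3) by blast
    then have "classified (Some q) y" using p by (auto simp: classified_def)
    then show ?thesis using \<open>q \<in> S\<close> by blast
  qed
  then have "\<forall>y\<in>?W. \<exists>t. t \<in> insert None (Some ` S) \<and> classified t y" by blast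
  then obtain h where h: "\<And>y. y \<in> ?W \<Longrightarrow> h y \<in> insert None (Some ` S)" "\<And>y. y \<in> ?W \<Longrightarrow> classified (h y) y"
    by (auto dest!: bchoice)
  have dom: "dominated y z" if y: "y \<in> ?W" and z: "z \<in> ?W" and eq: "h y = h z" for y z
  proof (cases "h z")
    case None
    obtain x :: "nat \<Rightarrow> 'a" where "seminormalized x" "spreading_model x y"
      using y unfolding wn_spreading_models_def by blast
    then show ?thesis using l1_like_dominates h(2)[OF z] None by (auto simp: classified_def)
  next
    case (Some q)
    obtain p p' where "spreading_model (code_seq e p) y" "spread_dominated (code_seq e p) (code_seq e q)"
      "spreading_model (code_seq e p') z" "spread_dominated (code_seq e q) (code_seq e p')"
      using h(2)[OF y] h(2)[OF z] eq Some by (auto simp: classified_def)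
    then show ?thesis using dominated_iff_spread_dominated spread_dominated_trans by blast
  qed
  define g where "g t = E `` {SOME y. y \<in> ?W \<and> h y = t}" for t
  have "E `` {y} = g (h y)" if y: "y \<in> ?W" for y
  proof -
    define y' where "y' = (SOME y'. y' \<in> ?W \<and> h y' = h y)"
    have y': "y' \<in> ?W" "h y' = h y" unfolding y'_def using someI[of "\<lambda>y'. y' \<in> ?W \<and> h y' = h y" y] y by auto
    have "dominated y y'" "dominated y' y" using dom y y' by auto
    then have "seq_equivalent y z \<longleftrightarrow> seq_equivalent y' z" for z :: "nat \<Rightarrow> linfty"
      unfolding seq_equivalent_def using dominated_trans by blast
    then have "E `` {y} = E `` {y'}" using y y'(1) by (auto simp: E_def)
    then show ?thesis by (simp add: g_def y'_def)
  qed
  then have "E `` {y} \<in> g ` insert None (Some ` S)" if "y \<in> ?W" for y using h(1)[OF that] that by blast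
  then have "SPw TYPE('a) \<subseteq> g ` insert None (Some ` S)"
    unfolding SPw_def E_def[symmetric] by (auto elim!: quotientE simp del: image_insert)
  moreover have "countable (g ` insert None (Some ` S))" using S(1) by simp
  ultimately show ?thesis by (rule countable_subset)
qed

lemma antichain_in_SPw:
  fixes f :: "nat set \<Rightarrow> nat \<Rightarrow> 'a::banach"
  assumes f: "\<And>A. weakly_null (f A)" "\<And>A. seminormalized (f A)" "\<And>A. \<exists>\<phi>. spreads (f A) \<phi>"
    and incomp: "\<And>A B. A \<noteq> B \<Longrightarrow> \<not> spread_dominated (f A) (f B)"
  shows "\<exists>\<A>\<subseteq>SPw TYPE('a). \<A> \<approx> (UNIV :: nat set set) \<and> pairwise incomparable \<A>"
proof -
  let ?W = "wn_spreading_models TYPE('a)"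
  define E where "E = {(y, z). y \<in> ?W \<and> z \<in> ?W \<and> seq_equivalent y z}"
  have "\<exists>y :: nat \<Rightarrow> linfty. spreading_model (f A) y" for A
  proof -
    obtain \<phi> where "spreads (f A) \<phi>" using f(3) by blast
    moreover obtain M where "\<And>n. norm (f A n) \<le> M" using seminormalized_bounded[OF f(2)] by blast
    ultimately show ?thesis using spreads_realized by blast
  qed
  then obtain y :: "nat set \<Rightarrow> nat \<Rightarrow> linfty" where y: "\<And>A. spreading_model (f A) (y A)" by metis
  have yW: "y A \<in> ?W" for A unfolding wn_spreading_models_def using f y by blast
  have not_dom: "\<not> dominated (y A) (y B)" if "A \<noteq> B" for A B
    using incomp[OF that] dominated_iff_spread_dominated[OF y y] by simp
  define cls where "cls A = E `` {y A}" for A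
  \<comment> \<open>\<open>class_dominated\<close> speaks of some representatives; transitivity
    brings the domination back to \<open>y A\<close> and \<open>y B\<close>.\<close>
  have not_cls: "\<not> class_dominated (cls A) (cls B)" if "A \<noteq> B" for A B
  proof
    assume "class_dominated (cls A) (cls B)"
    then obtain u v where "u \<in> cls A" "v \<in> cls B" "dominated u v" unfolding class_dominated_def by blast
    then have "dominated (y A) u" "dominated u v" "dominated v (y B)"
      by (auto simp: cls_def E_def seq_equivalent_def)
    then show False using not_dom[OF that] dominated_trans by blast
  qed
  have self: "y A \<in> cls A" for A using yW by (simp add: cls_def E_def seq_equivalent_def dominated_refl)
  have "inj cls"
  proof (rule injI, rule ccontr)
    fix A B assume eq: "cls A = cls B" and ne: "A \<noteq> B"
    have "class_dominated (cls A) (cls A)"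
      unfolding class_dominated_def using self[of A] dominated_refl[of "y A"] by (intro bexI)
    then show False using not_cls[OF ne] eq by simp
  qed
  then have "range cls \<approx> (UNIV :: nat set set)" by (rule inj_on_image_eqpoll_self)
  moreover have "range cls \<subseteq> SPw TYPE('a)"
  proof (rule image_subsetI)
    fix A show "cls A \<in> SPw TYPE('a)"
      unfolding SPw_def E_def[symmetric] cls_def using yW[of A] by (rule quotientI)
  qed
  moreover have "incomparable (cls A) (cls B)" if "cls A \<noteq> cls B" for A B
    using not_cls[of A B] not_cls[of B A] that unfolding incomparable_def by (cases "A = B") auto
  then have "pairwise incomparable (range cls)" unfolding pairwise_def by fast
  ultimately show ?thesis by (intro exI[of _ "range cls"] conjI)
qed

theorem corollary2:
  assumes "separable_space (euclidean :: 'a::banach topology)"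
    and "uncountable (SPw TYPE('a))"
  shows "\<exists>\<A> \<subseteq> SPw TYPE('a). \<A> \<approx> (UNIV :: nat set set) \<and> pairwise incomparable \<A>"
proof -
  obtain D :: "'a set" where D: "countable D" "closure D = UNIV"
    using assms(1) unfolding separable_space_def by auto
  define e where "e = from_nat_into D"
  have e: "\<exists>n. norm (e n - v) \<le> \<epsilon>" if \<epsilon>: "0 < \<epsilon>" for v \<epsilon>
  proof -
    have "v \<in> closure D" using D(2) by simp
    then obtain d where d: "d \<in> D" "dist d v < \<epsilon>" using \<epsilon> closure_approachable by blast
    then obtain n where "e n = d" using from_nat_into_surj[OF D(1)] unfolding e_def by blast
    then show ?thesis using d(2) by (intro exI[of _ n]) (simp add: dist_norm)
  qed
  interpret closed_preorder_uncountable "codes e" "code_dominated e"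
    "\<lambda>p q. spread_dominated (code_seq e p) (code_seq e q)"
  proof (intro closed_preorder_uncountable.intro closed_preorder_uncountable_axioms.intro codes_closed_preorder)
    show "spread_dominated (code_seq e p) (code_seq e q) \<longleftrightarrow> (\<exists>m. code_dominated e m p q)" for p q
      by (simp add: spread_dominated_def code_dominated_def)
    show "spread_dominated (code_seq e p) (code_seq e p)" for p by (rule spread_dominated_refl)
    show "spread_dominated (code_seq e p) (code_seq e r)"
      if "spread_dominated (code_seq e p) (code_seq e q)" "spread_dominated (code_seq e q) (code_seq e r)" for p q r
      using that by (rule spread_dominated_trans)
    show "\<exists>p\<in>codes e. \<forall>q\<in>S. \<not> (spread_dominated (code_seq e p) (code_seq e q) \<and>
        spread_dominated (code_seq e q) (code_seq e p))" if S: "S \<subseteq> codes e" "countable S" for S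
    proof (rule ccontr)
      assume "\<not> ?thesis"
      \<comment> \<open>A countable set of codes representing all codes would leave only countably
        many classes of models, l1 included.\<close>
      then have "countable (SPw TYPE('a))" by (intro countable_SPw[OF e S(2,1)]) auto
      then show False using assms(2) by simp
    qed
  qed
  have code: "weakly_null (code_seq e p)" "seminormalized (code_seq e p)" "\<exists>\<phi>. spreads (code_seq e p) \<phi>"
    if "p \<in> codes e" for p
    using weakly_null_code_seq seminormalized_code_seq codesD(3) that by blast+
  from antichain_or_increasing show ?thesis
  proof (elim disjE exE conjE)
    fix f :: "nat set \<Rightarrow> code"
    assume "\<forall>A. f A \<in> codes e"
      "\<forall>A B. A \<noteq> B \<longrightarrow> \<not> spread_dominated (code_seq e (f A)) (code_seq e (f B))"
    then show ?thesis using code by (intro antichain_in_SPw[of "\<lambda>A. code_seq e (f A)"]) auto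
  next
    fix s :: "nat \<Rightarrow> code"
    assume s: "\<forall>i. s i \<in> codes e \<and> spread_dominated (code_seq e (s i)) (code_seq e (s (Suc i))) \<and>
      \<not> spread_dominated (code_seq e (s (Suc i))) (code_seq e (s i))"
    have "\<exists>f :: nat set \<Rightarrow> nat \<Rightarrow> 'a. (\<forall>A. weakly_null (f A) \<and> seminormalized (f A) \<and> (\<exists>\<phi>. spreads (f A) \<phi>)) \<and>
       (\<forall>A B. A \<noteq> B \<longrightarrow> \<not> spread_dominated (f A) (f B))"
      by (rule antichain_of_increasing[of "\<lambda>i. code_seq e (s i)" "\<lambda>i. code_modulus (s i)" "\<lambda>i. code_bound (s i)"])
         (use s code(1) codesD(1,3) in blast)+
    then show ?thesis using antichain_in_SPw by blast
  qed
qed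

end
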